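(* Let $m':[0,1]\to[0,1]$ be any convex function satisfying $m'(\alpha)\le m(\alpha)$ for all $\alpha\in[0,1]$. Then for the family of groups $G_n = \mathbb{F}_2^n$ ($n\ge 1$), the threshold density for corners satisfies $M(\alpha)\ge m'(\alpha)$ for every $\alpha\in[0,1]$.
   Context: Corners and $S_d$: for a finite abelian group $G$ with $|G| = N$, a subset $A \subset G\times G$ and $d \in G$, let $S_d = \{(x,y) \in G\times G : (x,y),\,(x+d,y),\,(x,y+d) \in A\}$. The density of $A$ is $|A|/N^2$. Threshold density: for a family of finite abelian groups and $\alpha\in[0,1]$, $M(\alpha)$ is the largest $M \in [0,1]$ such that for every $\epsilon > 0$ there is an $N_0$ such that for all groups $G$ in the family with $|G| = N \ge N_0$ and all subsets $A \subset G\times G$ of density at least $\alpha$, there is a $d \in G\setminus\{0\}$ with $|S_d| > (M-\epsilon)N^2$. Piecewise constant functions: $f:[0,1]^3\to[0,1]$ is piecewise constant if there are a positive integer $r$ and real numbers $0=x_0\le x_1\le\dots\le x_r=1$, $0=y_0\le\dots\le y_r=1$, $0=z_0\le\dots\le z_r=1$ such that $f$ is constant on $[x_i,x_{i+1})\times[y_j,y_{j+1})\times[z_k,z_{k+1})$ for all $0\le i,j,k\le r-1$. For such $f$ define $$T(f) = \int_0^1\int_0^1\int_0^1 \left(\int_0^1 f(x,y,z')\,dz'\right)\left(\int_0^1 f(x,y',z)\,dy'\right)\left(\int_0^1 f(x',y,z)\,dx'\right)dx\,dy\,dz,$$ and for $\alpha\in[0,1]$ define $m(\alpha) = \inf_f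 T(f)$, the infimum over all piecewise constant $f:[0,1]^3\to[0,1]$ with $\int_0^1\int_0^1\int_0^1 f(x,y,z)\,dx\,dy\,dz = \alpha$. *)

theory Defs
  imports
    "HOL-Analysis.Analysis"
    "HOL-Algebra.Elementary_Groups"
    "HOL-Algebra.Product_Groups"
begin

text \<open>Groups are HOL-Algebra records, so \<open>\<otimes>\<close> and \<open>\<one>\<close> play the roles of \<open>+\<close> and \<open>0\<close>.\<close>

definition corner_set :: "'a monoid \<Rightarrow> ('a \<times> 'a) set \<Rightarrow> 'a \<Rightarrow> ('a \<times> 'a) set" where
  "corner_set G A d =
     {(x, y) \<in> carrier G \<times> carrier G.
        (x, y) \<in> A \<and> (x \<otimes>\<^bsub>G\<^esub> d, y) \<in> A \<and> (x, y \<otimes>\<^bsub>G\<^esub> d) \<in> A}"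

definition pair_density :: "'a monoid \<Rightarrow> ('a \<times> 'a) set \<Rightarrow> real" where
  "pair_density G A = real (card A) / real (order G) ^ 2"

definition popular_corner_bound :: "'a monoid set \<Rightarrow> real \<Rightarrow> real \<Rightarrow> bool" where
  "popular_corner_bound \<G> \<alpha> M \<longleftrightarrow>
     (\<forall>\<epsilon>>0. \<exists>N\<^sub>0. \<forall>G\<in>\<G>. order G \<ge> N\<^sub>0 \<longrightarrow>
        (\<forall>A \<subseteq> carrier G \<times> carrier G. pair_density G A \<ge> \<alpha> \<longrightarrow>
           (\<exists>d \<in> carrier G - {\<one>\<^bsub>G\<^esub>}.
              real (card (corner_set G A d)) > (M - \<epsilon>) * real (order G) ^ 2)))"

text \<open>The family \<open>\<G>\<close> is meant to consist of finite abelian groups; the maximum is then attained,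
  see \<open>threshold_density_greatest\<close> below.\<close>

definition threshold_density :: "'a monoid set \<Rightarrow> real \<Rightarrow> real" where
  "threshold_density \<G> \<alpha> = (GREATEST M. M \<in> {0..1} \<and> popular_corner_bound \<G> \<alpha> M)"

lemma popular_corner_bound_zero:
  assumes fin: "\<And>G. G \<in> \<G> \<Longrightarrow> comm_group G \<and> finite (carrier G)"
  shows "popular_corner_bound \<G> \<alpha> 0"
  unfolding popular_corner_bound_def
proof (intro allI impI exI[of _ 2] ballI)
  fix \<epsilon> :: real and G A
  assume \<epsilon>: "\<epsilon> > 0" and G: "G \<in> \<G>" "2 \<le> order G"
  have "carrier G - {\<one>\<^bsub>G\<^esub>} \<noteq> {}"
  proof
    assume "carrier G - {\<one>\<^bsub>G\<^esub>} = {}"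
    then have "card (carrier G) \<le> card {\<one>\<^bsub>G\<^esub>}"
      by (intro card_mono) auto
    then show False using G by (simp add: order_def)
  qed
  then obtain d where "d \<in> carrier G - {\<one>\<^bsub>G\<^esub>}" by blast
  moreover have "(0 - \<epsilon>) * real (order G) ^ 2 < 0"
    using \<epsilon> G by (simp add: mult_neg_pos)
  ultimately show "\<exists>d \<in> carrier G - {\<one>\<^bsub>G\<^esub>}.
      real (card (corner_set G A d)) > (0 - \<epsilon>) * real (order G) ^ 2"
    by (meson of_nat_0_le_iff less_le_trans)
qed

lemma popular_corner_bound_limit:
  assumes "\<And>\<delta>. \<delta> > 0 \<Longrightarrow> \<exists>M'>M - \<delta>. popular_corner_bound \<G> \<alpha> M'"
  shows "popular_corner_bound \<G> \<alpha> M"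
  unfolding popular_corner_bound_def
proof (intro allI impI)
  fix \<epsilon> :: real assume \<epsilon>: "\<epsilon> > 0"
  obtain M' where M': "M' > M - \<epsilon> / 2" "popular_corner_bound \<G> \<alpha> M'"
    using assms[of "\<epsilon> / 2"] \<epsilon> by auto
  obtain N\<^sub>0 where N: "\<And>G A. G \<in> \<G> \<Longrightarrow> order G \<ge> N\<^sub>0 \<Longrightarrow> A \<subseteq> carrier G \<times> carrier G \<Longrightarrow>
      pair_density G A \<ge> \<alpha> \<Longrightarrow> \<exists>d \<in> carrier G - {\<one>\<^bsub>G\<^esub>}.
        real (card (corner_set G A d)) > (M' - \<epsilon> / 2) * real (order G) ^ 2"
    using M'(2) \<epsilon> unfolding popular_corner_bound_def by (meson half_gt_zero)
  have "(M - \<epsilon>) * real (order G) ^ 2 \<le> (M' - \<epsilon> / 2) * real (order G) ^ 2" for G :: "'a monoid"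
    using M'(1) by (intro mult_right_mono) auto
  then show "\<exists>N\<^sub>0. \<forall>G\<in>\<G>. order G \<ge> N\<^sub>0 \<longrightarrow>
        (\<forall>A \<subseteq> carrier G \<times> carrier G. pair_density G A \<ge> \<alpha> \<longrightarrow>
           (\<exists>d \<in> carrier G - {\<one>\<^bsub>G\<^esub>}.
              real (card (corner_set G A d)) > (M - \<epsilon>) * real (order G) ^ 2))"
    using N by (meson le_less_trans)
qed

lemma threshold_density_greatest:
  assumes "\<And>G. G \<in> \<G> \<Longrightarrow> comm_group G \<and> finite (carrier G)"
  shows "threshold_density \<G> \<alpha> \<in> {0..1}"
    and "popular_corner_bound \<G> \<alpha> (threshold_density \<G> \<alpha>)"
    and "\<And>M. M \<in> {0..1} \<Longrightarrow> popular_corner_bound \<G> \<alpha> M \<Longrightarrow> M \<le> threshold_density \<G> \<alpha>"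
proof -
  let ?P = "\<lambda>M. M \<in> {0..1} \<and> popular_corner_bound \<G> \<alpha> M"
  define s where "s = Sup (Collect ?P)"
  have zero: "0 \<in> Collect ?P"
    using popular_corner_bound_zero[OF assms] by simp
  have bdd: "bdd_above (Collect ?P)" by (rule bdd_aboveI[of _ 1]) auto
  have upper: "M \<le> s" if "?P M" for M
    unfolding s_def using that bdd by (intro cSup_upper) auto
  have "s \<le> 1"
    unfolding s_def
  proof (rule cSup_least)
    show "Collect ?P \<noteq> {}" using zero by blast
  qed auto
  moreover have "popular_corner_bound \<G> \<alpha> s"
  proof (rule popular_corner_bound_limit)
    fix \<delta> :: real assume "\<delta> > 0"
    then have "s - \<delta> < Sup (Collect ?P)" by (simp add: s_def)
    then obtain M' where "M' \<in> Collect ?P" "s - \<delta> < M'"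
      using less_cSup_iff[OF _ bdd] zero by blast
    then show "\<exists>M'>s - \<delta>. popular_corner_bound \<G> \<alpha> M'" by auto
  qed
  ultimately have s: "?P s" using upper[of 0] zero by simp
  have "threshold_density \<G> \<alpha> = s"
    unfolding threshold_density_def by (rule Greatest_equality[where P = ?P, OF s upper])
  then show "threshold_density \<G> \<alpha> \<in> {0..1}"
    and "popular_corner_bound \<G> \<alpha> (threshold_density \<G> \<alpha>)"
    and "\<And>M. M \<in> {0..1} \<Longrightarrow> popular_corner_bound \<G> \<alpha> M \<Longrightarrow> M \<le> threshold_density \<G> \<alpha>"
    using s upper by auto
qed

definition F2_power :: "nat \<Rightarrow> (nat \<Rightarrow> int) monoid" where
  "F2_power n = product_group {..<n} (\<lambda>_. integer_mod_group 2)"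

lemma comm_group_F2_power: "comm_group (F2_power n)"
proof (rule group.group_comm_groupI)
  show "group (F2_power n)" by (simp add: F2_power_def)
qed (simp add: F2_power_def add.commute cong: restrict_cong)

lemma order_F2_power: "order (F2_power n) = 2 ^ n"
  by (simp add: order_def F2_power_def card_PiE carrier_integer_mod_group)

lemma finite_F2_power: "finite (carrier (F2_power n))"
  using order_F2_power[of n] by (intro card_ge_0_finite) (simp add: order_def)

definition partition01 :: "nat \<Rightarrow> (nat \<Rightarrow> real) \<Rightarrow> bool" where
  "partition01 r x \<longleftrightarrow> x 0 = 0 \<and> x r = 1 \<and> (\<forall>i<r. x i \<le> x (Suc i))"

text \<open>The cells are half-open, so the values on the faces where some coordinate is 1 are
  unconstrained (except to lie in the unit interval).\<close>

definition piecewise_constant :: "(real \<times> real \<times> real \<Rightarrow> real) \<Rightarrow> bool" where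
  "piecewise_constant f \<longleftrightarrow>
     f \<in> {0..1} \<times> {0..1} \<times> {0..1} \<rightarrow> {0..1} \<and>
     (\<exists>r>0. \<exists>x y z. partition01 r x \<and> partition01 r y \<and> partition01 r z \<and>
        (\<forall>i<r. \<forall>j<r. \<forall>k<r.
           f constant_on {x i..<x (Suc i)} \<times> {y j..<y (Suc j)} \<times> {z k..<z (Suc k)}))"

definition cube_integral :: "(real \<times> real \<times> real \<Rightarrow> real) \<Rightarrow> real" where
  "cube_integral f =
     integral {0..1} (\<lambda>x. integral {0..1} (\<lambda>y. integral {0..1} (\<lambda>z. f (x, y, z))))"

definition T_functional :: "(real \<times> real \<times> real \<Rightarrow> real) \<Rightarrow> real" where
  "T_functional f = cube_integral (\<lambda>(x, y, z).
     integral {0..1} (\<lambda>z'. f (x, y, z')) *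
     integral {0..1} (\<lambda>y'. f (x, y', z)) *
     integral {0..1} (\<lambda>x'. f (x', y, z)))"

definition m_function :: "real \<Rightarrow> real" where
  "m_function \<alpha> = (INF f \<in> {f. piecewise_constant f \<and> cube_integral f = \<alpha>}. T_functional f)"

end

theory Submission
  imports Defs
begin

text \<open>
  Let \<open>A\<close> be a subset of \<open>G \<times> G\<close>, where every element of \<open>G\<close> is its own inverse. For a corner
  \<open>(x, y)\<close>, \<open>(x + d, y)\<close>, \<open>(x, y + d)\<close> put \<open>z = x + y + d\<close>. Its three points are \<open>(x, y)\<close>,
  \<open>(y + z, y)\<close> and \<open>(x, x + z)\<close>, so that each depends on two of the variables \<open>x\<close>, \<open>y\<close>, \<open>z\<close>. Hence the
  corners whose difference lies in a subgroup \<open>H\<close> are the triangles of tripartite graphs, one on the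
  vertex classes \<open>a + H\<close>, \<open>b + H\<close>, \<open>a + b + H\<close> for each pair of cosets. It is enough to find \<open>H\<close>
  of bounded index such that the average of \<open>|S\<^sub>d|\<close> over \<open>d \<in> H\<close> is at least
  \<open>(m'(\<alpha>) - \<epsilon>) N\<^sup>2\<close>: when \<open>H\<close> is large, the difference \<open>0\<close> contributes little to this average.

  Two regularity properties are used. First, there is a partition of \<open>G\<close> such that the number of
  triangles hardly drops if each of the three edge indicators is replaced by its mean over the
  products of two cells (\<open>counting_lemma\<close>). Secondly, for such a partition and for \<open>x\<close>, \<open>y\<close> running
  through two of its cells, the sum \<open>x + y\<close> should be equidistributed, within the coset of \<open>H\<close> in
  which it lies, among the cells of the partition (\<open>uniform\<close>). By Fourier analysis this can be
  achieved by passing to a smaller subgroup (\<open>uniform_kernels_exist\<close>). The cells have to refine the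
  cosets of \<open>H\<close>, so repairing one property may destroy the other. The lemma
  \<open>regular_uniform_partition\<close> alternates the two repairs. The mean square of the edge densities grows
  by a fixed amount in each round, so the number of rounds is bounded independently of \<open>G\<close>.

  Given both properties, let \<open>F(x, y, z)\<close> be the density of \<open>A\<close> among all pairs whose two coordinates
  and whose sum lie in the cells of \<open>x\<close>, \<open>y\<close> and \<open>z\<close>. Equidistribution says that the density of \<open>A\<close>
  on a product of two cells is close to the average of \<open>F\<close> over the free coordinate. So the triangle
  density on three matching cosets is nearly \<open>T(f)\<close> for the step function \<open>f\<close> that lists the values of
  \<open>F\<close> on these cosets, and therefore it is nearly at least \<open>m'\<close> of the mean of \<open>F\<close> there. By
  convexity, the average of these bounds over all pairs of cosets is at least \<open>m'(\<beta>)\<close>, where \<open>\<beta>\<close> is the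
  total mean of \<open>F\<close>, which is close to the density of \<open>A\<close> (\<open>convex_bound_on_cosets\<close>).

  Finally \<open>m'(0) = 0\<close>, so the convex function \<open>m' \<ge> 0\<close> is nondecreasing, and since \<open>m' \<le> 1\<close> it
  increases from \<open>\<beta>\<close> to \<open>\<alpha> < 1\<close> by at most \<open>(\<alpha> - \<beta>) / (1 - \<alpha>)\<close>. At \<open>\<alpha> = 1\<close>, where \<open>m'\<close> may be
  discontinuous, \<open>A\<close> is the whole of \<open>G \<times> G\<close> and there is nothing to prove.
\<close>

section \<open>Means over the fibres of a labelling\<close>

text \<open>A bounded energy can only be increased by \<open>\<delta>\<close> a bounded number of times. The bound on the size of the
final state is an iterate of \<open>g\<close> and involves neither \<open>E\<close> nor the states, which makes it uniform over all
groups below.\<close>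

lemma energy_increment:
  fixes E :: "'s \<Rightarrow> real" and size :: "'s \<Rightarrow> nat" and g :: "nat \<Rightarrow> nat"
  assumes start: "I s\<^sub>0" "size s\<^sub>0 \<le> t\<^sub>0"
    and bounds: "\<And>s. I s \<Longrightarrow> 0 \<le> E s" "\<And>s. I s \<Longrightarrow> E s \<le> M"
    and "\<delta> > 0"
    and step: "\<And>s t. I s \<Longrightarrow> size s \<le> t \<Longrightarrow> \<not> good s \<Longrightarrow>
      \<exists>s'. I s' \<and> size s' \<le> g t \<and> E s' \<ge> E s + \<delta>"
  shows "\<exists>s. I s \<and> good s \<and> size s \<le> (MAX i\<in>{..nat \<lceil>M / \<delta>\<rceil>}. (g ^^ i) t\<^sub>0)"
proof (rule ccontr)
  define J where "J = nat \<lceil>M / \<delta>\<rceil>"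
  assume contra: "\<not> ?thesis"
  have "\<exists>s. I s \<and> size s \<le> (g ^^ i) t\<^sub>0 \<and> E s \<ge> real i * \<delta>" if "i \<le> Suc J" for i
    using that
  proof (induction i)
    case 0
    then show ?case using start bounds(1) by auto
  next
    case (Suc i)
    then obtain s where s: "I s" "size s \<le> (g ^^ i) t\<^sub>0" "E s \<ge> real i * \<delta>" by auto
    have "(g ^^ i) t\<^sub>0 \<le> (MAX i\<in>{..J}. (g ^^ i) t\<^sub>0)"
      using Suc.prems by (intro Max_ge) auto
    then have "\<not> good s" using contra s by (auto simp: J_def)
    from step[OF s(1,2) this] show ?case using s(3) by (force simp: algebra_simps)
  qed
  from this[of "Suc J"] obtain s where "I s" "E s \<ge> real (Suc J) * \<delta>" by blast
  moreover have "M / \<delta> < real (Suc J)" unfolding J_def by linarith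
  ultimately show False
    using bounds(2)[of s] \<open>\<delta> > 0\<close> by (simp add: pos_divide_less_eq)
qed

text \<open>The conditional expectation of \<open>g\<close> given the label \<open>\<tau>\<close>, for the uniform distribution on \<open>S\<close>, as a
function of the label. It is \<open>0\<close> for labels that do not occur.\<close>

definition fibre_mean :: "'s set \<Rightarrow> ('s \<Rightarrow> 'k) \<Rightarrow> ('s \<Rightarrow> real) \<Rightarrow> 'k \<Rightarrow> real" where
  "fibre_mean S \<tau> g k = (\<Sum>\<omega> \<in> {\<omega>\<in>S. \<tau> \<omega> = k}. g \<omega>) / real (card {\<omega>\<in>S. \<tau> \<omega> = k})"

definition fibre_energy :: "'s set \<Rightarrow> ('s \<Rightarrow> 'k) \<Rightarrow> ('s \<Rightarrow> real) \<Rightarrow> real" where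
  "fibre_energy S \<tau> g = (\<Sum>\<omega>\<in>S. (fibre_mean S \<tau> g (\<tau> \<omega>))\<^sup>2)"

text \<open>Measurability of \<open>u\<close> with respect to the partition of \<open>S\<close> by \<open>\<tau>\<close>. With a labelling in place of \<open>u\<close> it
says that \<open>\<tau>\<close> refines that labelling.\<close>

definition determined_by :: "'s set \<Rightarrow> ('s \<Rightarrow> 'k) \<Rightarrow> ('s \<Rightarrow> 'v) \<Rightarrow> bool" where
  "determined_by S \<tau> u \<longleftrightarrow> (\<forall>\<omega>\<in>S. \<forall>\<omega>'\<in>S. \<tau> \<omega> = \<tau> \<omega>' \<longrightarrow> u \<omega> = u \<omega>')"

lemma determined_byI:
  "(\<And>\<omega> \<omega>'. \<omega> \<in> S \<Longrightarrow> \<omega>' \<in> S \<Longrightarrow> \<tau> \<omega> = \<tau> \<omega>' \<Longrightarrow> u \<omega> = u \<omega>') \<Longrightarrow> determined_by S \<tau> u"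
  unfolding determined_by_def by blast

lemma determined_byD:
  "determined_by S \<tau> u \<Longrightarrow> \<omega> \<in> S \<Longrightarrow> \<omega>' \<in> S \<Longrightarrow> \<tau> \<omega> = \<tau> \<omega>' \<Longrightarrow> u \<omega> = u \<omega>'"
  unfolding determined_by_def by blast

lemma fibre_mean_nonneg: "(\<And>\<omega>. \<omega> \<in> S \<Longrightarrow> 0 \<le> g \<omega>) \<Longrightarrow> 0 \<le> fibre_mean S \<tau> g k"
  unfolding fibre_mean_def by (intro divide_nonneg_nonneg sum_nonneg) auto

lemma fibre_mean_le_one:
  assumes "\<And>\<omega>. \<omega> \<in> S \<Longrightarrow> g \<omega> \<le> 1"
  shows "fibre_mean S \<tau> g k \<le> 1"
proof -
  have "(\<Sum>\<omega> \<in> {\<omega>\<in>S. \<tau> \<omega> = k}. g \<omega>) \<le> (\<Sum>\<omega> \<in> {\<omega>\<in>S. \<tau> \<omega> = k}. 1)"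
    using assms by (intro sum_mono) auto
  then show ?thesis unfolding fibre_mean_def by (auto intro: divide_le_eq_1[THEN iffD2])
qed

lemma fibre_mean_reindex:
  assumes "bij_betw f {\<omega>\<in>S'. \<tau>' \<omega> = k'} {\<omega>\<in>S. \<tau> \<omega> = k}"
    and "\<And>\<omega>. g' \<omega> = g (f \<omega>)"
  shows "fibre_mean S' \<tau>' g' k' = fibre_mean S \<tau> g k"
  unfolding fibre_mean_def assms(2) sum.reindex_bij_betw[OF assms(1)] bij_betw_same_card[OF assms(1)] ..

lemma fibre_mean_tower:
  assumes fin: "finite S"
    and u: "determined_by S \<tau> u"
  shows "(\<Sum>\<omega>\<in>S. g \<omega> * u \<omega>) = (\<Sum>\<omega>\<in>S. fibre_mean S \<tau> g (\<tau> \<omega>) * u \<omega>)"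
proof -
  have "(\<Sum>\<omega> \<in> {\<omega>\<in>S. \<tau> \<omega> = k}. g \<omega> * u \<omega>) =
      (\<Sum>\<omega> \<in> {\<omega>\<in>S. \<tau> \<omega> = k}. fibre_mean S \<tau> g (\<tau> \<omega>) * u \<omega>)" if k: "k \<in> \<tau> ` S" for k
  proof -
    obtain w where w: "w \<in> S" "\<tau> w = k" using k by blast
    have c: "card {\<omega>\<in>S. \<tau> \<omega> = k} \<noteq> 0" using w fin by auto
    have uw: "u \<omega> = u w" if "\<omega> \<in> {\<omega>\<in>S. \<tau> \<omega> = k}" for \<omega>
      using that w by (intro determined_byD[OF u]) auto
    have "(\<Sum>\<omega> \<in> {\<omega>\<in>S. \<tau> \<omega> = k}. g \<omega> * u \<omega>) = (\<Sum>\<omega> \<in> {\<omega>\<in>S. \<tau> \<omega> = k}. g \<omega>) * u w"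
      unfolding sum_distrib_right by (rule sum.cong) (use uw in auto)
    also have "\<dots> = real (card {\<omega>\<in>S. \<tau> \<omega> = k}) * (fibre_mean S \<tau> g k * u w)"
      using c by (simp add: fibre_mean_def)
    also have "\<dots> = (\<Sum>\<omega> \<in> {\<omega>\<in>S. \<tau> \<omega> = k}. fibre_mean S \<tau> g k * u w)" by simp
    also have "\<dots> = (\<Sum>\<omega> \<in> {\<omega>\<in>S. \<tau> \<omega> = k}. fibre_mean S \<tau> g (\<tau> \<omega>) * u \<omega>)"
      by (rule sum.cong) (use uw in auto)
    finally show ?thesis .
  qed
  then show ?thesis
    unfolding sum.image_gen[OF fin, of "\<lambda>\<omega>. g \<omega> * u \<omega>" \<tau>]
      sum.image_gen[OF fin, of "\<lambda>\<omega>. fibre_mean S \<tau> g (\<tau> \<omega>) * u \<omega>" \<tau>]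
    by (rule sum.cong[OF refl])
qed

text \<open>Taking means over fibres is the orthogonal projection to the functions determined by the labelling, and
the projections of a refinement are nested.\<close>

lemma fibre_energy_pythagoras:
  assumes fin: "finite S"
    and refine: "determined_by S \<tau>' \<tau>"
  shows "(\<Sum>\<omega>\<in>S. (fibre_mean S \<tau>' g (\<tau>' \<omega>) - fibre_mean S \<tau> g (\<tau> \<omega>))\<^sup>2) =
    fibre_energy S \<tau>' g - fibre_energy S \<tau> g"
proof -
  let ?m = "\<lambda>\<omega>. fibre_mean S \<tau> g (\<tau> \<omega>)" and ?m' = "\<lambda>\<omega>. fibre_mean S \<tau>' g (\<tau>' \<omega>)"
  have "(\<Sum>\<omega>\<in>S. ?m' \<omega> * ?m \<omega>) = (\<Sum>\<omega>\<in>S. g \<omega> * ?m \<omega>)"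
  proof (rule fibre_mean_tower[OF fin, symmetric], rule determined_byI)
    fix \<omega> \<omega>' assume "\<omega> \<in> S" "\<omega>' \<in> S" "\<tau>' \<omega> = \<tau>' \<omega>'"
    from determined_byD[OF refine this] show "?m \<omega> = ?m \<omega>'" by (rule arg_cong)
  qed
  also have "\<dots> = (\<Sum>\<omega>\<in>S. ?m \<omega> * ?m \<omega>)" by (rule fibre_mean_tower[OF fin]) (simp add: determined_by_def)
  finally have cross: "(\<Sum>\<omega>\<in>S. ?m' \<omega> * ?m \<omega>) = fibre_energy S \<tau> g"
    by (simp add: fibre_energy_def power2_eq_square)
  have "(\<Sum>\<omega>\<in>S. (?m' \<omega> - ?m \<omega>)\<^sup>2) =
      fibre_energy S \<tau>' g + fibre_energy S \<tau> g - 2 * (\<Sum>\<omega>\<in>S. ?m' \<omega> * ?m \<omega>)"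
    unfolding fibre_energy_def
    by (simp add: power2_diff sum.distrib sum_subtractf sum_distrib_left mult.assoc)
  then show ?thesis using cross by simp
qed

lemma fibre_energy_mono:
  assumes "finite S"
    and "determined_by S \<tau>' \<tau>"
  shows "fibre_energy S \<tau> g \<le> fibre_energy S \<tau>' g"
  using fibre_energy_pythagoras[OF assms, of g]
    sum_nonneg[of S "\<lambda>\<omega>. (fibre_mean S \<tau>' g (\<tau>' \<omega>) - fibre_mean S \<tau> g (\<tau> \<omega>))\<^sup>2"] by simp

lemma fibre_energy_nonneg: "0 \<le> fibre_energy S \<tau> g"
  unfolding fibre_energy_def by (intro sum_nonneg) simp

lemma fibre_energy_le_card:
  assumes "\<And>\<omega>. \<omega> \<in> S \<Longrightarrow> 0 \<le> g \<omega> \<and> g \<omega> \<le> 1"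
  shows "fibre_energy S \<tau> g \<le> real (card S)"
proof -
  have "fibre_energy S \<tau> g \<le> (\<Sum>\<omega>\<in>S. 1)"
    unfolding fibre_energy_def using assms
    by (intro sum_mono) (simp add: power_le_one fibre_mean_nonneg fibre_mean_le_one)
  then show ?thesis by simp
qed

text \<open>The engine of both regularity arguments: if the error made by averaging over the fibres of \<open>\<tau>\<close>
correlates with a function that the finer labelling \<open>\<tau>'\<close> determines, then \<open>\<tau>'\<close> has larger energy. The
tower property replaces \<open>g\<close> by its finer mean, and Cauchy--Schwarz bounds what remains by the norm in
the Pythagorean identity.\<close>

lemma correlation_le_energy_gain:
  assumes fin: "finite S"
    and refine: "determined_by S \<tau>' \<tau>"
    and u: "determined_by S \<tau>' u"
    and u_le: "\<And>\<omega>. \<omega> \<in> S \<Longrightarrow> \<bar>u \<omega>\<bar> \<le> 1"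
  shows "(\<Sum>\<omega>\<in>S. (g \<omega> - fibre_mean S \<tau> g (\<tau> \<omega>)) * u \<omega>)\<^sup>2 \<le>
    real (card S) * (fibre_energy S \<tau>' g - fibre_energy S \<tau> g)"
proof -
  let ?m = "\<lambda>\<omega>. fibre_mean S \<tau> g (\<tau> \<omega>)" and ?m' = "\<lambda>\<omega>. fibre_mean S \<tau>' g (\<tau>' \<omega>)"
  have "(\<Sum>\<omega>\<in>S. (g \<omega> - ?m \<omega>) * u \<omega>) = (\<Sum>\<omega>\<in>S. (?m' \<omega> - ?m \<omega>) * u \<omega>)"
    using fibre_mean_tower[OF fin u, of g]
    by (simp add: left_diff_distrib sum_subtractf)
  then have "(\<Sum>\<omega>\<in>S. (g \<omega> - ?m \<omega>) * u \<omega>)\<^sup>2 \<le>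
      (\<Sum>\<omega>\<in>S. (?m' \<omega> - ?m \<omega>)\<^sup>2) * (\<Sum>\<omega>\<in>S. (u \<omega>)\<^sup>2)"
    using Cauchy_Schwarz_ineq_sum[of "\<lambda>\<omega>. ?m' \<omega> - ?m \<omega>" u S] by simp
  also have "(\<Sum>\<omega>\<in>S. (u \<omega>)\<^sup>2) \<le> (\<Sum>\<omega>\<in>S. 1)"
    using u_le by (intro sum_mono) (simp add: abs_square_le_1)
  then have "(\<Sum>\<omega>\<in>S. (?m' \<omega> - ?m \<omega>)\<^sup>2) * (\<Sum>\<omega>\<in>S. (u \<omega>)\<^sup>2) \<le>
      (\<Sum>\<omega>\<in>S. (?m' \<omega> - ?m \<omega>)\<^sup>2) * real (card S)"
    by (intro mult_left_mono sum_nonneg) auto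
  finally show ?thesis
    unfolding fibre_energy_pythagoras[OF fin refine] by (simp add: mult.commute)
qed

section \<open>Step functions on the unit cube\<close>

text \<open>The minimum puts the end point \<open>1\<close> into the last cell, so that the index is always in range.\<close>

definition grid_index :: "nat \<Rightarrow> real \<Rightarrow> nat" where
  "grid_index h x = min (h - 1) (nat \<lfloor>real h * x\<rfloor>)"

lemma grid_index_less: "h > 0 \<Longrightarrow> grid_index h x < h"
  by (auto simp: grid_index_def)

lemma grid_index_eq:
  assumes "i < h" "real i / real h \<le> x" "x < real (Suc i) / real h"
  shows "grid_index h x = i"
proof -
  have "real i \<le> real h * x" "real h * x < real i + 1"
    using assms by (simp_all add: field_simps)
  then have "\<lfloor>real h * x\<rfloor> = int i" by (simp add: floor_eq_iff)
  then show ?thesis using assms(1) by (simp add: grid_index_def)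
qed

lemma has_integral_grid_prefix:
  fixes g :: "nat \<Rightarrow> real"
  assumes "k \<le> h" "h > 0"
  shows "((\<lambda>x. g (grid_index h x)) has_integral (\<Sum>i<k. g i) / real h) {0..real k / real h}"
  using assms(1)
proof (induction k)
  case 0
  show ?case using has_integral_refl(2)[of "\<lambda>x. g (grid_index h x)" 0] by simp
next
  case (Suc k)
  let ?I = "{real k / real h..real (Suc k) / real h}"
  have "((\<lambda>x. g k) has_integral (real (Suc k) / real h - real k / real h) *\<^sub>R g k) ?I"
    using \<open>h > 0\<close> has_integral_const_real[of "g k" "real k / real h" "real (Suc k) / real h"]
    by (simp add: divide_right_mono)
  then have const: "((\<lambda>x. g k) has_integral g k / real h) ?I"
    by (simp add: diff_divide_distrib[symmetric])
  have "((\<lambda>x. g (grid_index h x)) has_integral g k / real h) ?I"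
  proof (rule has_integral_spike_finite[OF _ _ const])
    show "finite {real (Suc k) / real h}" by simp
    show "g (grid_index h x) = g k" if "x \<in> ?I - {real (Suc k) / real h}" for x
      using that Suc.prems grid_index_eq[of k h x] by auto
  qed
  from has_integral_combine[OF _ _ Suc.IH this]
  show ?case using Suc.prems \<open>h > 0\<close> by (simp add: divide_right_mono add_divide_distrib)
qed

lemma integral_grid:
  fixes g :: "nat \<Rightarrow> real"
  assumes "h > 0"
  shows "integral {0..1} (\<lambda>x. g (grid_index h x)) = (\<Sum>i<h. g i) / real h"
  using has_integral_grid_prefix[of h h g] assms by (simp add: integral_unique)

lemma cube_integral_grid:
  fixes g :: "nat \<Rightarrow> nat \<Rightarrow> nat \<Rightarrow> real"
  assumes "h > 0"
  shows "cube_integral (\<lambda>(x, y, z). g (grid_index h x) (grid_index h y) (grid_index h z)) =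
    (\<Sum>i<h. \<Sum>j<h. \<Sum>k<h. g i j k) / real h ^ 3"
proof -
  have "cube_integral (\<lambda>(x, y, z). g (grid_index h x) (grid_index h y) (grid_index h z)) =
    integral {0..1} (\<lambda>x. integral {0..1} (\<lambda>y. (\<Sum>k<h. g (grid_index h x) (grid_index h y) k) / real h))"
    unfolding cube_integral_def by (simp add: integral_grid[OF assms, where g = "\<lambda>k. g _ _ k"])
  also have "\<dots> = integral {0..1} (\<lambda>x. (\<Sum>j<h. (\<Sum>k<h. g (grid_index h x) j k) / real h) / real h)"
    by (simp only: integral_grid[OF assms, where g = "\<lambda>j. (\<Sum>k<h. g _ j k) / real h"])
  also have "\<dots> = (\<Sum>i<h. (\<Sum>j<h. (\<Sum>k<h. g i j k) / real h) / real h) / real h"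
    by (rule integral_grid[OF assms])
  finally show ?thesis by (simp add: sum_divide_distrib power3_eq_cube)
qed

text \<open>The integral of a function that is not integrable is \<open>0\<close> by convention. This gives a lower bound for
\<open>T_functional\<close>, needed for its infimum, without checking integrability.\<close>

lemma integral_nonneg_always:
  fixes g :: "real \<Rightarrow> real"
  assumes "\<And>x. x \<in> S \<Longrightarrow> 0 \<le> g x"
  shows "0 \<le> integral S g"
  using assms by (cases "g integrable_on S") (auto intro: integral_nonneg simp: not_integrable_integral)

lemma T_functional_nonneg:
  assumes "f \<in> {0..1} \<times> {0..1} \<times> {0..1} \<rightarrow> {0..1}"
  shows "0 \<le> T_functional f"
proof -
  have "0 \<le> f (x, y, z)" if "x \<in> {0..1}" "y \<in> {0..1}" "z \<in> {0..1}" for x y z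
    using assms that by fastforce
  then show ?thesis
    unfolding T_functional_def cube_integral_def split
    by (intro integral_nonneg_always mult_nonneg_nonneg)
qed

text \<open>An array of numbers in the unit interval is the list of values of a step function on the regular grid,
and the functional of this step function is a sum over the array.\<close>

lemma m_function_le_grid:
  fixes g :: "nat \<Rightarrow> nat \<Rightarrow> nat \<Rightarrow> real"
  assumes h: "h > 0"
    and g: "\<And>i j k. i < h \<Longrightarrow> j < h \<Longrightarrow> k < h \<Longrightarrow> g i j k \<in> {0..1}"
  shows "m_function ((\<Sum>i<h. \<Sum>j<h. \<Sum>k<h. g i j k) / real h ^ 3) \<le>
    (\<Sum>i<h. \<Sum>j<h. \<Sum>k<h.
      ((\<Sum>k'<h. g i j k') / real h) * ((\<Sum>j'<h. g i j' k) / real h) * ((\<Sum>i'<h. g i' j k) / real h))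
      / real h ^ 3"
proof -
  define f where "f = (\<lambda>(x, y, z). g (grid_index h x) (grid_index h y) (grid_index h z))"
  have pc: "piecewise_constant f"
    unfolding piecewise_constant_def
  proof (intro conjI exI)
    show "f \<in> {0..1} \<times> {0..1} \<times> {0..1} \<rightarrow> {0..1}"
      unfolding f_def using g grid_index_less[OF h] by auto
    have "partition01 h (\<lambda>i. real i / real h)"
      using h by (auto simp: partition01_def divide_right_mono)
    then show "partition01 h (\<lambda>i. real i / real h)" "partition01 h (\<lambda>i. real i / real h)"
      "partition01 h (\<lambda>i. real i / real h)" by this+
    show "\<forall>i<h. \<forall>j<h. \<forall>k<h. f constant_on
        {real i / real h..<real (Suc i) / real h} \<times> {real j / real h..<real (Suc j) / real h} \<times>
        {real k / real h..<real (Suc k) / real h}"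
      unfolding constant_on_def f_def
    proof (intro allI impI exI ballI)
      fix i j k w
      assume "i < h" "j < h" "k < h"
        and "w \<in> {real i / real h..<real (Suc i) / real h} \<times>
          {real j / real h..<real (Suc j) / real h} \<times> {real k / real h..<real (Suc k) / real h}"
      then show "(case w of (x, y, z) \<Rightarrow> g (grid_index h x) (grid_index h y) (grid_index h z)) = g i j k"
        by (auto simp del: of_nat_Suc simp: grid_index_eq)
    qed
  qed (use h in auto)
  have "cube_integral f = (\<Sum>i<h. \<Sum>j<h. \<Sum>k<h. g i j k) / real h ^ 3"
    unfolding f_def by (rule cube_integral_grid[OF h])
  moreover have "T_functional f = (\<Sum>i<h. \<Sum>j<h. \<Sum>k<h.
      ((\<Sum>k'<h. g i j k') / real h) * ((\<Sum>j'<h. g i j' k) / real h) * ((\<Sum>i'<h. g i' j k) / real h))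
      / real h ^ 3"
  proof -
    have "integral {0..1} (\<lambda>z'. f (x, y, z')) = (\<Sum>k'<h. g (grid_index h x) (grid_index h y) k') / real h"
      "integral {0..1} (\<lambda>y'. f (x, y', z)) = (\<Sum>j'<h. g (grid_index h x) j' (grid_index h z)) / real h"
      "integral {0..1} (\<lambda>x'. f (x', y, z)) = (\<Sum>i'<h. g i' (grid_index h y) (grid_index h z)) / real h"
      for x y z
      unfolding f_def split
      by (rule integral_grid[OF h, where g = "\<lambda>k. g _ _ k"],
          rule integral_grid[OF h, where g = "\<lambda>j. g _ j _"],
          rule integral_grid[OF h, where g = "\<lambda>i. g i _ _"])
    then show ?thesis
      unfolding T_functional_def
      using cube_integral_grid[OF h, of "\<lambda>i j k.
        ((\<Sum>k'<h. g i j k') / real h) * ((\<Sum>j'<h. g i j' k) / real h) * ((\<Sum>i'<h. g i' j k) / real h)"]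
      by simp
  qed
  moreover have "m_function (cube_integral f) \<le> T_functional f"
    unfolding m_function_def
  proof (rule cINF_lower)
    show "bdd_below (T_functional ` {f'. piecewise_constant f' \<and> cube_integral f' = cube_integral f})"
      by (rule bdd_belowI[of _ 0]) (auto simp: piecewise_constant_def intro: T_functional_nonneg)
  qed (use pc in simp)
  ultimately show ?thesis by simp
qed

text \<open>Neither the sums nor the functional depend on the order of the grid cells, so the points of any three
finite sets of equal size may serve as coordinates.\<close>

lemma m_function_le_average:
  fixes F :: "'a \<Rightarrow> 'b \<Rightarrow> 'c \<Rightarrow> real"
  assumes H: "finite H\<^sub>1" "finite H\<^sub>2" "finite H\<^sub>3"
    and card: "card H\<^sub>1 = h" "card H\<^sub>2 = h" "card H\<^sub>3 = h" "h > 0"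
    and F: "\<And>x y z. x \<in> H\<^sub>1 \<Longrightarrow> y \<in> H\<^sub>2 \<Longrightarrow> z \<in> H\<^sub>3 \<Longrightarrow> F x y z \<in> {0..1}"
  shows "m_function ((\<Sum>x\<in>H\<^sub>1. \<Sum>y\<in>H\<^sub>2. \<Sum>z\<in>H\<^sub>3. F x y z) / real h ^ 3) \<le>
    (\<Sum>x\<in>H\<^sub>1. \<Sum>y\<in>H\<^sub>2. \<Sum>z\<in>H\<^sub>3.
      ((\<Sum>z'\<in>H\<^sub>3. F x y z') / real h) * ((\<Sum>y'\<in>H\<^sub>2. F x y' z) / real h) *
      ((\<Sum>x'\<in>H\<^sub>1. F x' y z) / real h)) / real h ^ 3"
proof -
  obtain e\<^sub>1 e\<^sub>2 e\<^sub>3 where e: "bij_betw e\<^sub>1 {..<h} H\<^sub>1" "bij_betw e\<^sub>2 {..<h} H\<^sub>2" "bij_betw e\<^sub>3 {..<h} H\<^sub>3"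
    using ex_bij_betw_nat_finite H card unfolding atLeast0LessThan by metis
  have "F (e\<^sub>1 i) (e\<^sub>2 j) (e\<^sub>3 k) \<in> {0..1}" if "i < h" "j < h" "k < h" for i j k
    using that e by (intro F) (auto simp: bij_betw_def)
  from m_function_le_grid[OF \<open>h > 0\<close> this] show ?thesis
    unfolding e[THEN sum.reindex_bij_betw, symmetric] .
qed

lemma m_function_zero: "m_function 0 \<le> 0"
  using m_function_le_grid[of 1 "\<lambda>_ _ _. 0"] by simp

section \<open>Elementary inequalities\<close>

text \<open>Compare the value at \<open>u\<close> with the chord from \<open>0\<close> to \<open>v\<close>.\<close>

lemma convex_zero_mono:
  fixes f :: "real \<Rightarrow> real"
  assumes f: "convex_on {0..1} f" "f 0 \<le> 0" "0 \<le> f v" and uv: "0 \<le> u" "u \<le> v" "v \<le> 1"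
  shows "f u \<le> f v"
proof (cases "v = 0")
  case False
  then have v: "v > 0" using uv by simp
  have "f ((1 - u / v) *\<^sub>R 0 + (u / v) *\<^sub>R v) \<le> (1 - u / v) * f 0 + (u / v) * f v"
    using uv v by (intro convex_onD[OF f(1)]) auto
  moreover have "(1 - u / v) * f 0 \<le> 0" using uv v f(2) by (intro mult_nonneg_nonpos) auto
  moreover have "(u / v) * f v \<le> 1 * f v" using uv v f(3) by (intro mult_right_mono) auto
  ultimately show ?thesis using v by simp
qed (use uv in simp)

text \<open>Compare the value at \<open>\<alpha>\<close> with the chord from \<open>\<beta>\<close> to \<open>1\<close>.\<close>

lemma convex_drop_bound:
  fixes f :: "real \<Rightarrow> real"
  assumes f: "convex_on {0..1} f" "f 1 \<le> 1" "0 \<le> f \<beta>"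
    and \<beta>: "0 \<le> \<beta>" "\<beta> \<le> \<alpha>" and \<alpha>: "\<alpha> < 1"
  shows "f \<alpha> \<le> f \<beta> + (\<alpha> - \<beta>) / (1 - \<alpha>)"
proof -
  define t where "t = (\<alpha> - \<beta>) / (1 - \<beta>)"
  have t: "0 \<le> t" "t \<le> 1" unfolding t_def using \<beta> \<alpha> by (auto simp: divide_le_eq)
  have "t * (1 - \<beta>) = \<alpha> - \<beta>" unfolding t_def using \<beta> \<alpha> by simp
  then have "\<alpha> = (1 - t) *\<^sub>R \<beta> + t *\<^sub>R 1" by (simp add: algebra_simps)
  then have "f \<alpha> \<le> (1 - t) * f \<beta> + t * f 1"
    using convex_onD[OF f(1) t, of \<beta> 1] \<beta> \<alpha> by simp
  also have "\<dots> \<le> 1 * f \<beta> + t * 1" using t f(2,3) by (intro add_mono mult_right_mono mult_left_mono) auto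
  also have "t \<le> (\<alpha> - \<beta>) / (1 - \<alpha>)" unfolding t_def using \<beta> \<alpha> by (intro divide_left_mono) auto
  finally show ?thesis by simp
qed

text \<open>Replace the factors one after the other.\<close>

lemma product_lower_bound:
  fixes a b c :: real
  assumes "a \<in> {0..1}" "b \<in> {0..1}" "c \<in> {0..1}" "f \<in> {0..1}" "g \<in> {0..1}" "h \<in> {0..1}"
  shows "f * g * h \<le> a * b * c + (\<bar>a - f\<bar> + \<bar>b - g\<bar> + \<bar>c - h\<bar>)"
proof -
  have le: "d * p * q \<le> \<bar>d\<bar>" if "p \<in> {0..1}" "q \<in> {0..1}" for d p q :: real
  proof -
    have "d * p * q \<le> \<bar>d\<bar> * (p * q)" using that by (simp add: mult.assoc mult_right_mono)
    also have "\<dots> \<le> \<bar>d\<bar> * 1" using that by (intro mult_left_mono) (auto simp: mult_le_one)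
    finally show ?thesis by simp
  qed
  have "f * g * h - a * b * c = (f - a) * g * h + (g - b) * a * h + (h - c) * a * b"
    by (simp add: algebra_simps)
  also have "\<dots> \<le> \<bar>f - a\<bar> + \<bar>g - b\<bar> + \<bar>h - c\<bar>"
    by (intro add_mono le assms)
  finally show ?thesis by (simp add: abs_minus_commute)
qed

lemma funcset_binary_unit: "f \<in> S \<rightarrow> T \<rightarrow> {0, 1} \<Longrightarrow> f \<in> S \<rightarrow> T \<rightarrow> {0..1::real}"
proof (intro Pi_I)
  fix x y assume "f \<in> S \<rightarrow> T \<rightarrow> {0, 1}" "x \<in> S" "y \<in> T"
  then have "f x y \<in> {0, 1}" by blast
  then show "f x y \<in> {0..1}" by auto
qed

lemma funcset_flip: "f \<in> S \<rightarrow> T \<rightarrow> U \<Longrightarrow> (\<lambda>y x. f x y) \<in> T \<rightarrow> S \<rightarrow> U"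
  by blast

section \<open>Partitions, characters and cosets\<close>

text \<open>The number of characters that suffice to make a partition given by \<open>s\<close> sets equidistributed up to
\<open>\<eta>\<close>. Each round of the energy argument adds a character for every pair of a cell (at most \<open>2 ^ s\<close>)
and a coset (at most \<open>2 ^ t\<close>, if \<open>t\<close> characters are present).\<close>

definition kernel_bound :: "nat \<Rightarrow> real \<Rightarrow> nat" where
  "kernel_bound s \<eta> = (MAX i\<in>{..nat \<lceil>2 ^ s / ((\<eta> / 4 ^ s)\<^sup>2 / 2 ^ s)\<rceil>}. ((\<lambda>t. t + 2 ^ s * 2 ^ t) ^^ i) 0)"

text \<open>The number of sets that define the final partition. A round adds three sets for each coset and then
restores equidistribution.\<close>

definition complexity_bound :: "real \<Rightarrow> nat" where
  "complexity_bound \<eta> = (MAX i\<in>{..nat \<lceil>2 / \<eta>\<^sup>2\<rceil>}.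
     ((\<lambda>t. t + 3 * 2 ^ t + kernel_bound (t + 3 * 2 ^ t) \<eta>) ^^ i) (kernel_bound 0 \<eta>))"

text \<open>A partition of a group is given by a finite family of sets: two points lie in the same cell if they lie in
the same members of the family. Refining a partition is enlarging the family, and there are at most
\<open>2 ^ card \<B>\<close> cells.\<close>

definition colour :: "'a set set \<Rightarrow> 'a \<Rightarrow> 'a set set" where
  "colour \<B> x = {B \<in> \<B>. x \<in> B}"

lemma colour_eq_iff: "colour \<B> x = colour \<B> y \<longleftrightarrow> (\<forall>B\<in>\<B>. x \<in> B \<longleftrightarrow> y \<in> B)"
  unfolding colour_def by blast

lemma colour_eq_mono: "colour \<B>' x = colour \<B>' y \<Longrightarrow> \<B> \<subseteq> \<B>' \<Longrightarrow> colour \<B> x = colour \<B> y"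
  unfolding colour_eq_iff by blast

lemma card_colour_image_le:
  assumes "finite \<B>"
  shows "finite (colour \<B> ` S)" "card (colour \<B> ` S) \<le> 2 ^ card \<B>"
proof -
  have sub: "colour \<B> ` S \<subseteq> Pow \<B>" unfolding colour_def by blast
  then show "finite (colour \<B> ` S)" using assms finite_subset by auto
  show "card (colour \<B> ` S) \<le> 2 ^ card \<B>"
    using card_mono[OF _ sub] assms by (simp add: card_Pow)
qed

text \<open>
A finite group of exponent two with its real characters. The completeness relation for the characters is
all that Fourier inversion and Parseval's identity need.
\<close>

locale boolean_group = comm_group G for G :: "'a monoid" (structure) +
  fixes X :: "('a \<Rightarrow> real) set"
  assumes finite_carrier: "finite (carrier G)"
    and square: "x \<in> carrier G \<Longrightarrow> x \<otimes> x = \<one>"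
    and finite_characters: "finite X"
    and character_sign: "\<xi> \<in> X \<Longrightarrow> x \<in> carrier G \<Longrightarrow> \<xi> x = 1 \<or> \<xi> x = -1"
    and character_mult: "\<xi> \<in> X \<Longrightarrow> x \<in> carrier G \<Longrightarrow> y \<in> carrier G \<Longrightarrow> \<xi> (x \<otimes> y) = \<xi> x * \<xi> y"
    and character_sum: "x \<in> carrier G \<Longrightarrow> (\<Sum>\<xi>\<in>X. \<xi> x) = (if x = \<one> then real (order G) else 0)"
begin

text \<open>
A subgroup is the intersection of a finite family of kernels of characters, so that the partition into its
cosets is again the partition given by a family of sets. The subgroup itself is \<open>coset \<K> \<one>\<close>.
\<close>

definition kernels :: "'a set set" where
  "kernels = (\<lambda>\<xi>. {x \<in> carrier G. \<xi> x = 1}) ` X"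

definition coset :: "'a set set \<Rightarrow> 'a \<Rightarrow> 'a set" where
  "coset \<K> w = {z \<in> carrier G. colour \<K> z = colour \<K> w}"

definition pair_mean :: "'a set set \<Rightarrow> ('a \<Rightarrow> 'a \<Rightarrow> real) \<Rightarrow> 'a \<Rightarrow> 'a \<Rightarrow> real" where
  "pair_mean \<B> b x y = fibre_mean (carrier G \<times> carrier G) (\<lambda>(x, y). (colour \<B> x, colour \<B> y))
     (\<lambda>(x, y). b x y) (colour \<B> x, colour \<B> y)"

definition pair_energy :: "'a set set \<Rightarrow> ('a \<Rightarrow> 'a \<Rightarrow> real) \<Rightarrow> real" where
  "pair_energy \<B> b = fibre_energy (carrier G \<times> carrier G) (\<lambda>(x, y). (colour \<B> x, colour \<B> y))
     (\<lambda>(x, y). b x y)"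

lemma order_pos: "order G > 0"
  using finite_carrier by (simp add: order_gt_0_iff_finite)

lemma mult_self_left: "x \<in> carrier G \<Longrightarrow> y \<in> carrier G \<Longrightarrow> x \<otimes> (x \<otimes> y) = y"
  by (simp add: m_assoc[symmetric] square)

lemma mult_self_right: "x \<in> carrier G \<Longrightarrow> y \<in> carrier G \<Longrightarrow> x \<otimes> y \<otimes> y = x"
  by (simp add: m_assoc square)

lemma mult_self_middle: "x \<in> carrier G \<Longrightarrow> y \<in> carrier G \<Longrightarrow> x \<otimes> y \<otimes> x = y"
  by (simp add: m_comm[of x y] mult_self_right)

lemma bij_betw_mult: "w \<in> carrier G \<Longrightarrow> bij_betw (\<lambda>x. w \<otimes> x) (carrier G) (carrier G)"
  by (rule bij_betw_byWitness[where f' = "\<lambda>x. w \<otimes> x"]) (auto simp: mult_self_left)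

lemma mem_kernel_mult:
  assumes "K \<in> kernels" "x \<in> carrier G" "y \<in> carrier G"
  shows "x \<otimes> y \<in> K \<longleftrightarrow> (x \<in> K \<longleftrightarrow> y \<in> K)"
proof -
  obtain \<xi> where "\<xi> \<in> X" "K = {x \<in> carrier G. \<xi> x = 1}" using assms(1) unfolding kernels_def by blast
  then show ?thesis
    using assms(2,3) character_mult[of \<xi> x y] character_sign[of \<xi> x] character_sign[of \<xi> y] by auto
qed

lemma colour_mult_cong:
  assumes "\<K> \<subseteq> kernels" "x \<in> carrier G" "y \<in> carrier G" "x' \<in> carrier G" "y' \<in> carrier G"
    and "colour \<K> x = colour \<K> x'" "colour \<K> y = colour \<K> y'"
  shows "colour \<K> (x \<otimes> y) = colour \<K> (x' \<otimes> y')"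
  unfolding colour_eq_iff
proof
  fix K assume K: "K \<in> \<K>"
  then have "K \<in> kernels" using assms(1) by blast
  moreover have "x \<in> K \<longleftrightarrow> x' \<in> K" "y \<in> K \<longleftrightarrow> y' \<in> K"
    using assms(6,7) K unfolding colour_eq_iff by blast+
  ultimately show "x \<otimes> y \<in> K \<longleftrightarrow> x' \<otimes> y' \<in> K" using assms(2-5) by (simp add: mem_kernel_mult)
qed

lemma coset_subset: "coset \<K> w \<subseteq> carrier G"
  unfolding coset_def by blast

lemma finite_coset: "finite (coset \<K> w)"
  using coset_subset finite_carrier by (rule finite_subset)

text \<open>Membership in a kernel is additive modulo two. Therefore the condition that \<open>x\<close>, \<open>y\<close>, \<open>z\<close> sum to an
element of the subgroup is symmetric in the three variables.\<close>

lemma mem_coset_mult: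
  assumes "\<K> \<subseteq> kernels" "x \<in> carrier G" "y \<in> carrier G" "z \<in> carrier G"
  shows "z \<in> coset \<K> (x \<otimes> y) \<longleftrightarrow> (\<forall>K\<in>\<K>. z \<in> K \<longleftrightarrow> (x \<in> K \<longleftrightarrow> y \<in> K))"
proof -
  have "x \<otimes> y \<in> K \<longleftrightarrow> (x \<in> K \<longleftrightarrow> y \<in> K)" if "K \<in> \<K>" for K
    using that assms by (intro mem_kernel_mult) auto
  then show ?thesis using assms(4) unfolding coset_def colour_eq_iff by simp
qed

lemma coset_translate:
  assumes K: "\<K> \<subseteq> kernels" and w: "w \<in> carrier G"
  shows "bij_betw (\<lambda>h. w \<otimes> h) (coset \<K> \<one>) (coset \<K> w)"
proof (rule bij_betw_byWitness[where f' = "\<lambda>x. w \<otimes> x"])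
  have one: "\<one> \<in> K" if "K \<in> \<K>" for K
    using mem_kernel_mult[of K w w] that K w square[OF w] by auto
  show "(\<lambda>h. w \<otimes> h) ` coset \<K> \<one> \<subseteq> coset \<K> w" "(\<lambda>h. w \<otimes> h) ` coset \<K> w \<subseteq> coset \<K> \<one>"
    using one w K unfolding coset_def colour_eq_iff by (auto simp: mem_kernel_mult subsetD)
qed (auto simp: coset_def w mult_self_left)

lemma card_coset: "\<K> \<subseteq> kernels \<Longrightarrow> w \<in> carrier G \<Longrightarrow> card (coset \<K> w) = card (coset \<K> \<one>)"
  by (rule bij_betw_same_card[OF coset_translate, symmetric])

lemma card_coset_pos: "card (coset \<K> \<one>) > 0"
  using finite_coset by (auto simp: card_gt_0_iff coset_def)

lemma order_le_card_coset:
  assumes "\<K> \<subseteq> kernels" "finite \<K>"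
  shows "order G \<le> 2 ^ card \<K> * card (coset \<K> \<one>)"
proof -
  have "order G = (\<Sum>k \<in> colour \<K> ` carrier G. \<Sum>x \<in> {x \<in> carrier G. colour \<K> x = k}. 1)"
    unfolding order_def using sum.image_gen[OF finite_carrier, of "\<lambda>_. 1::nat" "colour \<K>"] by simp
  also have "\<dots> = (\<Sum>k \<in> colour \<K> ` carrier G. card (coset \<K> \<one>))"
  proof (rule sum.cong[OF refl])
    fix k assume "k \<in> colour \<K> ` carrier G"
    then obtain w where w: "w \<in> carrier G" "k = colour \<K> w" by blast
    then show "(\<Sum>x \<in> {x \<in> carrier G. colour \<K> x = k}. 1) = card (coset \<K> \<one>)"
      using card_coset[OF assms(1) w(1)] by (simp add: coset_def)
  qed
  also have "\<dots> \<le> 2 ^ card \<K> * card (coset \<K> \<one>)"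
    using card_colour_image_le(2)[OF assms(2), of "carrier G"] by simp
  finally show ?thesis .
qed

lemma sum_coset: "(\<Sum>z\<in>coset \<K> w. f z) = (\<Sum>z\<in>carrier G. if z \<in> coset \<K> w then f z else (0::real))"
  using sum.inter_restrict[OF finite_carrier, of f "coset \<K> w"] coset_subset[of \<K> w]
  by (simp only: Int_absorb1)

lemma mem_coset_rotate:
  assumes "\<K> \<subseteq> kernels" "x \<in> carrier G" "y \<in> carrier G" "z \<in> carrier G"
  shows "z \<in> coset \<K> (x \<otimes> y) \<longleftrightarrow> x \<in> coset \<K> (y \<otimes> z)"
    and "z \<in> coset \<K> (x \<otimes> y) \<longleftrightarrow> y \<in> coset \<K> (x \<otimes> z)"
  unfolding mem_coset_mult[OF assms] mem_coset_mult[OF assms(1,3,4,2)] mem_coset_mult[OF assms(1,2,4,3)]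
  by blast+

lemma coset_triple_rotate:
  assumes K: "\<K> \<subseteq> kernels"
  shows "(\<Sum>x\<in>carrier G. \<Sum>y\<in>carrier G. \<Sum>z\<in>coset \<K> (x \<otimes> y). f x y z) =
    (\<Sum>y\<in>carrier G. \<Sum>z\<in>carrier G. \<Sum>x\<in>coset \<K> (y \<otimes> z). (f x y z :: real))"
proof -
  have "(\<Sum>x\<in>carrier G. \<Sum>y\<in>carrier G. \<Sum>z\<in>coset \<K> (x \<otimes> y). f x y z) =
    (\<Sum>x\<in>carrier G. \<Sum>y\<in>carrier G. \<Sum>z\<in>carrier G. if x \<in> coset \<K> (y \<otimes> z) then f x y z else 0)"
    unfolding sum_coset
    by (intro sum.cong refl, subst mem_coset_rotate(1)[OF K]) auto
  also have "\<dots> = (\<Sum>y\<in>carrier G. \<Sum>x\<in>carrier G. \<Sum>z\<in>carrier G. if x \<in> coset \<K> (y \<otimes> z) then f x y z else 0)"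
    by (rule sum.swap)
  also have "\<dots> = (\<Sum>y\<in>carrier G. \<Sum>z\<in>carrier G. \<Sum>x\<in>carrier G. if x \<in> coset \<K> (y \<otimes> z) then f x y z else 0)"
    by (intro sum.cong refl sum.swap)
  finally show ?thesis unfolding sum_coset .
qed

lemma coset_triple_swap:
  assumes K: "\<K> \<subseteq> kernels"
  shows "(\<Sum>x\<in>carrier G. \<Sum>y\<in>carrier G. \<Sum>z\<in>coset \<K> (x \<otimes> y). f x y z) =
    (\<Sum>x\<in>carrier G. \<Sum>z\<in>carrier G. \<Sum>y\<in>coset \<K> (x \<otimes> z). (f x y z :: real))"
proof -
  have "(\<Sum>x\<in>carrier G. \<Sum>y\<in>carrier G. \<Sum>z\<in>coset \<K> (x \<otimes> y). f x y z) =
    (\<Sum>x\<in>carrier G. \<Sum>y\<in>carrier G. \<Sum>z\<in>carrier G. if y \<in> coset \<K> (x \<otimes> z) then f x y z else 0)"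
    unfolding sum_coset
    by (intro sum.cong refl, subst mem_coset_rotate(2)[OF K]) auto
  also have "\<dots> = (\<Sum>x\<in>carrier G. \<Sum>z\<in>carrier G. \<Sum>y\<in>carrier G. if y \<in> coset \<K> (x \<otimes> z) then f x y z else 0)"
    by (intro sum.cong refl sum.swap)
  finally show ?thesis unfolding sum_coset .
qed

text \<open>The contribution of a fixed \<open>z\<close> is a sum over the pairs whose product lies in the coset of \<open>z\<close>. In each
coset choose the \<open>z\<close> with the least contribution. One \<open>z\<close> per coset gives a single sum over all pairs.\<close>

lemma coset_representatives_below_average:
  fixes s :: "'a \<Rightarrow> 'a \<Rightarrow> 'a \<Rightarrow> real"
  assumes K: "\<K> \<subseteq> kernels"
  obtains r where "\<And>z. z \<in> carrier G \<Longrightarrow> r (colour \<K> z) \<in> coset \<K> z"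
    and "real (card (coset \<K> \<one>)) *
        (\<Sum>x\<in>carrier G. \<Sum>y\<in>carrier G. s (r (colour \<K> (x \<otimes> y))) x y) \<le>
      (\<Sum>x\<in>carrier G. \<Sum>y\<in>carrier G. \<Sum>z\<in>coset \<K> (x \<otimes> y). s z x y)"
proof -
  let ?P = "carrier G \<times> carrier G" and ?c = "colour \<K>"
  let ?p = "\<lambda>(x, y). ?c (x \<otimes> y)"
  define S where "S = (\<lambda>z. \<Sum>w\<in>{w \<in> ?P. ?p w = ?c z}. s z (fst w) (snd w))"
  define C where "C = (\<lambda>k. {z \<in> carrier G. ?c z = k})"
  define r where "r = (\<lambda>k. arg_min_on S (C k))"
  have finP: "finite ?P" using finite_carrier by simp
  have finC: "finite (C k)" for k unfolding C_def using finite_carrier by simp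
  have C_coset: "C (?c w) = coset \<K> w" for w unfolding C_def coset_def by simp
  have r_mem: "r k \<in> C k" and r_min: "z \<in> C k \<Longrightarrow> S (r k) \<le> S z" if "k \<in> ?c ` carrier G" for k z
  proof -
    have "C k \<noteq> {}" using that unfolding C_def by blast
    then show "r k \<in> C k" "z \<in> C k \<Longrightarrow> S (r k) \<le> S z"
      unfolding r_def using arg_min_if_finite[OF finC] by (auto simp: arg_min_least[OF finC])
  qed
  have "(\<Sum>x\<in>carrier G. \<Sum>y\<in>carrier G. s (r (?c (x \<otimes> y))) x y) =
      (\<Sum>w\<in>?P. s (r (?p w)) (fst w) (snd w))"
    by (simp only: sum.cartesian_product' fst_conv snd_conv split)
  also have "\<dots> = (\<Sum>k \<in> ?c ` carrier G. \<Sum>w\<in>{w \<in> ?P. ?p w = k}. s (r (?p w)) (fst w) (snd w))"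
    by (rule sum.group[symmetric]) (use finP finite_carrier in auto)
  also have "\<dots> = (\<Sum>k \<in> ?c ` carrier G. S (r k))"
  proof (rule sum.cong[OF refl])
    fix k assume "k \<in> ?c ` carrier G"
    then have "?c (r k) = k" using r_mem unfolding C_def by blast
    then show "(\<Sum>w\<in>{w \<in> ?P. ?p w = k}. s (r (?p w)) (fst w) (snd w)) = S (r k)"
      unfolding S_def by (intro sum.cong) auto
  qed
  finally have lhs: "(\<Sum>x\<in>carrier G. \<Sum>y\<in>carrier G. s (r (?c (x \<otimes> y))) x y) =
    (\<Sum>k \<in> ?c ` carrier G. S (r k))" .
  have "real (card (coset \<K> \<one>)) * (\<Sum>k \<in> ?c ` carrier G. S (r k)) =
      (\<Sum>k \<in> ?c ` carrier G. \<Sum>z \<in> C k. S (r k))"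
    unfolding sum_distrib_left
  proof (rule sum.cong[OF refl])
    fix k assume "k \<in> ?c ` carrier G"
    then obtain w where w: "w \<in> carrier G" "k = ?c w" by blast
    show "real (card (coset \<K> \<one>)) * S (r k) = (\<Sum>z \<in> C k. S (r k))"
      by (simp add: w(2) C_coset card_coset[OF K w(1)])
  qed
  also have "\<dots> \<le> (\<Sum>k \<in> ?c ` carrier G. \<Sum>z \<in> C k. S z)"
    using r_min by (intro sum_mono) auto
  also have "\<dots> = (\<Sum>z\<in>carrier G. S z)"
    unfolding C_def by (rule sum.image_gen[OF finite_carrier, symmetric])
  also have "\<dots> = (\<Sum>z\<in>carrier G. \<Sum>w\<in>?P. if z \<in> coset \<K> (fst w \<otimes> snd w) then s z (fst w) (snd w) else 0)"
  proof (rule sum.cong[OF refl])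
    fix z assume z: "z \<in> carrier G"
    have "?p w = ?c z \<longleftrightarrow> z \<in> coset \<K> (fst w \<otimes> snd w)" for w
      using z by (cases w) (auto simp: coset_def)
    then show "S z = (\<Sum>w\<in>?P. if z \<in> coset \<K> (fst w \<otimes> snd w) then s z (fst w) (snd w) else 0)"
      unfolding S_def sum.inter_filter[OF finP] by (simp only:)
  qed
  also have "\<dots> = (\<Sum>w\<in>?P. \<Sum>z\<in>carrier G. if z \<in> coset \<K> (fst w \<otimes> snd w) then s z (fst w) (snd w) else 0)"
    by (rule sum.swap)
  also have "\<dots> = (\<Sum>x\<in>carrier G. \<Sum>y\<in>carrier G. \<Sum>z\<in>coset \<K> (x \<otimes> y). s z x y)"
    by (simp only: sum.cartesian_product' sum_coset fst_conv snd_conv)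
  finally have le: "real (card (coset \<K> \<one>)) * (\<Sum>k \<in> ?c ` carrier G. S (r k)) \<le>
    (\<Sum>x\<in>carrier G. \<Sum>y\<in>carrier G. \<Sum>z\<in>coset \<K> (x \<otimes> y). s z x y)" .
  show thesis
  proof (rule that)
    show "r (?c z) \<in> coset \<K> z" if "z \<in> carrier G" for z
      using r_mem[of "?c z"] that C_coset by blast
  qed (use le in \<open>simp only: lhs\<close>)
qed

section \<open>Triangle counts and pair densities\<close>

lemma pair_mean_in_unit:
  assumes "b \<in> carrier G \<rightarrow> carrier G \<rightarrow> {0..1}"
  shows "pair_mean \<B> b x y \<in> {0..1}"
proof -
  have "b x y \<in> {0..1}" if "x \<in> carrier G" "y \<in> carrier G" for x y using assms that by blast
  then show ?thesis unfolding pair_mean_def by (auto intro!: fibre_mean_nonneg fibre_mean_le_one)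
qed

lemma pair_mean_cong:
  "colour \<B> x = colour \<B> x' \<Longrightarrow> colour \<B> y = colour \<B> y' \<Longrightarrow> pair_mean \<B> b x y = pair_mean \<B> b x' y'"
  unfolding pair_mean_def by simp

lemma pair_label_refines:
  assumes "\<B> \<subseteq> \<B>'"
  shows "determined_by S (\<lambda>(x, y). (colour \<B>' x, colour \<B>' y)) (\<lambda>(x, y). (colour \<B> x, colour \<B> y))"
proof (rule determined_byI)
  fix w w' assume eq: "(\<lambda>(x, y). (colour \<B>' x, colour \<B>' y)) w = (\<lambda>(x, y). (colour \<B>' x, colour \<B>' y)) w'"
  obtain x y x' y' where w: "w = (x, y)" "w' = (x', y')" by (cases w; cases w')
  have "colour \<B>' x = colour \<B>' x'" "colour \<B>' y = colour \<B>' y'" using eq by (simp_all add: w)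
  note this[THEN colour_eq_mono, OF assms]
  then show "(\<lambda>(x, y). (colour \<B> x, colour \<B> y)) w = (\<lambda>(x, y). (colour \<B> x, colour \<B> y)) w'"
    by (simp add: w)
qed

lemma pair_energy_mono: "\<B> \<subseteq> \<B>' \<Longrightarrow> pair_energy \<B> b \<le> pair_energy \<B>' b"
  unfolding pair_energy_def using finite_carrier
  by (intro fibre_energy_mono pair_label_refines) auto

lemma pair_energy_bounds:
  assumes "b \<in> carrier G \<rightarrow> carrier G \<rightarrow> {0..1}"
  shows "0 \<le> pair_energy \<B> b" "pair_energy \<B> b \<le> real (order G) ^ 2"
proof -
  show "0 \<le> pair_energy \<B> b" unfolding pair_energy_def by (rule fibre_energy_nonneg)
  have "b x y \<in> {0..1}" if "x \<in> carrier G" "y \<in> carrier G" for x y using assms that by blast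
  then have "pair_energy \<B> b \<le> real (card (carrier G \<times> carrier G))"
    unfolding pair_energy_def by (intro fibre_energy_le_card) auto
  then show "pair_energy \<B> b \<le> real (order G) ^ 2"
    by (simp add: card_cartesian_product order_def power2_eq_square)
qed

text \<open>Replacing \<open>b\<close> by its cell densities costs little unless a finer partition has larger energy. After fixing
the worst \<open>z\<close> in each coset, the factors \<open>u\<close> and \<open>v\<close> become functions of \<open>x\<close> and of \<open>y\<close>, so a
partition that refines these boundedly many functions and the cosets sees their product. The
representatives \<open>r\<close> are chosen before \<open>\<B>'\<close>, since \<open>\<B>'\<close> will be built from them.\<close>

lemma replace_by_pair_mean:
  fixes b u v :: "'a \<Rightarrow> 'a \<Rightarrow> real"
  assumes K: "\<K> \<subseteq> kernels" "\<K> \<subseteq> \<B>"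
    and u: "u \<in> carrier G \<rightarrow> carrier G \<rightarrow> {0..1}"
    and v: "v \<in> carrier G \<rightarrow> carrier G \<rightarrow> {0..1}"
  shows "\<exists>r. (\<forall>z\<in>carrier G. r (colour \<K> z) \<in> carrier G) \<and>
    (\<forall>\<B>'. \<B> \<subseteq> \<B>' \<longrightarrow>
      (\<forall>k \<in> colour \<K> ` carrier G. determined_by (carrier G) (colour \<B>') (\<lambda>x. u x (r k)) \<and>
        determined_by (carrier G) (colour \<B>') (\<lambda>y. v y (r k))) \<longrightarrow>
      - (real (card (coset \<K> \<one>)) * real (order G) * sqrt (pair_energy \<B>' b - pair_energy \<B> b)) \<le>
        (\<Sum>x\<in>carrier G. \<Sum>y\<in>carrier G. \<Sum>z\<in>coset \<K> (x \<otimes> y).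
          (b x y - pair_mean \<B> b x y) * (u x z * v y z)))"
proof -
  let ?h = "real (card (coset \<K> \<one>))" and ?P = "carrier G \<times> carrier G"
  define s where "s = (\<lambda>z x y. (b x y - pair_mean \<B> b x y) * (u x z * v y z))"
  obtain r where r: "\<And>z. z \<in> carrier G \<Longrightarrow> r (colour \<K> z) \<in> coset \<K> z"
    and le: "?h * (\<Sum>x\<in>carrier G. \<Sum>y\<in>carrier G. s (r (colour \<K> (x \<otimes> y))) x y) \<le>
      (\<Sum>x\<in>carrier G. \<Sum>y\<in>carrier G. \<Sum>z\<in>coset \<K> (x \<otimes> y). s z x y)"
    using coset_representatives_below_average[OF K(1), of s] by blast
  have r_mem: "r (colour \<K> z) \<in> carrier G" if "z \<in> carrier G" for z
    using r[OF that] coset_subset by blast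
  show ?thesis
  proof (intro exI[of _ r] conjI ballI allI impI)
    fix \<B>'
    assume sub: "\<B> \<subseteq> \<B>'"
      and uv: "\<forall>k \<in> colour \<K> ` carrier G. determined_by (carrier G) (colour \<B>') (\<lambda>x. u x (r k)) \<and>
        determined_by (carrier G) (colour \<B>') (\<lambda>y. v y (r k))"
    define U where "U = (\<lambda>(x, y). u x (r (colour \<K> (x \<otimes> y))) * v y (r (colour \<K> (x \<otimes> y))))"
    have "determined_by ?P (\<lambda>(x, y). (colour \<B>' x, colour \<B>' y)) U"
    proof (rule determined_byI)
      fix w w' assume w: "w \<in> ?P" "w' \<in> ?P"
        "(\<lambda>(x, y). (colour \<B>' x, colour \<B>' y)) w = (\<lambda>(x, y). (colour \<B>' x, colour \<B>' y)) w'"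
      obtain x y x' y' where eq: "w = (x, y)" "w' = (x', y')" by (cases w; cases w')
      have mem: "x \<in> carrier G" "y \<in> carrier G" "x' \<in> carrier G" "y' \<in> carrier G"
        and c: "colour \<B>' x = colour \<B>' x'" "colour \<B>' y = colour \<B>' y'" using w eq by auto
      define k where "k = colour \<K> (x \<otimes> y)"
      have "\<K> \<subseteq> \<B>'" using K(2) sub by blast
      then have k': "colour \<K> (x' \<otimes> y') = k"
        unfolding k_def
        by (intro colour_mult_cong[OF K(1)] mem c[symmetric, THEN colour_eq_mono])
      have k: "k \<in> colour \<K> ` carrier G" unfolding k_def using mem by blast
      show "U w = U w'"
        unfolding U_def eq split k' k_def[symmetric]
        using determined_byD[OF bspec[OF uv k, THEN conjunct1] mem(1,3) c(1)] determined_byD[OF bspec[OF uv k, THEN conjunct2] mem(2,4) c(2)]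
        by simp
    qed
    moreover have "\<bar>U w\<bar> \<le> 1" if "w \<in> ?P" for w
    proof -
      obtain x y where eq: "w = (x, y)" "x \<in> carrier G" "y \<in> carrier G" using \<open>w \<in> ?P\<close> by blast
      have "r (colour \<K> (x \<otimes> y)) \<in> carrier G" using eq by (intro r_mem) simp
      then have "u x (r (colour \<K> (x \<otimes> y))) \<in> {0..1}" "v y (r (colour \<K> (x \<otimes> y))) \<in> {0..1}"
        using u v eq by blast+
      then show ?thesis unfolding U_def eq split by (auto simp: abs_mult mult_le_one)
    qed
    ultimately have "(\<Sum>w\<in>?P. ((\<lambda>(x, y). b x y) w - fibre_mean ?P (\<lambda>(x, y). (colour \<B> x, colour \<B> y))
        (\<lambda>(x, y). b x y) ((\<lambda>(x, y). (colour \<B> x, colour \<B> y)) w)) * U w)\<^sup>2 \<le>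
        real (card ?P) * (pair_energy \<B>' b - pair_energy \<B> b)"
      unfolding pair_energy_def using finite_carrier
      by (intro correlation_le_energy_gain pair_label_refines[OF sub]) auto
    also have "(\<Sum>w\<in>?P. ((\<lambda>(x, y). b x y) w - fibre_mean ?P (\<lambda>(x, y). (colour \<B> x, colour \<B> y))
        (\<lambda>(x, y). b x y) ((\<lambda>(x, y). (colour \<B> x, colour \<B> y)) w)) * U w) =
        (\<Sum>x\<in>carrier G. \<Sum>y\<in>carrier G. s (r (colour \<K> (x \<otimes> y))) x y)" (is "_ = ?L")
      by (simp only: sum.cartesian_product' U_def s_def pair_mean_def split)
    finally have "\<bar>?L\<bar> \<le> sqrt (real (card ?P) * (pair_energy \<B>' b - pair_energy \<B> b))"
      using real_le_rsqrt[of "\<bar>?L\<bar>"] by simp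
    also have "\<dots> = real (order G) * sqrt (pair_energy \<B>' b - pair_energy \<B> b)"
      by (simp add: card_cartesian_product order_def real_sqrt_mult)
    finally have "?h * (- ?L) \<le> ?h * (real (order G) * sqrt (pair_energy \<B>' b - pair_energy \<B> b))"
      by (intro mult_left_mono) auto
    then show "- (?h * real (order G) * sqrt (pair_energy \<B>' b - pair_energy \<B> b)) \<le>
        (\<Sum>x\<in>carrier G. \<Sum>y\<in>carrier G. \<Sum>z\<in>coset \<K> (x \<otimes> y).
          (b x y - pair_mean \<B> b x y) * (u x z * v y z))"
      using le unfolding s_def by simp
  qed (rule r_mem)
qed

text \<open>The three edge functions are replaced in turn. In the first step both remaining factors are indicators, and
the new sets are their slices at the representatives. In the second step one factor is already a cell
density, which the old partition determines. In the third step both are, so that nothing is lost there.\<close>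

lemma counting_lemma:
  fixes a b c :: "'a \<Rightarrow> 'a \<Rightarrow> real"
  assumes K: "\<K> \<subseteq> kernels" "\<K> \<subseteq> \<B>" "finite \<B>"
    and a: "a \<in> carrier G \<rightarrow> carrier G \<rightarrow> {0, 1}"
    and b: "b \<in> carrier G \<rightarrow> carrier G \<rightarrow> {0, 1}"
    and c: "c \<in> carrier G \<rightarrow> carrier G \<rightarrow> {0, 1}"
  obtains \<B>' where "\<B> \<subseteq> \<B>'" "finite \<B>'" "card \<B>' \<le> card \<B> + 3 * 2 ^ card \<K>"
    and "(\<Sum>x\<in>carrier G. \<Sum>y\<in>carrier G. \<Sum>z\<in>coset \<K> (x \<otimes> y). a x y * b y z * c x z) \<ge>
      (\<Sum>x\<in>carrier G. \<Sum>y\<in>carrier G. \<Sum>z\<in>coset \<K> (x \<otimes> y).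
        pair_mean \<B> a x y * pair_mean \<B> b y z * pair_mean \<B> c x z) -
      real (card (coset \<K> \<one>)) * real (order G) *
        (sqrt (pair_energy \<B>' a - pair_energy \<B> a) + sqrt (pair_energy \<B>' b - pair_energy \<B> b))"
proof -
  let ?h = "real (card (coset \<K> \<one>))" and ?N = "real (order G)" and ?G = "carrier G"
  let ?keys = "colour \<K> ` ?G"
  let ?A = "pair_mean \<B> a" and ?B = "pair_mean \<B> b" and ?C = "pair_mean \<B> c"
  note a_unit = funcset_binary_unit[OF a] and b_unit = funcset_binary_unit[OF b]
    and c_unit = funcset_binary_unit[OF c]
  note c_unit' = funcset_flip[OF c_unit]
  have "?A x y \<in> {0..1}" "?B x y \<in> {0..1}" for x y
    by (rule pair_mean_in_unit[OF a_unit], rule pair_mean_in_unit[OF b_unit])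
  then have A: "?A \<in> ?G \<rightarrow> ?G \<rightarrow> {0..1}" and A': "(\<lambda>y x. ?A x y) \<in> ?G \<rightarrow> ?G \<rightarrow> {0..1}"
    and B': "(\<lambda>z y. ?B y z) \<in> ?G \<rightarrow> ?G \<rightarrow> {0..1}"
    by blast+
  obtain r1 where r1: "\<forall>z\<in>?G. r1 (colour \<K> z) \<in> ?G" and step1: "\<forall>\<B>'. \<B> \<subseteq> \<B>' \<longrightarrow>
        (\<forall>k\<in>?keys. determined_by ?G (colour \<B>') (\<lambda>x. c x (r1 k)) \<and> determined_by ?G (colour \<B>') (\<lambda>y. b y (r1 k))) \<longrightarrow>
        - (?h * ?N * sqrt (pair_energy \<B>' a - pair_energy \<B> a)) \<le>
        (\<Sum>x\<in>?G. \<Sum>y\<in>?G. \<Sum>z\<in>coset \<K> (x \<otimes> y). (a x y - ?A x y) * (c x z * b y z))"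
    using replace_by_pair_mean[where u = c and v = b and b = a, OF K(1,2) c_unit b_unit] by (elim exE conjE) (rule that)
  obtain r2 where r2: "\<forall>z\<in>?G. r2 (colour \<K> z) \<in> ?G" and step2: "\<forall>\<B>'. \<B> \<subseteq> \<B>' \<longrightarrow>
        (\<forall>k\<in>?keys. determined_by ?G (colour \<B>') (\<lambda>y. ?A (r2 k) y) \<and> determined_by ?G (colour \<B>') (\<lambda>z. c (r2 k) z)) \<longrightarrow>
        - (?h * ?N * sqrt (pair_energy \<B>' b - pair_energy \<B> b)) \<le>
        (\<Sum>y\<in>?G. \<Sum>z\<in>?G. \<Sum>x\<in>coset \<K> (y \<otimes> z). (b y z - ?B y z) * (?A x y * c x z))"
    using replace_by_pair_mean[where u = "\<lambda>y x. ?A x y" and v = "\<lambda>z x. c x z" and b = b, OF K(1,2) A' c_unit'] by (elim exE conjE) (rule that)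
  obtain r3 where r3: "\<forall>z\<in>?G. r3 (colour \<K> z) \<in> ?G" and step3: "\<forall>\<B>'. \<B> \<subseteq> \<B>' \<longrightarrow>
        (\<forall>k\<in>?keys. determined_by ?G (colour \<B>') (\<lambda>x. ?A x (r3 k)) \<and> determined_by ?G (colour \<B>') (\<lambda>z. ?B (r3 k) z)) \<longrightarrow>
        - (?h * ?N * sqrt (pair_energy \<B>' c - pair_energy \<B> c)) \<le>
        (\<Sum>x\<in>?G. \<Sum>z\<in>?G. \<Sum>y\<in>coset \<K> (x \<otimes> z). (c x z - ?C x z) * (?A x y * ?B y z))"
    using replace_by_pair_mean[where u = ?A and v = "\<lambda>z y. ?B y z" and b = c, OF K(1,2) A B'] by (elim exE conjE) (rule that)
  define new where "new = (\<lambda>k. {x \<in> ?G. c x (r1 k) = 1}) ` ?keys \<union> (\<lambda>k. {y \<in> ?G. b y (r1 k) = 1}) ` ?keys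
    \<union> (\<lambda>k. {z \<in> ?G. c (r2 k) z = 1}) ` ?keys"
  define \<B>' where "\<B>' = \<B> \<union> new"
  have "finite \<K>" using K(2,3) finite_subset by blast
  note keys = card_colour_image_le[OF this, of ?G]
  have im: "card (f ` ?keys) \<le> 2 ^ card \<K>" for f :: "'a set set \<Rightarrow> 'a set"
    using card_image_le[OF keys(1), of f] keys(2) by (rule le_trans)
  have sub: "\<B> \<subseteq> \<B>'" and fin: "finite \<B>'" unfolding \<B>'_def new_def using K(3) keys(1) by auto
  have "card \<B>' \<le> card \<B> + card new" unfolding \<B>'_def by (rule card_Un_le)
  moreover have "card new \<le> 2 ^ card \<K> + 2 ^ card \<K> + 2 ^ card \<K>"
    unfolding new_def by (intro order_trans[OF card_Un_le] add_mono im)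
  ultimately have card: "card \<B>' \<le> card \<B> + 3 * 2 ^ card \<K>" by simp
  have indicator: "determined_by ?G (colour \<B>') f"
    if "{x \<in> ?G. f x = 1} \<in> new" and f: "\<And>x. x \<in> ?G \<Longrightarrow> f x \<in> {0, 1}" for f :: "'a \<Rightarrow> real"
  proof (rule determined_byI)
    fix x y assume xy: "x \<in> ?G" "y \<in> ?G" and "colour \<B>' x = colour \<B>' y"
    then have "\<forall>B\<in>\<B>'. x \<in> B \<longleftrightarrow> y \<in> B" by (simp only: colour_eq_iff)
    moreover have "{x \<in> ?G. f x = 1} \<in> \<B>'" unfolding \<B>'_def using that(1) by (rule UnI2)
    ultimately have "x \<in> {x \<in> ?G. f x = 1} \<longleftrightarrow> y \<in> {x \<in> ?G. f x = 1}" by (rule bspec)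
    then show "f x = f y" using f[OF xy(1)] f[OF xy(2)] xy by auto
  qed
  have mean: "determined_by ?G (colour \<B>'') (\<lambda>x. pair_mean \<B> g x y)"
    "determined_by ?G (colour \<B>'') (\<lambda>x. pair_mean \<B> g y x)" if "\<B> \<subseteq> \<B>''" for \<B>'' g y
  proof -
    have "colour \<B> x = colour \<B> x'" if "colour \<B>'' x = colour \<B>'' x'" for x x'
      using that \<open>\<B> \<subseteq> \<B>''\<close> by (rule colour_eq_mono)
    then show "determined_by ?G (colour \<B>'') (\<lambda>x. pair_mean \<B> g x y)"
      "determined_by ?G (colour \<B>'') (\<lambda>x. pair_mean \<B> g y x)"
      unfolding determined_by_def by (blast intro: pair_mean_cong[OF _ refl] pair_mean_cong[OF refl])+
  qed
  let ?e1 = "sqrt (pair_energy \<B>' a - pair_energy \<B> a)" and ?e2 = "sqrt (pair_energy \<B>' b - pair_energy \<B> b)"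
  \<comment> \<open>In the first two steps the slices at the representatives belong to the new partition.\<close>
  have s1: "- (?h * ?N * ?e1) \<le>
      (\<Sum>x\<in>?G. \<Sum>y\<in>?G. \<Sum>z\<in>coset \<K> (x \<otimes> y). (a x y - ?A x y) * (c x z * b y z))"
  proof (rule step1[rule_format, OF sub], rule conjI)
    fix k assume k: "k \<in> ?keys"
    then have "r1 k \<in> ?G" using r1 by blast
    then show "determined_by ?G (colour \<B>') (\<lambda>x. c x (r1 k))" "determined_by ?G (colour \<B>') (\<lambda>y. b y (r1 k))"
      by (intro indicator; use k b c in \<open>auto simp: new_def Pi_iff\<close>)+
  qed
  have s2: "- (?h * ?N * ?e2) \<le>
      (\<Sum>y\<in>?G. \<Sum>z\<in>?G. \<Sum>x\<in>coset \<K> (y \<otimes> z). (b y z - ?B y z) * (?A x y * c x z))"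
  proof (rule step2[rule_format, OF sub], rule conjI)
    fix k assume k: "k \<in> ?keys"
    then have "r2 k \<in> ?G" using r2 by blast
    then show "determined_by ?G (colour \<B>') (\<lambda>z. c (r2 k) z)"
      by (intro indicator; use k c in \<open>auto simp: new_def Pi_iff\<close>)
    show "determined_by ?G (colour \<B>') (\<lambda>y. ?A (r2 k) y)" by (rule mean(2)[OF sub])
  qed
  \<comment> \<open>Here the old partition already determines both slices, so it is its own refinement.\<close>
  have s3: "0 \<le> (\<Sum>x\<in>?G. \<Sum>z\<in>?G. \<Sum>y\<in>coset \<K> (x \<otimes> z). (c x z - ?C x z) * (?A x y * ?B y z))"
    using step3[rule_format, of \<B>] mean[of \<B>] by simp
  have "(\<Sum>x\<in>?G. \<Sum>y\<in>?G. \<Sum>z\<in>coset \<K> (x \<otimes> y). a x y * b y z * c x z) -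
      (\<Sum>x\<in>?G. \<Sum>y\<in>?G. \<Sum>z\<in>coset \<K> (x \<otimes> y). ?A x y * ?B y z * ?C x z) =
    (\<Sum>x\<in>?G. \<Sum>y\<in>?G. \<Sum>z\<in>coset \<K> (x \<otimes> y). (a x y - ?A x y) * (c x z * b y z)) +
    (\<Sum>x\<in>?G. \<Sum>y\<in>?G. \<Sum>z\<in>coset \<K> (x \<otimes> y). (b y z - ?B y z) * (?A x y * c x z)) +
    (\<Sum>x\<in>?G. \<Sum>y\<in>?G. \<Sum>z\<in>coset \<K> (x \<otimes> y). (c x z - ?C x z) * (?A x y * ?B y z))"
    unfolding sum_subtractf[symmetric] sum.distrib[symmetric]
    by (intro sum.cong refl) (simp add: algebra_simps)
  note decomposition = this
  show thesis
  proof (rule that[OF sub fin card])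
    show "(\<Sum>x\<in>?G. \<Sum>y\<in>?G. \<Sum>z\<in>coset \<K> (x \<otimes> y). a x y * b y z * c x z) \<ge>
      (\<Sum>x\<in>?G. \<Sum>y\<in>?G. \<Sum>z\<in>coset \<K> (x \<otimes> y). ?A x y * ?B y z * ?C x z) - ?h * ?N * (?e1 + ?e2)"
      using decomposition s1 order_trans[OF s2 eq_refl[OF coset_triple_rotate[OF K(1), symmetric]]]
        order_trans[OF s3 eq_refl[OF coset_triple_swap[OF K(1), symmetric]]]
      unfolding distrib_left by linarith
  qed
qed

section \<open>Equidistribution of sums\<close>

text \<open>The balanced indicator of the cell \<open>R\<close>: its mean over each coset vanishes.\<close>

definition deviation :: "'a set set \<Rightarrow> 'a set set \<Rightarrow> 'a set set \<Rightarrow> 'a \<Rightarrow> real" where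
  "deviation \<B> \<K> R z = of_bool (colour \<B> z = R) -
     fibre_mean (carrier G) (colour \<K>) (\<lambda>z. of_bool (colour \<B> z = R)) (colour \<K> z)"

text \<open>The largest Fourier coefficient, without normalisation, of the balanced cell restricted to a coset.\<close>

definition coset_bias :: "'a set set \<Rightarrow> 'a set set \<Rightarrow> 'a set set \<Rightarrow> 'a \<Rightarrow> real" where
  "coset_bias \<B> \<K> R w = (MAX \<xi>\<in>X. \<bar>\<Sum>z\<in>coset \<K> w. deviation \<B> \<K> R z * \<xi> z\<bar>)"

text \<open>For \<open>x\<close> and \<open>y\<close> chosen at random, the cells of \<open>x\<close>, \<open>y\<close>, \<open>x + y\<close> are distributed almost as the cells
of \<open>x\<close>, \<open>y\<close>, \<open>z\<close> with \<open>z\<close> chosen at random in the coset of \<open>x + y\<close>. The test functions \<open>\<theta>\<close> express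
that the distance of the two distributions in total variation is small.\<close>

definition uniform :: "'a set set \<Rightarrow> 'a set set \<Rightarrow> real \<Rightarrow> bool" where
  "uniform \<B> \<K> \<eta> \<longleftrightarrow> (\<forall>\<theta>.
     (\<forall>x\<in>carrier G. \<forall>y\<in>carrier G. \<forall>z\<in>carrier G. \<bar>\<theta> x y z\<bar> \<le> 1) \<longrightarrow>
     determined_by (carrier G \<times> carrier G \<times> carrier G)
       (\<lambda>(x, y, z). (colour \<B> x, colour \<B> y, colour \<B> z)) (\<lambda>(x, y, z). \<theta> x y z) \<longrightarrow>
     \<bar>(\<Sum>x\<in>carrier G. \<Sum>y\<in>carrier G. \<theta> x y (x \<otimes> y)) -
       (\<Sum>x\<in>carrier G. \<Sum>y\<in>carrier G. \<Sum>z\<in>coset \<K> (x \<otimes> y). \<theta> x y z) / real (card (coset \<K> \<one>))\<bar>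
       \<le> \<eta> * real (order G) ^ 2)"

lemma characters_nonempty: "X \<noteq> {}"
  using character_sum[of \<one>] order_pos by auto

lemma abs_character: "\<xi> \<in> X \<Longrightarrow> x \<in> carrier G \<Longrightarrow> \<bar>\<xi> x\<bar> = 1"
  using character_sign[of \<xi> x] by auto

lemma mult_eq_one_iff: "x \<in> carrier G \<Longrightarrow> y \<in> carrier G \<Longrightarrow> x \<otimes> y = \<one> \<longleftrightarrow> x = y"
  using mult_self_left[of x y] square[of x] by auto

lemma character_orthogonality:
  assumes "x \<in> carrier G" "y \<in> carrier G"
  shows "(\<Sum>\<xi>\<in>X. \<xi> x * \<xi> y) = (if x = y then real (order G) else 0)"
  using character_sum[of "x \<otimes> y"] assms by (simp add: character_mult mult_eq_one_iff)

lemma parseval_set: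
  assumes P: "P \<subseteq> carrier G"
  shows "(\<Sum>\<xi>\<in>X. (\<Sum>x\<in>P. \<xi> x)\<^sup>2) = real (order G) * real (card P)"
proof -
  have fin: "finite P" using P finite_carrier by (rule finite_subset)
  have "(\<Sum>\<xi>\<in>X. (\<Sum>x\<in>P. \<xi> x)\<^sup>2) = (\<Sum>\<xi>\<in>X. \<Sum>x\<in>P. \<Sum>y\<in>P. \<xi> x * \<xi> y)"
    by (simp add: power2_eq_square sum_product)
  also have "\<dots> = (\<Sum>x\<in>P. \<Sum>\<xi>\<in>X. \<Sum>y\<in>P. \<xi> x * \<xi> y)" by (rule sum.swap)
  also have "\<dots> = (\<Sum>x\<in>P. \<Sum>y\<in>P. \<Sum>\<xi>\<in>X. \<xi> x * \<xi> y)" by (intro sum.cong refl sum.swap)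
  also have "\<dots> = (\<Sum>x\<in>P. \<Sum>y\<in>P. if x = y then real (order G) else 0)"
    using P by (intro sum.cong refl character_orthogonality) auto
  also have "\<dots> = real (order G) * real (card P)"
    using fin by (simp add: mult.commute)
  finally show ?thesis .
qed

text \<open>Fourier inversion turns the sum into \<open>\<Sum>\<xi>. \<Gamma> \<xi> * \<Phi> \<xi> * \<Psi> \<xi>\<close>, divided by the order of the group. The
first factor is at most \<open>M\<close>, and the sums of the squares of the other two are given by Parseval's identity.\<close>

lemma sum_mult_le_max_fourier:
  assumes P: "P \<subseteq> carrier G" "card P \<le> h" and Q: "Q \<subseteq> carrier G" "card Q \<le> h"
    and M: "\<And>\<xi>. \<xi> \<in> X \<Longrightarrow> \<bar>\<Sum>z\<in>carrier G. \<gamma> z * \<xi> z\<bar> \<le> M"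
  shows "\<bar>\<Sum>x\<in>P. \<Sum>y\<in>Q. \<gamma> (x \<otimes> y)\<bar> \<le> real h * M"
proof -
  define \<Gamma> \<Phi> \<Psi> where "\<Gamma> = (\<lambda>\<xi>::'a \<Rightarrow> real. \<Sum>z\<in>carrier G. \<gamma> z * \<xi> z)"
    and "\<Phi> = (\<lambda>\<xi>::'a \<Rightarrow> real. \<Sum>x\<in>P. \<xi> x)" and "\<Psi> = (\<lambda>\<xi>::'a \<Rightarrow> real. \<Sum>y\<in>Q. \<xi> y)"
  have N: "real (order G) > 0" using order_pos by simp
  obtain \<xi>\<^sub>0 where "\<xi>\<^sub>0 \<in> X" using characters_nonempty by blast
  then have M0: "0 \<le> M" using M[of \<xi>\<^sub>0] by linarith
  have inv: "(\<Sum>\<xi>\<in>X. \<Gamma> \<xi> * (\<xi> x * \<xi> y)) = real (order G) * \<gamma> (x \<otimes> y)"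
    if "x \<in> P" "y \<in> Q" for x y
  proof -
    have xy: "x \<in> carrier G" "y \<in> carrier G" using that P Q by auto
    have "(\<Sum>\<xi>\<in>X. \<Gamma> \<xi> * (\<xi> x * \<xi> y)) = (\<Sum>\<xi>\<in>X. \<Sum>z\<in>carrier G. \<gamma> z * (\<xi> z * \<xi> (x \<otimes> y)))"
      unfolding \<Gamma>_def sum_distrib_right
      using xy by (intro sum.cong refl) (simp add: character_mult)
    also have "\<dots> = (\<Sum>z\<in>carrier G. \<Sum>\<xi>\<in>X. \<gamma> z * (\<xi> z * \<xi> (x \<otimes> y)))" by (rule sum.swap)
    also have "\<dots> = (\<Sum>z\<in>carrier G. if z = x \<otimes> y then real (order G) * \<gamma> (x \<otimes> y) else 0)"
      unfolding sum_distrib_left[symmetric]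
      using xy by (intro sum.cong refl) (simp add: character_orthogonality)
    also have "\<dots> = real (order G) * \<gamma> (x \<otimes> y)" using xy finite_carrier by simp
    finally show ?thesis .
  qed
  have "real (order G) * (\<Sum>x\<in>P. \<Sum>y\<in>Q. \<gamma> (x \<otimes> y)) = (\<Sum>x\<in>P. \<Sum>y\<in>Q. \<Sum>\<xi>\<in>X. \<Gamma> \<xi> * (\<xi> x * \<xi> y))"
    unfolding sum_distrib_left using inv by (intro sum.cong refl) simp
  also have "\<dots> = (\<Sum>x\<in>P. \<Sum>\<xi>\<in>X. \<Sum>y\<in>Q. \<Gamma> \<xi> * (\<xi> x * \<xi> y))" by (intro sum.cong refl sum.swap)
  also have "\<dots> = (\<Sum>\<xi>\<in>X. \<Sum>x\<in>P. \<Sum>y\<in>Q. \<Gamma> \<xi> * (\<xi> x * \<xi> y))" by (rule sum.swap)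
  also have "\<dots> = (\<Sum>\<xi>\<in>X. \<Gamma> \<xi> * (\<Phi> \<xi> * \<Psi> \<xi>))"
    unfolding \<Phi>_def \<Psi>_def sum_product by (simp only: sum_distrib_left)
  finally have "real (order G) * \<bar>\<Sum>x\<in>P. \<Sum>y\<in>Q. \<gamma> (x \<otimes> y)\<bar> = \<bar>\<Sum>\<xi>\<in>X. \<Gamma> \<xi> * (\<Phi> \<xi> * \<Psi> \<xi>)\<bar>"
    by (metis abs_mult abs_of_nat)
  also have "\<dots> \<le> (\<Sum>\<xi>\<in>X. M * (((\<Phi> \<xi>)\<^sup>2 + (\<Psi> \<xi>)\<^sup>2) / 2))"
  proof (rule order_trans[OF sum_abs sum_mono])
    fix \<xi> assume \<xi>: "\<xi> \<in> X"
    have "\<bar>\<Phi> \<xi> * \<Psi> \<xi>\<bar> \<le> ((\<Phi> \<xi>)\<^sup>2 + (\<Psi> \<xi>)\<^sup>2) / 2"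
      using sum_squares_bound[of "\<bar>\<Phi> \<xi>\<bar>" "\<bar>\<Psi> \<xi>\<bar>"] by (simp add: abs_mult)
    then show "\<bar>\<Gamma> \<xi> * (\<Phi> \<xi> * \<Psi> \<xi>)\<bar> \<le> M * (((\<Phi> \<xi>)\<^sup>2 + (\<Psi> \<xi>)\<^sup>2) / 2)"
      unfolding abs_mult[of "\<Gamma> \<xi>"] using M[OF \<xi>] M0 by (intro mult_mono) (auto simp: \<Gamma>_def)
  qed
  also have "\<dots> = M * ((real (order G) * real (card P) + real (order G) * real (card Q)) / 2)"
    using parseval_set[OF P(1)] parseval_set[OF Q(1)]
    by (simp add: \<Phi>_def \<Psi>_def sum_distrib_left[symmetric] sum_divide_distrib[symmetric] sum.distrib)
  also have "\<dots> = real (order G) * (M * ((real (card P) + real (card Q)) / 2))" by (simp add: algebra_simps)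
  also have "\<dots> \<le> real (order G) * (M * real h)"
    using P(2) Q(2) M0 by (intro mult_left_mono) auto
  finally show ?thesis using N by (simp add: mult.commute)
qed

lemma coset_self: "w \<in> carrier G \<Longrightarrow> w \<in> coset \<K> w"
  unfolding coset_def by simp

lemma sum_over_cosets:
  fixes f :: "'a \<Rightarrow> 'a \<Rightarrow> real"
  shows "(\<Sum>w\<in>carrier G. \<Sum>z\<in>coset \<K> w. f w z) = (\<Sum>z\<in>carrier G. \<Sum>w\<in>coset \<K> z. f w z)"
proof -
  have "(\<Sum>w\<in>carrier G. \<Sum>z\<in>coset \<K> w. f w z) =
      (\<Sum>z\<in>carrier G. \<Sum>w\<in>carrier G. if z \<in> coset \<K> w then f w z else 0)"
    unfolding sum_coset by (rule sum.swap)
  also have "\<dots> = (\<Sum>z\<in>carrier G. \<Sum>w\<in>coset \<K> z. f w z)"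
    unfolding sum_coset by (intro sum.cong refl if_cong) (auto simp: coset_def)
  finally show ?thesis .
qed

text \<open>Each point is counted once for every element of its coset.\<close>

lemma sum_coset_average:
  fixes f :: "'a \<Rightarrow> real"
  assumes "\<K> \<subseteq> kernels"
  shows "(\<Sum>w\<in>carrier G. \<Sum>z\<in>coset \<K> w. f z) = real (card (coset \<K> \<one>)) * (\<Sum>z\<in>carrier G. f z)"
proof -
  have "(\<Sum>w\<in>carrier G. \<Sum>z\<in>coset \<K> w. f z) = (\<Sum>z\<in>carrier G. \<Sum>w\<in>coset \<K> z. f z)"
    by (rule sum_over_cosets)
  also have "\<dots> = (\<Sum>z\<in>carrier G. real (card (coset \<K> \<one>)) * f z)"
    by (rule sum.cong[OF refl]) (simp only: sum_constant card_coset[OF assms])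
  finally show ?thesis by (simp add: sum_distrib_left)
qed

lemma fibre_mean_coset:
  assumes "\<K> \<subseteq> kernels" "w \<in> carrier G"
  shows "fibre_mean (carrier G) (colour \<K>) g (colour \<K> w) = (\<Sum>z\<in>coset \<K> w. g z) / real (card (coset \<K> \<one>))"
  unfolding fibre_mean_def coset_def[symmetric] card_coset[OF assms] ..

lemma coset_bias_upper:
  assumes "\<xi> \<in> X"
  shows "\<bar>\<Sum>z\<in>coset \<K> w. deviation \<B> \<K> R z * \<xi> z\<bar> \<le> coset_bias \<B> \<K> R w"
  unfolding coset_bias_def using assms finite_characters by (intro Max_ge) auto

lemma coset_bias_attained:
  obtains \<xi> where "\<xi> \<in> X" "coset_bias \<B> \<K> R w = \<bar>\<Sum>z\<in>coset \<K> w. deviation \<B> \<K> R z * \<xi> z\<bar>"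
proof -
  have "coset_bias \<B> \<K> R w \<in> (\<lambda>\<xi>. \<bar>\<Sum>z\<in>coset \<K> w. deviation \<B> \<K> R z * \<xi> z\<bar>) ` X"
    unfolding coset_bias_def using finite_characters characters_nonempty by (intro Max_in) auto
  then show thesis using that by blast
qed

text \<open>On the product of two cells, each intersected with a coset, the weight \<open>t\<close> is constant and the
Fourier bound applies. The factor \<open>(2 ^ card \<B>)\<^sup>2\<close> counts the pairs of cells.\<close>

lemma block_bias:
  assumes K: "\<K> \<subseteq> kernels" and B: "finite \<B>" and xy: "x\<^sub>0 \<in> carrier G" "y\<^sub>0 \<in> carrier G"
    and t_le: "\<And>x y. x \<in> carrier G \<Longrightarrow> y \<in> carrier G \<Longrightarrow> \<bar>t x y\<bar> \<le> (1::real)"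
    and t_const: "\<And>x y x' y'. x \<in> coset \<K> x\<^sub>0 \<Longrightarrow> x' \<in> coset \<K> x\<^sub>0 \<Longrightarrow> y \<in> coset \<K> y\<^sub>0 \<Longrightarrow> y' \<in> coset \<K> y\<^sub>0 \<Longrightarrow>
      colour \<B> x = colour \<B> x' \<Longrightarrow> colour \<B> y = colour \<B> y' \<Longrightarrow> t x y = t x' y'"
  shows "\<bar>\<Sum>x\<in>coset \<K> x\<^sub>0. \<Sum>y\<in>coset \<K> y\<^sub>0. t x y * deviation \<B> \<K> R (x \<otimes> y)\<bar> \<le>
    (2 ^ card \<B>)\<^sup>2 * (real (card (coset \<K> \<one>)) * coset_bias \<B> \<K> R (x\<^sub>0 \<otimes> y\<^sub>0))"
proof -
  let ?c = "colour \<B>" and ?d = "deviation \<B> \<K> R" and ?w = "x\<^sub>0 \<otimes> y\<^sub>0"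
  let ?h = "card (coset \<K> \<one>)"
  define C where "C = ?c ` carrier G"
  define P Q where "P = (\<lambda>p. {x \<in> coset \<K> x\<^sub>0. ?c x = p})" and "Q = (\<lambda>q. {y \<in> coset \<K> y\<^sub>0. ?c y = q})"
  have C: "finite C" "card C \<le> 2 ^ card \<B>" unfolding C_def using card_colour_image_le[OF B] by auto
  have PQ: "P p \<subseteq> carrier G" "Q p \<subseteq> carrier G" "P p \<subseteq> coset \<K> x\<^sub>0" "Q p \<subseteq> coset \<K> y\<^sub>0" for p
    unfolding P_def Q_def using coset_subset by auto
  have cards: "card (P p) \<le> ?h" "card (Q p) \<le> ?h" for p
    using card_mono[OF finite_coset PQ(3)] card_mono[OF finite_coset PQ(4)]
      card_coset[OF K xy(1)] card_coset[OF K xy(2)] by auto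
  \<comment> \<open>Restricting to the coset of the sum changes nothing on the block, but replaces Fourier coefficients on the
    whole group by those on this coset.\<close>
  define \<gamma> where "\<gamma> = (\<lambda>z. if z \<in> coset \<K> ?w then ?d z else 0)"
  have bias0: "0 \<le> coset_bias \<B> \<K> R ?w"
    using characters_nonempty order_trans[OF abs_ge_zero coset_bias_upper] by blast
  have block: "\<bar>\<Sum>x\<in>P p. \<Sum>y\<in>Q q. t x y * ?d (x \<otimes> y)\<bar> \<le> real ?h * coset_bias \<B> \<K> R ?w" for p q
  proof (cases "P p = {} \<or> Q q = {}")
    case True
    then show ?thesis using bias0 by auto
  next
    case False
    then obtain x1 y1 where xy1: "x1 \<in> P p" "y1 \<in> Q q" by blast
    have "(\<Sum>x\<in>P p. \<Sum>y\<in>Q q. t x y * ?d (x \<otimes> y)) = (\<Sum>x\<in>P p. \<Sum>y\<in>Q q. t x1 y1 * \<gamma> (x \<otimes> y))"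
    proof (intro sum.cong refl)
      fix x y assume x: "x \<in> P p" and y: "y \<in> Q q"
      have "t x y = t x1 y1" using x y xy1 unfolding P_def Q_def by (intro t_const) auto
      moreover have "x \<otimes> y \<in> coset \<K> ?w"
      proof -
        have "x \<in> carrier G" "y \<in> carrier G" "colour \<K> x = colour \<K> x\<^sub>0" "colour \<K> y = colour \<K> y\<^sub>0"
          using x y unfolding P_def Q_def coset_def by auto
        then show ?thesis unfolding coset_def using colour_mult_cong[OF K _ _ xy] by auto
      qed
      ultimately show "t x y * ?d (x \<otimes> y) = t x1 y1 * \<gamma> (x \<otimes> y)" by (simp add: \<gamma>_def)
    qed
    also have "\<bar>\<dots>\<bar> = \<bar>t x1 y1\<bar> * \<bar>\<Sum>x\<in>P p. \<Sum>y\<in>Q q. \<gamma> (x \<otimes> y)\<bar>"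
      by (simp add: sum_distrib_left[symmetric] abs_mult)
    also have "\<dots> \<le> 1 * (real ?h * coset_bias \<B> \<K> R ?w)"
    proof (rule mult_mono)
      show "\<bar>t x1 y1\<bar> \<le> 1" using xy1 PQ by (intro t_le) auto
      show "\<bar>\<Sum>x\<in>P p. \<Sum>y\<in>Q q. \<gamma> (x \<otimes> y)\<bar> \<le> real ?h * coset_bias \<B> \<K> R ?w"
      proof (rule sum_mult_le_max_fourier[OF PQ(1) cards(1) PQ(2) cards(2)])
        fix \<xi> assume "\<xi> \<in> X"
        have "(\<Sum>z\<in>carrier G. \<gamma> z * \<xi> z) = (\<Sum>z\<in>coset \<K> ?w. ?d z * \<xi> z)"
          unfolding sum_coset \<gamma>_def by (intro sum.cong refl) simp
        then show "\<bar>\<Sum>z\<in>carrier G. \<gamma> z * \<xi> z\<bar> \<le> coset_bias \<B> \<K> R ?w"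
          using coset_bias_upper[OF \<open>\<xi> \<in> X\<close>, where w = ?w and \<K> = \<K> and \<B> = \<B> and R = R] by simp
      qed
    qed auto
    finally show ?thesis by simp
  qed
  have "(\<Sum>x\<in>coset \<K> x\<^sub>0. \<Sum>y\<in>coset \<K> y\<^sub>0. t x y * ?d (x \<otimes> y)) =
      (\<Sum>p\<in>C. \<Sum>x\<in>P p. \<Sum>q\<in>C. \<Sum>y\<in>Q q. t x y * ?d (x \<otimes> y))"
    unfolding P_def Q_def
    using C(1) coset_subset finite_coset by (subst (1 2) sum.group) (auto simp: C_def)
  also have "\<dots> = (\<Sum>p\<in>C. \<Sum>q\<in>C. \<Sum>x\<in>P p. \<Sum>y\<in>Q q. t x y * ?d (x \<otimes> y))"
    by (intro sum.cong refl sum.swap)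
  also have "\<bar>\<dots>\<bar> \<le> (\<Sum>p\<in>C. \<Sum>q\<in>C. real ?h * coset_bias \<B> \<K> R ?w)"
    by (intro order_trans[OF sum_abs] sum_mono order_trans[OF sum_abs] block)
  also have "\<dots> = (real (card C))\<^sup>2 * (real ?h * coset_bias \<B> \<K> R ?w)"
    by (simp add: power2_eq_square)
  also have "\<dots> \<le> (2 ^ card \<B>)\<^sup>2 * (real ?h * coset_bias \<B> \<K> R ?w)"
    using C(2) bias0 by (intro mult_right_mono power_mono) (auto simp flip: of_nat_power)
  finally show ?thesis .
qed

text \<open>A test function that is constant on cells is a combination of the indicators of the cells \<open>R\<close> of the third
variable, with coefficients \<open>t R x y\<close>. The difference of the two averages then only involves the balanced
indicators of these cells, evaluated at \<open>x \<otimes> y\<close>, and \<open>block_bias\<close> bounds it on each pair of cosets.\<close>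

lemma uniform_if_unbiased:
  assumes K: "\<K> \<subseteq> kernels" and B: "finite \<B>"
    and bias: "(\<Sum>R\<in>colour \<B> ` carrier G. \<Sum>w\<in>carrier G. coset_bias \<B> \<K> R w) \<le>
      \<eta>' * real (order G) * real (card (coset \<K> \<one>))"
    and \<eta>: "(2 ^ card \<B>)\<^sup>2 * \<eta>' \<le> \<eta>"
  shows "uniform (\<B> \<union> \<K>) \<K> \<eta>"
  unfolding uniform_def
proof (intro allI impI)
  let ?c = "colour \<B>" and ?\<kappa> = "colour \<K>" and ?G = "carrier G"
  let ?h = "real (card (coset \<K> \<one>))" and ?N = "real (order G)"
  fix \<theta> :: "'a \<Rightarrow> 'a \<Rightarrow> 'a \<Rightarrow> real"
  assume \<theta>_le: "\<forall>x\<in>?G. \<forall>y\<in>?G. \<forall>z\<in>?G. \<bar>\<theta> x y z\<bar> \<le> 1"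
    and inv: "determined_by (?G \<times> ?G \<times> ?G)
      (\<lambda>(x, y, z). (colour (\<B> \<union> \<K>) x, colour (\<B> \<union> \<K>) y, colour (\<B> \<union> \<K>) z)) (\<lambda>(x, y, z). \<theta> x y z)"
  have \<theta>_inv: "\<theta> x y z = \<theta> x' y' z'"
    if "x \<in> ?G" "y \<in> ?G" "z \<in> ?G" "x' \<in> ?G" "y' \<in> ?G" "z' \<in> ?G"
      "?c x = ?c x'" "?c y = ?c y'" "?c z = ?c z'" "?\<kappa> x = ?\<kappa> x'" "?\<kappa> y = ?\<kappa> y'" "?\<kappa> z = ?\<kappa> z'"
    for x y z x' y' z'
  proof -
    have "colour (\<B> \<union> \<K>) x = colour (\<B> \<union> \<K>) x'" "colour (\<B> \<union> \<K>) y = colour (\<B> \<union> \<K>) y'"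
      "colour (\<B> \<union> \<K>) z = colour (\<B> \<union> \<K>) z'"
      using that(7-12) unfolding colour_eq_iff ball_Un by simp_all
    then show ?thesis using determined_byD[OF inv, of "(x, y, z)" "(x', y', z')"] that(1-6) by simp
  qed
  have hpos: "?h > 0" using card_coset_pos by simp
  define atom where "atom = (\<lambda>R k. {z \<in> ?G. ?c z = R \<and> ?\<kappa> z = k})"
  \<comment> \<open>The value of the test function at the cell of the third variable that is given by \<open>R\<close> and by the coset of
    the product, and \<open>0\<close> if there is no such cell.\<close>
  define t where "t = (\<lambda>R x y. if atom R (?\<kappa> (x \<otimes> y)) = {} then 0
    else \<theta> x y (SOME z. z \<in> atom R (?\<kappa> (x \<otimes> y))))"
  have t_eq: "t (?c z) x y = \<theta> x y z" if "x \<in> ?G" "y \<in> ?G" "z \<in> coset \<K> (x \<otimes> y)" for x y z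
  proof -
    let ?A = "atom (?c z) (?\<kappa> (x \<otimes> y))"
    have z: "z \<in> ?A" using that unfolding atom_def coset_def by simp
    then have "(SOME z. z \<in> ?A) \<in> ?A" by (rule someI)
    then show ?thesis
      using z that unfolding t_def by (auto simp: atom_def intro!: \<theta>_inv)
  qed
  have t_le: "\<bar>t R x y\<bar> \<le> 1" if "x \<in> ?G" "y \<in> ?G" for R x y
  proof (cases "atom R (?\<kappa> (x \<otimes> y)) = {}")
    case False
    then have "(SOME z. z \<in> atom R (?\<kappa> (x \<otimes> y))) \<in> atom R (?\<kappa> (x \<otimes> y))" by (simp add: some_in_eq)
    then have "(SOME z. z \<in> atom R (?\<kappa> (x \<otimes> y))) \<in> ?G" unfolding atom_def by simp
    then show ?thesis using False \<theta>_le that unfolding t_def by simp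
  qed (simp add: t_def)
  have t_const: "t R x y = t R x' y'"
    if x0: "x\<^sub>0 \<in> ?G" "y\<^sub>0 \<in> ?G" and mem: "x \<in> coset \<K> x\<^sub>0" "x' \<in> coset \<K> x\<^sub>0" "y \<in> coset \<K> y\<^sub>0" "y' \<in> coset \<K> y\<^sub>0"
      and c: "?c x = ?c x'" "?c y = ?c y'" for R x\<^sub>0 y\<^sub>0 x x' y y'
  proof -
    have G: "x \<in> ?G" "y \<in> ?G" "x' \<in> ?G" "y' \<in> ?G" and \<kappa>: "?\<kappa> x = ?\<kappa> x'" "?\<kappa> y = ?\<kappa> y'"
      using mem unfolding coset_def by auto
    have eq: "?\<kappa> (x \<otimes> y) = ?\<kappa> (x' \<otimes> y')" by (rule colour_mult_cong[OF K G \<kappa>])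
    show ?thesis
    proof (cases "atom R (?\<kappa> (x \<otimes> y)) = {}")
      case False
      then have "(SOME z. z \<in> atom R (?\<kappa> (x \<otimes> y))) \<in> atom R (?\<kappa> (x \<otimes> y))" by (simp add: some_in_eq)
      then have "(SOME z. z \<in> atom R (?\<kappa> (x \<otimes> y))) \<in> ?G" unfolding atom_def by simp
      then show ?thesis
        using False \<theta>_inv[OF G(1,2) _ G(3,4) _ c refl \<kappa> refl] unfolding t_def eq by simp
    qed (simp add: t_def eq)
  qed
  define C where "C = ?c ` ?G"
  have finC: "finite C" unfolding C_def using finite_carrier by simp
  have pick: "(\<Sum>R\<in>C. t R x y * of_bool (?c z = R)) = \<theta> x y z"
    if "x \<in> ?G" "y \<in> ?G" "z \<in> coset \<K> (x \<otimes> y)" for x y z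
  proof -
    have "?c z \<in> C" using that unfolding C_def coset_def by blast
    have "(\<Sum>R\<in>C. t R x y * of_bool (?c z = R)) = (\<Sum>R\<in>C. if R = ?c z then t (?c z) x y else 0)"
      by (intro sum.cong refl) auto
    then show ?thesis using \<open>?c z \<in> C\<close> finC t_eq[OF that] by simp
  qed
  have pointwise: "\<theta> x y (x \<otimes> y) - (\<Sum>z\<in>coset \<K> (x \<otimes> y). \<theta> x y z) / ?h =
    (\<Sum>R\<in>C. t R x y * deviation \<B> \<K> R (x \<otimes> y))" if xy: "x \<in> ?G" "y \<in> ?G" for x y
  proof -
    have "(\<Sum>z\<in>coset \<K> (x \<otimes> y). \<theta> x y z) = (\<Sum>z\<in>coset \<K> (x \<otimes> y). \<Sum>R\<in>C. t R x y * of_bool (?c z = R))"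
      using pick[OF xy] by simp
    also have "\<dots> = (\<Sum>R\<in>C. t R x y * (\<Sum>z\<in>coset \<K> (x \<otimes> y). of_bool (?c z = R)))"
      unfolding sum_distrib_left by (rule sum.swap)
    finally have "(\<Sum>z\<in>coset \<K> (x \<otimes> y). \<theta> x y z) / ?h =
        (\<Sum>R\<in>C. t R x y * fibre_mean ?G ?\<kappa> (\<lambda>z. of_bool (?c z = R)) (?\<kappa> (x \<otimes> y)))"
      using xy by (simp add: fibre_mean_coset[OF K] sum_divide_distrib[where A = C])
    moreover have "\<theta> x y (x \<otimes> y) = (\<Sum>R\<in>C. t R x y * of_bool (?c (x \<otimes> y) = R))"
      using pick[OF xy coset_self] xy by simp
    ultimately show ?thesis
      unfolding deviation_def by (simp only: right_diff_distrib sum_subtractf)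
  qed
  have local: "\<bar>\<Sum>x\<in>?G. \<Sum>y\<in>?G. t R x y * deviation \<B> \<K> R (x \<otimes> y)\<bar> \<le>
    (2 ^ card \<B>)\<^sup>2 * ?N * (\<Sum>w\<in>?G. coset_bias \<B> \<K> R w) / ?h" for R
  proof -
    let ?f = "\<lambda>x y. t R x y * deviation \<B> \<K> R (x \<otimes> y)"
    have "?h\<^sup>2 * (\<Sum>x\<in>?G. \<Sum>y\<in>?G. ?f x y) = ?h * (\<Sum>x\<in>?G. \<Sum>y\<^sub>0\<in>?G. \<Sum>y\<in>coset \<K> y\<^sub>0. ?f x y)"
      unfolding sum_coset_average[OF K] by (simp add: power2_eq_square sum_distrib_left mult.assoc)
    also have "\<dots> = (\<Sum>x\<^sub>0\<in>?G. \<Sum>x\<in>coset \<K> x\<^sub>0. \<Sum>y\<^sub>0\<in>?G. \<Sum>y\<in>coset \<K> y\<^sub>0. ?f x y)"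
      by (rule sum_coset_average[OF K, symmetric])
    also have "\<dots> = (\<Sum>x\<^sub>0\<in>?G. \<Sum>y\<^sub>0\<in>?G. \<Sum>x\<in>coset \<K> x\<^sub>0. \<Sum>y\<in>coset \<K> y\<^sub>0. ?f x y)"
      by (intro sum.cong refl sum.swap)
    also have "\<bar>\<dots>\<bar> \<le> (\<Sum>x\<^sub>0\<in>?G. \<Sum>y\<^sub>0\<in>?G. (2 ^ card \<B>)\<^sup>2 * (?h * coset_bias \<B> \<K> R (x\<^sub>0 \<otimes> y\<^sub>0)))"
      by (intro order_trans[OF sum_abs] sum_mono order_trans[OF sum_abs] block_bias[OF K B] t_le t_const)
    also have "\<dots> = (\<Sum>x\<^sub>0\<in>?G. \<Sum>w\<in>?G. (2 ^ card \<B>)\<^sup>2 * (?h * coset_bias \<B> \<K> R w))"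
      by (intro sum.cong refl sum.reindex_bij_betw[OF bij_betw_mult])
    also have "\<dots> = ?h * ((2 ^ card \<B>)\<^sup>2 * ?N * (\<Sum>w\<in>?G. coset_bias \<B> \<K> R w))"
      unfolding sum_distrib_left[symmetric] sum_constant order_def by (simp add: mult_ac)
    finally have "?h * (?h * \<bar>\<Sum>x\<in>?G. \<Sum>y\<in>?G. ?f x y\<bar>) \<le>
        ?h * ((2 ^ card \<B>)\<^sup>2 * ?N * (\<Sum>w\<in>?G. coset_bias \<B> \<K> R w))"
      by (simp add: abs_mult power2_eq_square mult.assoc)
    then show ?thesis using hpos by (simp add: pos_le_divide_eq mult.commute)
  qed
  have "(\<Sum>x\<in>?G. \<Sum>y\<in>?G. \<theta> x y (x \<otimes> y)) - (\<Sum>x\<in>?G. \<Sum>y\<in>?G. \<Sum>z\<in>coset \<K> (x \<otimes> y). \<theta> x y z) / ?h =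
      (\<Sum>x\<in>?G. \<Sum>y\<in>?G. \<theta> x y (x \<otimes> y) - (\<Sum>z\<in>coset \<K> (x \<otimes> y). \<theta> x y z) / ?h)"
    by (simp add: sum_subtractf sum_divide_distrib)
  also have "\<dots> = (\<Sum>x\<in>?G. \<Sum>y\<in>?G. \<Sum>R\<in>C. t R x y * deviation \<B> \<K> R (x \<otimes> y))"
    using pointwise by simp
  also have "\<dots> = (\<Sum>x\<in>?G. \<Sum>R\<in>C. \<Sum>y\<in>?G. t R x y * deviation \<B> \<K> R (x \<otimes> y))"
    by (intro sum.cong refl sum.swap)
  also have "\<dots> = (\<Sum>R\<in>C. \<Sum>x\<in>?G. \<Sum>y\<in>?G. t R x y * deviation \<B> \<K> R (x \<otimes> y))"
    by (rule sum.swap)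
  also have "\<bar>\<dots>\<bar> \<le> (\<Sum>R\<in>C. (2 ^ card \<B>)\<^sup>2 * ?N * (\<Sum>w\<in>?G. coset_bias \<B> \<K> R w) / ?h)"
    by (intro order_trans[OF sum_abs] sum_mono local)
  also have "\<dots> = (2 ^ card \<B>)\<^sup>2 * ?N * (\<Sum>R\<in>C. \<Sum>w\<in>?G. coset_bias \<B> \<K> R w) / ?h"
    by (simp add: sum_distrib_left sum_divide_distrib)
  also have "\<dots> \<le> (2 ^ card \<B>)\<^sup>2 * ?N * (\<eta>' * ?N * ?h) / ?h"
    using bias unfolding C_def by (intro divide_right_mono mult_left_mono) auto
  also have "\<dots> = ((2 ^ card \<B>)\<^sup>2 * \<eta>') * ?N\<^sup>2"
    using hpos by (simp add: power2_eq_square)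
  also have "\<dots> \<le> \<eta> * ?N\<^sup>2" using \<eta> by (intro mult_right_mono) auto
  finally show "\<bar>(\<Sum>x\<in>?G. \<Sum>y\<in>?G. \<theta> x y (x \<otimes> y)) -
      (\<Sum>x\<in>?G. \<Sum>y\<in>?G. \<Sum>z\<in>coset \<K> (x \<otimes> y). \<theta> x y z) / ?h\<bar> \<le> \<eta> * ?N ^ 2" .
qed

text \<open>In each coset take the character that attains the maximum and give it the sign that makes the sum
positive. The resulting function \<open>u R\<close> is known as soon as the coset and the value of the character of this
coset are known.\<close>

lemma coset_bias_eq_twisted_sum:
  "\<exists>(\<xi> :: 'a set set \<Rightarrow> 'a set set \<Rightarrow> 'a \<Rightarrow> real) u. (\<forall>R k. \<xi> R k \<in> X) \<and>
    (\<forall>R. determined_by (carrier G) (\<lambda>z. (colour \<K> z, \<xi> R (colour \<K> z) z)) (u R)) \<and>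
    (\<forall>R. \<forall>z\<in>carrier G. \<bar>u R z\<bar> \<le> 1) \<and>
    (\<forall>R. \<forall>w\<in>carrier G. coset_bias \<B> \<K> R w = (\<Sum>z\<in>coset \<K> w. deviation \<B> \<K> R z * u R z))"
proof -
  let ?s = "\<lambda>R k \<xi>. \<Sum>z\<in>{z \<in> carrier G. colour \<K> z = k}. deviation \<B> \<K> R z * \<xi> z"
  have "\<exists>\<xi>\<in>X. \<forall>w\<in>carrier G. colour \<K> w = k \<longrightarrow> coset_bias \<B> \<K> R w = \<bar>?s R k \<xi>\<bar>" for R k
  proof (cases "\<exists>w\<in>carrier G. colour \<K> w = k")
    case True
    then obtain v where v: "colour \<K> v = k" by blast
    obtain \<xi> where \<xi>: "\<xi> \<in> X" "coset_bias \<B> \<K> R v = \<bar>\<Sum>z\<in>coset \<K> v. deviation \<B> \<K> R z * \<xi> z\<bar>"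
      using coset_bias_attained .
    have "coset_bias \<B> \<K> R w = \<bar>?s R k \<xi>\<bar>" if "colour \<K> w = k" for w
    proof -
      have "coset \<K> w = coset \<K> v" using that v by (simp add: coset_def)
      then have "coset_bias \<B> \<K> R w = coset_bias \<B> \<K> R v" by (simp add: coset_bias_def)
      then show ?thesis using \<xi>(2) v by (simp add: coset_def)
    qed
    then show ?thesis using \<xi>(1) by blast
  qed (use characters_nonempty in blast)
  note ex = this[unfolded Bex_def]
  define \<xi> where "\<xi> = (\<lambda>R k. SOME \<xi>. \<xi> \<in> X \<and>
    (\<forall>w\<in>carrier G. colour \<K> w = k \<longrightarrow> coset_bias \<B> \<K> R w = \<bar>?s R k \<xi>\<bar>))"
  have \<xi>: "\<xi> R k \<in> X"
    "w \<in> carrier G \<Longrightarrow> colour \<K> w = k \<Longrightarrow> coset_bias \<B> \<K> R w = \<bar>?s R k (\<xi> R k)\<bar>" for R k w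
    using someI_ex[OF ex[of k R]] unfolding \<xi>_def by blast+
  define u where "u = (\<lambda>R z. sgn (?s R (colour \<K> z) (\<xi> R (colour \<K> z))) * \<xi> R (colour \<K> z) z)"
  show ?thesis
  proof (intro exI[of _ \<xi>] exI[of _ u] conjI allI ballI)
    show "determined_by (carrier G) (\<lambda>z. (colour \<K> z, \<xi> R (colour \<K> z) z)) (u R)" for R
      by (rule determined_byI) (auto simp: u_def)
    show "\<bar>u R z\<bar> \<le> 1" if "z \<in> carrier G" for R z
      unfolding u_def using abs_character[OF \<xi>(1) that] by (simp add: abs_mult abs_sgn_eq)
    show "coset_bias \<B> \<K> R w = (\<Sum>z\<in>coset \<K> w. deviation \<B> \<K> R z * u R z)" if w: "w \<in> carrier G" for R w
    proof -
      let ?t = "?s R (colour \<K> w) (\<xi> R (colour \<K> w))"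
      have "coset_bias \<B> \<K> R w = sgn ?t * ?t" using \<xi>(2)[OF w refl] by (simp add: abs_sgn mult.commute)
      also have "\<dots> = (\<Sum>z\<in>coset \<K> w. deviation \<B> \<K> R z * u R z)"
        unfolding sum_distrib_left coset_def by (intro sum.cong refl) (auto simp: u_def)
      finally show ?thesis .
    qed
  qed (rule \<xi>(1))
qed

definition atom_energy :: "'a set set \<Rightarrow> 'a set set \<Rightarrow> real" where
  "atom_energy \<B> \<K> = (\<Sum>R\<in>colour \<B> ` carrier G.
     fibre_energy (carrier G) (colour \<K>) (\<lambda>z. of_bool (colour \<B> z = R)))"

text \<open>Adding the kernels of the maximising characters makes the twisted function \<open>u R\<close> constant on the new
cosets. It correlates with the balanced cell, so the density of the cell varies between the new cosets
more than between the old ones.\<close>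

lemma bias_energy_increment:
  assumes K: "\<K> \<subseteq> kernels" "finite \<K>" and B: "finite \<B>" "card \<B> \<le> s" and \<eta>: "0 \<le> \<eta>"
    and bias: "(\<Sum>R\<in>colour \<B> ` carrier G. \<Sum>w\<in>carrier G. coset_bias \<B> \<K> R w) >
      \<eta> * real (order G) * real (card (coset \<K> \<one>))"
  obtains \<K>' where "\<K>' \<subseteq> kernels" "finite \<K>'" "card \<K>' \<le> card \<K> + 2 ^ s * 2 ^ card \<K>"
    and "atom_energy \<B> \<K>' \<ge> atom_energy \<B> \<K> + \<eta>\<^sup>2 / 2 ^ s * real (order G)"
proof -
  let ?G = "carrier G" and ?h = "real (card (coset \<K> \<one>))" and ?N = "real (order G)"
  define C where "C = colour \<B> ` ?G"
  obtain \<xi> u where props: "\<forall>R k. \<xi> R k \<in> X"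
    "\<forall>R. determined_by ?G (\<lambda>z. (colour \<K> z, \<xi> R (colour \<K> z) z)) (u R)"
    "\<forall>R. \<forall>z\<in>?G. \<bar>u R z\<bar> \<le> 1"
    "\<forall>R. \<forall>w\<in>?G. coset_bias \<B> \<K> R w = (\<Sum>z\<in>coset \<K> w. deviation \<B> \<K> R z * u R z)"
    using coset_bias_eq_twisted_sum[of \<K> \<B>] by (elim exE conjE) (rule that)
  note \<xi> = props(1)[rule_format] and u_det = props(2)[rule_format] and u_le = props(3)[rule_format]
    and u_bias = props(4)[rule_format]
  define new where "new = (\<lambda>(R, k). {x \<in> ?G. \<xi> R k x = 1}) ` (C \<times> colour \<K> ` ?G)"
  define \<K>' where "\<K>' = \<K> \<union> new"
  have C: "finite C" "card C \<le> 2 ^ s"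
    unfolding C_def using card_colour_image_le[OF B(1), of ?G] power_increasing[OF B(2), of "2::nat"]
    by (auto intro: order_trans)
  then have C_real: "real (card C) \<le> 2 ^ s" by (metis of_nat_le_iff of_nat_numeral of_nat_power)
  note keys = card_colour_image_le[OF K(2), of ?G]
  have "card new \<le> card C * card (colour \<K> ` ?G)"
    unfolding new_def using C(1) keys(1)
    by (intro order_trans[OF card_image_le]) (auto simp: card_cartesian_product)
  also have "\<dots> \<le> 2 ^ s * 2 ^ card \<K>" by (intro mult_mono C(2) keys(2)) auto
  finally have "card \<K>' \<le> card \<K> + 2 ^ s * 2 ^ card \<K>"
    unfolding \<K>'_def by (intro order_trans[OF card_Un_le]) simp
  moreover have "\<K>' \<subseteq> kernels" unfolding \<K>'_def new_def kernels_def using K(1) \<xi> by (auto simp: kernels_def)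
  moreover have "finite \<K>'" unfolding \<K>'_def new_def using K(2) C(1) keys(1) by simp
  moreover have "atom_energy \<B> \<K>' \<ge> atom_energy \<B> \<K> + \<eta>\<^sup>2 / 2 ^ s * ?N"
  proof -
    \<comment> \<open>Cauchy--Schwarz over the cells combines the gains; the number of cells is the factor lost in the gain.\<close>
    define t where "t = (\<lambda>R. \<Sum>z\<in>?G. deviation \<B> \<K> R z * u R z)"
    define \<Delta> where "\<Delta> = (\<lambda>R. fibre_energy ?G (colour \<K>') (\<lambda>z. of_bool (colour \<B> z = R)) -
      fibre_energy ?G (colour \<K>) (\<lambda>z. of_bool (colour \<B> z = R)))"
    have gain: "(t R)\<^sup>2 \<le> ?N * \<Delta> R" if R: "R \<in> C" for R
      unfolding t_def \<Delta>_def deviation_def order_def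
    proof (rule correlation_le_energy_gain[OF finite_carrier])
      show "determined_by ?G (colour \<K>') (colour \<K>)"
        unfolding \<K>'_def by (rule determined_byI, rule colour_eq_mono) auto
      show "determined_by ?G (colour \<K>') (u R)"
      proof (rule determined_byI)
        fix x y assume xy: "x \<in> ?G" "y \<in> ?G" and c: "colour \<K>' x = colour \<K>' y"
        have k: "colour \<K> x = colour \<K> y" using c by (rule colour_eq_mono) (simp add: \<K>'_def)
        let ?\<xi> = "\<xi> R (colour \<K> y)"
        have "{x \<in> ?G. ?\<xi> x = 1} \<in> \<K>'" unfolding \<K>'_def new_def using R xy by blast
        moreover have "\<forall>K\<in>\<K>'. x \<in> K \<longleftrightarrow> y \<in> K" using c by (simp only: colour_eq_iff)
        ultimately have "x \<in> {x \<in> ?G. ?\<xi> x = 1} \<longleftrightarrow> y \<in> {x \<in> ?G. ?\<xi> x = 1}" by (rule bspec[rotated])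
        then have "?\<xi> x = ?\<xi> y"
          using xy character_sign[OF \<xi>[of R "colour \<K> y"] xy(1)]
            character_sign[OF \<xi>[of R "colour \<K> y"] xy(2)] by auto
        then show "u R x = u R y" using determined_byD[OF u_det xy] k by simp
      qed
    qed (rule u_le)
    have h: "?h > 0" and N: "?N > 0" using card_coset_pos order_pos by simp_all
    have "(\<Sum>R\<in>C. \<Sum>w\<in>?G. coset_bias \<B> \<K> R w) = (\<Sum>R\<in>C. ?h * t R)"
      unfolding t_def sum_coset_average[OF K(1), symmetric] using u_bias by simp
    then have "?h * (\<eta> * ?N) < ?h * (\<Sum>R\<in>C. t R)"
      using bias unfolding C_def sum_distrib_left[symmetric] by (simp add: mult_ac)
    then have "\<eta> * ?N < (\<Sum>R\<in>C. t R)" using h by simp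
    then have "(\<eta> * ?N)\<^sup>2 \<le> (\<Sum>R\<in>C. t R)\<^sup>2" using \<eta> by (intro power_mono) auto
    also have "\<dots> \<le> (\<Sum>R\<in>C. (t R)\<^sup>2) * real (card C)"
      using Cauchy_Schwarz_ineq_sum[of t "\<lambda>_. 1" C] by simp
    also have "\<dots> \<le> (\<Sum>R\<in>C. ?N * \<Delta> R) * 2 ^ s"
      using C_real order_trans[OF zero_le_power2 gain]
      by (intro mult_mono sum_mono gain) (auto intro!: sum_nonneg)
    also have "(\<Sum>R\<in>C. ?N * \<Delta> R) = ?N * (atom_energy \<B> \<K>' - atom_energy \<B> \<K>)"
      unfolding \<Delta>_def atom_energy_def C_def by (simp add: sum_distrib_left sum_subtractf right_diff_distrib)
    finally have "?N * (\<eta>\<^sup>2 * ?N) \<le> ?N * ((atom_energy \<B> \<K>' - atom_energy \<B> \<K>) * 2 ^ s)"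
      by (simp add: power2_eq_square mult_ac)
    then have "\<eta>\<^sup>2 * ?N \<le> (atom_energy \<B> \<K>' - atom_energy \<B> \<K>) * 2 ^ s" using N by simp
    then show ?thesis by (simp add: field_simps)
  qed
  ultimately show thesis using that by blast
qed

text \<open>Only the kernels are refined here while the family \<open>\<B>\<close> stays fixed, so the number of its cells, on which the
required bias depends, does not grow during the argument.\<close>

lemma uniform_kernels_exist:
  assumes B: "finite \<B>" "card \<B> \<le> s" and \<eta>: "\<eta> > 0"
  obtains \<K> where "\<K> \<subseteq> kernels" "finite \<K>" "card \<K> \<le> kernel_bound s \<eta>" "uniform (\<B> \<union> \<K>) \<K> \<eta>"
proof -
  define \<eta>' where "\<eta>' = \<eta> / 4 ^ s"
  let ?N = "real (order G)"
  let ?good = "\<lambda>\<K>. (\<Sum>R\<in>colour \<B> ` carrier G. \<Sum>w\<in>carrier G. coset_bias \<B> \<K> R w) \<le>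
      \<eta>' * ?N * real (card (coset \<K> \<one>))"
  have N: "?N > 0" using order_pos by simp
  have \<eta>': "\<eta>' > 0" unfolding \<eta>'_def using \<eta> by simp
  have C: "real (card (colour \<B> ` carrier G)) \<le> 2 ^ s"
    using order_trans[OF card_colour_image_le(2)[OF B(1), of "carrier G"] power_increasing[OF B(2), of "2::nat"]]
    by (metis of_nat_le_iff of_nat_numeral of_nat_power one_le_numeral)
  have "\<exists>\<K>. (\<K> \<subseteq> kernels \<and> finite \<K>) \<and> ?good \<K> \<and>
      card \<K> \<le> (MAX i\<in>{..nat \<lceil>2 ^ s / (\<eta>'\<^sup>2 / 2 ^ s)\<rceil>}. ((\<lambda>t. t + 2 ^ s * 2 ^ t) ^^ i) 0)"
  proof (rule energy_increment[where E = "\<lambda>\<K>. atom_energy \<B> \<K> / ?N" and s\<^sub>0 = "{}"])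
    fix \<K>
    show "0 \<le> atom_energy \<B> \<K> / ?N"
      unfolding atom_energy_def by (intro divide_nonneg_nonneg sum_nonneg fibre_energy_nonneg) simp
    have "atom_energy \<B> \<K> \<le> (\<Sum>R\<in>colour \<B> ` carrier G. ?N)"
      unfolding atom_energy_def order_def by (intro sum_mono fibre_energy_le_card) simp
    also have "\<dots> \<le> 2 ^ s * ?N" using C N by simp
    finally show "atom_energy \<B> \<K> / ?N \<le> 2 ^ s" using N by (simp add: divide_le_eq)
  next
    show "\<eta>'\<^sup>2 / 2 ^ s > 0" using \<eta>' by simp
  next
    fix \<K> t assume K: "\<K> \<subseteq> kernels \<and> finite \<K>" and t: "card \<K> \<le> t" and bad: "\<not> ?good \<K>"
    obtain \<K>' where K': "\<K>' \<subseteq> kernels" "finite \<K>'" "card \<K>' \<le> card \<K> + 2 ^ s * 2 ^ card \<K>"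
      and gain: "atom_energy \<B> \<K>' \<ge> atom_energy \<B> \<K> + \<eta>'\<^sup>2 / 2 ^ s * ?N"
      using bias_energy_increment[of \<K> \<B> s \<eta>'] K B \<eta>' bad by auto
    have "card \<K> + 2 ^ s * 2 ^ card \<K> \<le> t + 2 ^ s * (2::nat) ^ t"
      using t by (intro add_mono mult_le_mono power_increasing) auto
    moreover have "atom_energy \<B> \<K> / ?N + \<eta>'\<^sup>2 / 2 ^ s \<le> atom_energy \<B> \<K>' / ?N"
      using divide_right_mono[OF gain, of ?N] N by (simp add: add_divide_distrib)
    ultimately show "\<exists>\<K>'. (\<K>' \<subseteq> kernels \<and> finite \<K>') \<and> card \<K>' \<le> t + 2 ^ s * 2 ^ t \<and>
        atom_energy \<B> \<K> / ?N + \<eta>'\<^sup>2 / 2 ^ s \<le> atom_energy \<B> \<K>' / ?N"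
      using K' by (intro exI[of _ \<K>']) auto
  qed auto
  then obtain \<K> where K: "\<K> \<subseteq> kernels" "finite \<K>" "?good \<K>" "card \<K> \<le> kernel_bound s \<eta>"
    unfolding kernel_bound_def \<eta>'_def by blast
  have "(2 ^ card \<B>)\<^sup>2 * \<eta>' \<le> (2 ^ s)\<^sup>2 * \<eta>'"
    using \<eta>' B(2) by (intro mult_right_mono power_mono power_increasing) auto
  also have "\<dots> = \<eta>"
    unfolding \<eta>'_def by (simp add: power_mult[symmetric] power_mult_distrib[symmetric] power2_eq_square)
  finally have "uniform (\<B> \<union> \<K>) \<K> \<eta>" by (rule uniform_if_unbiased[OF K(1) B(1) K(3)])
  then show thesis using that K by blast
qed

section \<open>A partition that is regular and equidistributed\<close>

text \<open>A state is a partition \<open>\<B>\<close> together with kernels \<open>\<K> \<subseteq> \<B>\<close> for which it is equidistributed. If replacing the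
edge functions by their densities costs too much, \<open>counting_lemma\<close> yields a refinement of larger energy.
Adding new kernels to it restores equidistribution, possibly for a much smaller subgroup, and does not
decrease the energy.\<close>

lemma regular_uniform_partition:
  fixes a b c :: "'a \<Rightarrow> 'a \<Rightarrow> real"
  assumes abc: "a \<in> carrier G \<rightarrow> carrier G \<rightarrow> {0, 1}" "b \<in> carrier G \<rightarrow> carrier G \<rightarrow> {0, 1}"
      "c \<in> carrier G \<rightarrow> carrier G \<rightarrow> {0, 1}"
    and \<eta>: "\<eta> > 0"
  obtains \<B> \<K> where "\<K> \<subseteq> kernels" "\<K> \<subseteq> \<B>" "finite \<B>" "card \<K> \<le> complexity_bound \<eta>" "uniform \<B> \<K> \<eta>"
    and "(\<Sum>x\<in>carrier G. \<Sum>y\<in>carrier G. \<Sum>z\<in>coset \<K> (x \<otimes> y). a x y * b y z * c x z) \<ge>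
      (\<Sum>x\<in>carrier G. \<Sum>y\<in>carrier G. \<Sum>z\<in>coset \<K> (x \<otimes> y).
        pair_mean \<B> a x y * pair_mean \<B> b y z * pair_mean \<B> c x z) -
      2 * \<eta> * real (card (coset \<K> \<one>)) * real (order G) ^ 2"
proof -
  let ?N = "real (order G)" and ?h = "\<lambda>\<K>. real (card (coset \<K> \<one>))"
  define I where "I = (\<lambda>(\<B>, \<K>). \<K> \<subseteq> kernels \<and> \<K> \<subseteq> \<B> \<and> finite \<B> \<and> uniform \<B> \<K> \<eta>)"
  define E where "E = (\<lambda>(\<B>, \<K> :: 'a set set). (pair_energy \<B> a + pair_energy \<B> b) / ?N\<^sup>2)"
  define W where "W = (\<lambda>\<K>. \<Sum>x\<in>carrier G. \<Sum>y\<in>carrier G. \<Sum>z\<in>coset \<K> (x \<otimes> y). a x y * b y z * c x z)"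
  define W' where "W' = (\<lambda>\<B> \<K>. \<Sum>x\<in>carrier G. \<Sum>y\<in>carrier G. \<Sum>z\<in>coset \<K> (x \<otimes> y).
        pair_mean \<B> a x y * pair_mean \<B> b y z * pair_mean \<B> c x z)"
  define good where "good = (\<lambda>(\<B>, \<K>). W \<K> \<ge> W' \<B> \<K> - 2 * \<eta> * ?h \<K> * ?N\<^sup>2)"
  have N: "?N > 0" using order_pos by simp
  note unit = funcset_binary_unit[OF abc(1)] funcset_binary_unit[OF abc(2)]
  obtain \<K>\<^sub>0 where K0: "\<K>\<^sub>0 \<subseteq> kernels" "finite \<K>\<^sub>0" "card \<K>\<^sub>0 \<le> kernel_bound 0 \<eta>" "uniform ({} \<union> \<K>\<^sub>0) \<K>\<^sub>0 \<eta>"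
    by (rule uniform_kernels_exist[of "{}" 0 \<eta>]) (use \<eta> in auto)
  have "\<exists>s. I s \<and> good s \<and> card (fst s) \<le> (MAX i\<in>{..nat \<lceil>2 / \<eta>\<^sup>2\<rceil>}.
     ((\<lambda>t. t + 3 * 2 ^ t + kernel_bound (t + 3 * 2 ^ t) \<eta>) ^^ i) (kernel_bound 0 \<eta>))"
  proof (rule energy_increment[where I = I and good = good and E = E and size = "\<lambda>s. card (fst s)" and s\<^sub>0 = "(\<K>\<^sub>0, \<K>\<^sub>0)"])
    show "I (\<K>\<^sub>0, \<K>\<^sub>0)" "card (fst (\<K>\<^sub>0, \<K>\<^sub>0)) \<le> kernel_bound 0 \<eta>"
      unfolding I_def using K0 by auto
    fix s :: "'a set set \<times> 'a set set"
    obtain \<B> \<K> where s: "s = (\<B>, \<K>)" by (cases s)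
    note ab = pair_energy_bounds[OF unit(1), of \<B>] pair_energy_bounds[OF unit(2), of \<B>]
    show "0 \<le> E s" "E s \<le> 2" unfolding E_def s using ab N by (auto simp: divide_le_eq)
  next
    show "\<eta>\<^sup>2 > 0" using \<eta> by simp
  next
    fix s t assume Is: "I s" and st: "card (fst s) \<le> t" and bad: "\<not> good s"
    obtain \<B> \<K> where s: "s = (\<B>, \<K>)" by (cases s)
    have K: "\<K> \<subseteq> kernels" "\<K> \<subseteq> \<B>" "finite \<B>" and t: "card \<B> \<le> t"
      using Is st unfolding I_def s by auto
    obtain \<B>' where B': "\<B> \<subseteq> \<B>'" "finite \<B>'" "card \<B>' \<le> card \<B> + 3 * 2 ^ card \<K>"
      and count: "W \<K> \<ge> W' \<B> \<K> - ?h \<K> * ?N *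
        (sqrt (pair_energy \<B>' a - pair_energy \<B> a) + sqrt (pair_energy \<B>' b - pair_energy \<B> b))"
      by (rule counting_lemma[OF K abc]) (rule that, unfold W_def W'_def)
    let ?\<Delta>a = "pair_energy \<B>' a - pair_energy \<B> a" and ?\<Delta>b = "pair_energy \<B>' b - pair_energy \<B> b"
    have mono: "0 \<le> ?\<Delta>a" "0 \<le> ?\<Delta>b" using pair_energy_mono[OF B'(1)] by auto
    have gain: "?\<Delta>a + ?\<Delta>b \<ge> \<eta>\<^sup>2 * ?N\<^sup>2"
    proof (rule ccontr)
      assume "\<not> ?thesis"
      then have "?\<Delta>a \<le> (\<eta> * ?N)\<^sup>2" "?\<Delta>b \<le> (\<eta> * ?N)\<^sup>2" using mono by (auto simp: power_mult_distrib)
      then have "sqrt ?\<Delta>a \<le> \<eta> * ?N" "sqrt ?\<Delta>b \<le> \<eta> * ?N" using \<eta> N by (auto intro!: real_le_lsqrt)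
      then have "?h \<K> * ?N * (sqrt ?\<Delta>a + sqrt ?\<Delta>b) \<le> ?h \<K> * ?N * (\<eta> * ?N + \<eta> * ?N)"
        by (intro mult_left_mono add_mono) auto
      also have "\<dots> = 2 * \<eta> * ?h \<K> * ?N\<^sup>2" by (simp add: power2_eq_square)
      finally have "good s" unfolding good_def s using count by simp
      then show False using bad by simp
    qed
    have "card \<K> \<le> t" using card_mono[OF K(3,2)] t by simp
    then have "3 * (2::nat) ^ card \<K> \<le> 3 * 2 ^ t" by (intro mult_le_mono2 power_increasing) auto
    then have cB': "card \<B>' \<le> t + 3 * 2 ^ t" using B'(3) t by linarith
    obtain \<K>' where K': "\<K>' \<subseteq> kernels" "finite \<K>'" "card \<K>' \<le> kernel_bound (t + 3 * 2 ^ t) \<eta>"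
        "uniform (\<B>' \<union> \<K>') \<K>' \<eta>"
      by (rule uniform_kernels_exist[OF B'(2) cB' \<eta>]) (rule that)
    have "I (\<B>' \<union> \<K>', \<K>')" unfolding I_def using K' B'(2) by simp
    moreover have "card (fst (\<B>' \<union> \<K>', \<K>')) \<le> t + 3 * 2 ^ t + kernel_bound (t + 3 * 2 ^ t) \<eta>"
      using card_Un_le[of \<B>' \<K>'] cB' K'(3) by simp
    moreover have "E s + \<eta>\<^sup>2 \<le> E (\<B>' \<union> \<K>', \<K>')"
    proof -
      have "pair_energy \<B> a + pair_energy \<B> b + \<eta>\<^sup>2 * ?N\<^sup>2 \<le>
          pair_energy (\<B>' \<union> \<K>') a + pair_energy (\<B>' \<union> \<K>') b"
        using gain pair_energy_mono[of \<B>' "\<B>' \<union> \<K>'" a] pair_energy_mono[of \<B>' "\<B>' \<union> \<K>'" b] by simp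
      from divide_right_mono[OF this, of "?N\<^sup>2"] show ?thesis
        unfolding E_def s using N by (simp add: add_divide_distrib)
    qed
    ultimately show "\<exists>s'. I s' \<and> card (fst s') \<le> t + 3 * 2 ^ t + kernel_bound (t + 3 * 2 ^ t) \<eta> \<and> E s + \<eta>\<^sup>2 \<le> E s'"
      by blast
  qed
  then obtain \<B> \<K> where "I (\<B>, \<K>)" "good (\<B>, \<K>)" and card: "card \<B> \<le> complexity_bound \<eta>"
    unfolding complexity_bound_def by auto
  then have K: "\<K> \<subseteq> kernels" "\<K> \<subseteq> \<B>" "finite \<B>" "uniform \<B> \<K> \<eta>" and W: "W \<K> \<ge> W' \<B> \<K> - 2 * \<eta> * ?h \<K> * ?N\<^sup>2"
    unfolding I_def good_def by auto
  have "card \<K> \<le> complexity_bound \<eta>" using card_mono[OF K(3,2)] card by simp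
  then show thesis using that K W unfolding W_def W'_def by blast
qed

section \<open>Triangle densities as values of the functional\<close>

text \<open>The density of \<open>b\<close> on the set of pairs whose coordinates lie in the cells of \<open>x\<close> and \<open>y\<close> and whose product
lies in the cell of \<open>z\<close>. It is defined for all triples, also when \<open>z\<close> is not the product.\<close>

definition line_mean :: "'a set set \<Rightarrow> ('a \<Rightarrow> 'a \<Rightarrow> real) \<Rightarrow> 'a \<Rightarrow> 'a \<Rightarrow> 'a \<Rightarrow> real" where
  "line_mean \<B> b x y z = fibre_mean (carrier G \<times> carrier G)
     (\<lambda>(x, y). (colour \<B> x, colour \<B> y, colour \<B> (x \<otimes> y))) (\<lambda>(x, y). b x y)
     (colour \<B> x, colour \<B> y, colour \<B> z)"

lemma line_mean_in_unit:
  assumes "b \<in> carrier G \<rightarrow> carrier G \<rightarrow> {0..1}"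
  shows "line_mean \<B> b x y z \<in> {0..1}"
proof -
  have "b x y \<in> {0..1}" if "x \<in> carrier G" "y \<in> carrier G" for x y using assms that by blast
  then show ?thesis unfolding line_mean_def by (auto intro!: fibre_mean_nonneg fibre_mean_le_one)
qed

text \<open>Conditioning on the three cells turns \<open>b\<close> into \<open>line_mean\<close> at \<open>z = x \<otimes> y\<close>. Equidistribution then frees
\<open>z\<close>.\<close>

lemma sum_uniform_weight:
  fixes b w :: "'a \<Rightarrow> 'a \<Rightarrow> real"
  assumes unif: "uniform \<B> \<K> \<eta>" and b: "b \<in> carrier G \<rightarrow> carrier G \<rightarrow> {0..1}"
    and w: "determined_by (carrier G \<times> carrier G) (\<lambda>(x, y). (colour \<B> x, colour \<B> y)) (\<lambda>(x, y). w x y)"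
    and w_le: "\<And>x y. x \<in> carrier G \<Longrightarrow> y \<in> carrier G \<Longrightarrow> \<bar>w x y\<bar> \<le> 1"
  shows "\<bar>(\<Sum>x\<in>carrier G. \<Sum>y\<in>carrier G. w x y * b x y) -
      (\<Sum>x\<in>carrier G. \<Sum>y\<in>carrier G. w x y *
        ((\<Sum>z\<in>coset \<K> (x \<otimes> y). line_mean \<B> b x y z) / real (card (coset \<K> \<one>))))\<bar>
    \<le> \<eta> * real (order G) ^ 2"
proof -
  let ?G = "carrier G" and ?h = "real (card (coset \<K> \<one>))"
  have finP: "finite (?G \<times> ?G)" using finite_carrier by simp
  define \<theta> where "\<theta> = (\<lambda>x y z. w x y * line_mean \<B> b x y z)"
  have w_inv: "w x y = w x' y'" if "x \<in> ?G" "y \<in> ?G" "x' \<in> ?G" "y' \<in> ?G"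
    "colour \<B> x = colour \<B> x'" "colour \<B> y = colour \<B> y'" for x y x' y'
    using determined_byD[OF w, of "(x, y)" "(x', y')"] that by simp
  have "(\<Sum>p\<in>?G \<times> ?G. (\<lambda>(x, y). b x y) p * (\<lambda>(x, y). w x y) p) =
    (\<Sum>p\<in>?G \<times> ?G. fibre_mean (?G \<times> ?G) (\<lambda>(x, y). (colour \<B> x, colour \<B> y, colour \<B> (x \<otimes> y)))
      (\<lambda>(x, y). b x y) ((\<lambda>(x, y). (colour \<B> x, colour \<B> y, colour \<B> (x \<otimes> y))) p) * (\<lambda>(x, y). w x y) p)"
  proof (rule fibre_mean_tower[OF finP], rule determined_byI)
    fix p q assume pq: "p \<in> ?G \<times> ?G" "q \<in> ?G \<times> ?G" "(\<lambda>(x, y). (colour \<B> x, colour \<B> y, colour \<B> (x \<otimes> y))) p =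
      (\<lambda>(x, y). (colour \<B> x, colour \<B> y, colour \<B> (x \<otimes> y))) q"
    then show "(\<lambda>(x, y). w x y) p = (\<lambda>(x, y). w x y) q"
      by (intro determined_byD[OF w]) (auto split: prod.splits)
  qed
  then have tower: "(\<Sum>x\<in>?G. \<Sum>y\<in>?G. w x y * b x y) = (\<Sum>x\<in>?G. \<Sum>y\<in>?G. \<theta> x y (x \<otimes> y))"
    unfolding sum.cartesian_product' split \<theta>_def line_mean_def by (simp only: mult.commute)
  have "\<bar>\<theta> x y z\<bar> \<le> 1" if "x \<in> ?G" "y \<in> ?G" for x y z
    unfolding \<theta>_def using w_le[OF that] line_mean_in_unit[OF b, of \<B> x y z]
    by (auto simp: abs_mult mult_le_one)
  moreover have "determined_by (?G \<times> ?G \<times> ?G)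
       (\<lambda>(x, y, z). (colour \<B> x, colour \<B> y, colour \<B> z)) (\<lambda>(x, y, z). \<theta> x y z)"
  proof (rule determined_byI)
    fix p q assume pq: "p \<in> ?G \<times> ?G \<times> ?G" "q \<in> ?G \<times> ?G \<times> ?G"
      "(\<lambda>(x, y, z). (colour \<B> x, colour \<B> y, colour \<B> z)) p = (\<lambda>(x, y, z). (colour \<B> x, colour \<B> y, colour \<B> z)) q"
    obtain x y z x' y' z' where eq: "p = (x, y, z)" "q = (x', y', z')" by (cases p; cases q)
    have c: "colour \<B> x = colour \<B> x'" "colour \<B> y = colour \<B> y'" "colour \<B> z = colour \<B> z'"
      and mem: "x \<in> ?G" "y \<in> ?G" "x' \<in> ?G" "y' \<in> ?G" using pq unfolding eq by simp_all
    show "(\<lambda>(x, y, z). \<theta> x y z) p = (\<lambda>(x, y, z). \<theta> x y z) q"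
      unfolding eq split \<theta>_def line_mean_def c w_inv[OF mem c(1,2)] ..
  qed
  ultimately have "\<bar>(\<Sum>x\<in>?G. \<Sum>y\<in>?G. \<theta> x y (x \<otimes> y)) -
       (\<Sum>x\<in>?G. \<Sum>y\<in>?G. \<Sum>z\<in>coset \<K> (x \<otimes> y). \<theta> x y z) / ?h\<bar> \<le> \<eta> * real (order G) ^ 2"
    using unif unfolding uniform_def by blast
  also have "(\<Sum>x\<in>?G. \<Sum>y\<in>?G. \<Sum>z\<in>coset \<K> (x \<otimes> y). \<theta> x y z) / ?h = (\<Sum>x\<in>?G. \<Sum>y\<in>?G. w x y *
      ((\<Sum>z\<in>coset \<K> (x \<otimes> y). line_mean \<B> b x y z) / ?h))"
    unfolding \<theta>_def sum_distrib_left[symmetric] by (simp add: sum_divide_distrib[where A = ?G])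
  finally show ?thesis unfolding tower .
qed

text \<open>Use the sign of the difference as weight. It is constant on products of cells since these determine the
coset of the product.\<close>

lemma pair_mean_near_line_mean:
  fixes b :: "'a \<Rightarrow> 'a \<Rightarrow> real"
  assumes K: "\<K> \<subseteq> kernels" "\<K> \<subseteq> \<B>" and unif: "uniform \<B> \<K> \<eta>" and b: "b \<in> carrier G \<rightarrow> carrier G \<rightarrow> {0..1}"
  shows "(\<Sum>x\<in>carrier G. \<Sum>y\<in>carrier G. \<bar>pair_mean \<B> b x y -
      (\<Sum>z\<in>coset \<K> (x \<otimes> y). line_mean \<B> b x y z) / real (card (coset \<K> \<one>))\<bar>) \<le> \<eta> * real (order G) ^ 2"
proof -
  let ?G = "carrier G" and ?h = "real (card (coset \<K> \<one>))"
  define F where "F = (\<lambda>x y. (\<Sum>z\<in>coset \<K> (x \<otimes> y). line_mean \<B> b x y z) / ?h)"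
  define w where "w = (\<lambda>x y. sgn (pair_mean \<B> b x y - F x y))"
  have finP: "finite (?G \<times> ?G)" using finite_carrier by simp
  have w: "determined_by (?G \<times> ?G) (\<lambda>(x, y). (colour \<B> x, colour \<B> y)) (\<lambda>(x, y). w x y)"
  proof (rule determined_byI)
    fix p q assume pq: "p \<in> ?G \<times> ?G" "q \<in> ?G \<times> ?G"
      "(\<lambda>(x, y). (colour \<B> x, colour \<B> y)) p = (\<lambda>(x, y). (colour \<B> x, colour \<B> y)) q"
    obtain x y x' y' where eq: "p = (x, y)" "q = (x', y')" by (cases p; cases q)
    have c: "colour \<B> x = colour \<B> x'" "colour \<B> y = colour \<B> y'"
      and mem: "x \<in> ?G" "y \<in> ?G" "x' \<in> ?G" "y' \<in> ?G" using pq unfolding eq by simp_all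
    have "colour \<K> (x \<otimes> y) = colour \<K> (x' \<otimes> y')"
      by (rule colour_mult_cong[OF K(1) mem c[THEN colour_eq_mono, OF K(2)]])
    then have "coset \<K> (x \<otimes> y) = coset \<K> (x' \<otimes> y')" unfolding coset_def by simp
    then show "(\<lambda>(x, y). w x y) p = (\<lambda>(x, y). w x y) q"
      unfolding eq split w_def F_def line_mean_def pair_mean_def c by simp
  qed
  have "(\<Sum>x\<in>?G. \<Sum>y\<in>?G. \<bar>pair_mean \<B> b x y - F x y\<bar>) =
      (\<Sum>x\<in>?G. \<Sum>y\<in>?G. w x y * pair_mean \<B> b x y) - (\<Sum>x\<in>?G. \<Sum>y\<in>?G. w x y * F x y)"
    unfolding sum_subtractf[symmetric] right_diff_distrib[symmetric] w_def
    by (intro sum.cong refl) (simp add: abs_sgn mult.commute)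
  also have "(\<Sum>x\<in>?G. \<Sum>y\<in>?G. w x y * pair_mean \<B> b x y) = (\<Sum>x\<in>?G. \<Sum>y\<in>?G. w x y * b x y)"
    using fibre_mean_tower[OF finP w, of "\<lambda>(x, y). b x y"]
    unfolding sum.cartesian_product' split pair_mean_def by (simp only: mult.commute)
  finally show ?thesis
    using sum_uniform_weight[OF unif b w] unfolding F_def w_def by (auto simp: abs_sgn_eq)
qed

text \<open>The three edge functions describe the same set \<open>A\<close> in different coordinates, so they share one function
\<open>line_mean\<close>. This is what allows a single step function to serve for all three factors of the functional.\<close>

lemma line_mean_rotate: "line_mean \<B> (\<lambda>y z. a (y \<otimes> z) y) y z x = line_mean \<B> a x y z"
proof -
  let ?f = "\<lambda>(y, z). (y \<otimes> z, y)"
  have "bij_betw ?f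
    {p \<in> carrier G \<times> carrier G. (\<lambda>(x, y). (colour \<B> x, colour \<B> y, colour \<B> (x \<otimes> y))) p = (colour \<B> y, colour \<B> z, colour \<B> x)}
    {p \<in> carrier G \<times> carrier G. (\<lambda>(x, y). (colour \<B> x, colour \<B> y, colour \<B> (x \<otimes> y))) p = (colour \<B> x, colour \<B> y, colour \<B> z)}"
    by (rule bij_betw_byWitness[where f' = "\<lambda>(x, y). (y, x \<otimes> y)"])
      (auto simp: mult_self_middle m_lcomm square)
  then show ?thesis unfolding line_mean_def by (rule fibre_mean_reindex) auto
qed

lemma line_mean_swap: "line_mean \<B> (\<lambda>x z. a x (x \<otimes> z)) x z y = line_mean \<B> a x y z"
proof -
  let ?f = "\<lambda>(x, z). (x, x \<otimes> z)"
  have "bij_betw ?f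
    {p \<in> carrier G \<times> carrier G. (\<lambda>(x, y). (colour \<B> x, colour \<B> y, colour \<B> (x \<otimes> y))) p = (colour \<B> x, colour \<B> z, colour \<B> y)}
    {p \<in> carrier G \<times> carrier G. (\<lambda>(x, y). (colour \<B> x, colour \<B> y, colour \<B> (x \<otimes> y))) p = (colour \<B> x, colour \<B> y, colour \<B> z)}"
    by (rule bij_betw_byWitness[where f' = ?f]) (auto simp: mult_self_left)
  then show ?thesis unfolding line_mean_def by (rule fibre_mean_reindex) auto
qed

lemma coset_mult_eq:
  assumes K: "\<K> \<subseteq> kernels" and x0: "x\<^sub>0 \<in> carrier G" "y\<^sub>0 \<in> carrier G"
    and xy: "x \<in> coset \<K> x\<^sub>0" "y \<in> coset \<K> y\<^sub>0"
  shows "coset \<K> (x \<otimes> y) = coset \<K> (x\<^sub>0 \<otimes> y\<^sub>0)"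
proof -
  have "colour \<K> (x \<otimes> y) = colour \<K> (x\<^sub>0 \<otimes> y\<^sub>0)"
    using xy x0 unfolding coset_def by (intro colour_mult_cong[OF K]) auto
  then show ?thesis unfolding coset_def by simp
qed

lemma sum_triples_localise:
  assumes K: "\<K> \<subseteq> kernels"
  shows "(\<Sum>x\<^sub>0\<in>carrier G. \<Sum>y\<^sub>0\<in>carrier G. \<Sum>x\<in>coset \<K> x\<^sub>0. \<Sum>y\<in>coset \<K> y\<^sub>0. \<Sum>z\<in>coset \<K> (x\<^sub>0 \<otimes> y\<^sub>0). f x y z) =
    real (card (coset \<K> \<one>)) ^ 2 * (\<Sum>x\<in>carrier G. \<Sum>y\<in>carrier G. \<Sum>z\<in>coset \<K> (x \<otimes> y). (f x y z :: real))"
proof -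
  let ?G = "carrier G" and ?h = "real (card (coset \<K> \<one>))"
  let ?g = "\<lambda>x y. \<Sum>z\<in>coset \<K> (x \<otimes> y). f x y z"
  have "(\<Sum>x\<^sub>0\<in>?G. \<Sum>y\<^sub>0\<in>?G. \<Sum>x\<in>coset \<K> x\<^sub>0. \<Sum>y\<in>coset \<K> y\<^sub>0. \<Sum>z\<in>coset \<K> (x\<^sub>0 \<otimes> y\<^sub>0). f x y z) =
      (\<Sum>x\<^sub>0\<in>?G. \<Sum>y\<^sub>0\<in>?G. \<Sum>x\<in>coset \<K> x\<^sub>0. \<Sum>y\<in>coset \<K> y\<^sub>0. ?g x y)"
    by (intro sum.cong refl) (simp add: coset_mult_eq[OF K])
  also have "\<dots> = (\<Sum>x\<^sub>0\<in>?G. \<Sum>x\<in>coset \<K> x\<^sub>0. \<Sum>y\<^sub>0\<in>?G. \<Sum>y\<in>coset \<K> y\<^sub>0. ?g x y)"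
    by (intro sum.cong refl sum.swap)
  also have "\<dots> = ?h * (\<Sum>x\<in>?G. \<Sum>y\<^sub>0\<in>?G. \<Sum>y\<in>coset \<K> y\<^sub>0. ?g x y)"
    by (rule sum_coset_average[OF K])
  also have "\<dots> = ?h * (\<Sum>x\<in>?G. ?h * (\<Sum>y\<in>?G. ?g x y))"
    unfolding sum_coset_average[OF K] ..
  finally show ?thesis by (simp add: sum_distrib_left power2_eq_square mult.assoc)
qed

lemma sum_triples_const:
  assumes K: "\<K> \<subseteq> kernels"
  shows "(\<Sum>x\<in>carrier G. \<Sum>y\<in>carrier G. \<Sum>z\<in>coset \<K> (x \<otimes> y). g x y) =
    real (card (coset \<K> \<one>)) * (\<Sum>x\<in>carrier G. \<Sum>y\<in>carrier G. (g x y :: real))"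
  unfolding sum_distrib_left
  by (intro sum.cong refl) (simp add: card_coset[OF K m_closed])

lemma average_in_unit:
  assumes "card S = h" "\<And>x. x \<in> S \<Longrightarrow> f x \<in> {0..1::real}"
  shows "(\<Sum>x\<in>S. f x) / real h \<in> {0..1}"
proof -
  have "(\<Sum>x\<in>S. f x) \<le> (\<Sum>x\<in>S. 1)" using assms(2) by (intro sum_mono) auto
  moreover have "0 \<le> (\<Sum>x\<in>S. f x)" using assms(2) by (intro sum_nonneg) auto
  ultimately show ?thesis using assms(1) by (auto intro!: divide_le_eq_1[THEN iffD2])
qed

text \<open>Each of the three densities is close, in the mean, to the average of \<open>F\<close> over the third variable. For the
second and third factor this is the case of the rotated edge functions.\<close>

lemma product_of_pair_means_lower_bound:
  fixes a :: "'a \<Rightarrow> 'a \<Rightarrow> real"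
  assumes K: "\<K> \<subseteq> kernels" "\<K> \<subseteq> \<B>" and unif: "uniform \<B> \<K> \<eta>" and a: "a \<in> carrier G \<rightarrow> carrier G \<rightarrow> {0..1}"
  defines "F \<equiv> line_mean \<B> a" and "h \<equiv> real (card (coset \<K> \<one>))"
  shows "(\<Sum>x\<in>carrier G. \<Sum>y\<in>carrier G. \<Sum>z\<in>coset \<K> (x \<otimes> y). pair_mean \<B> a x y *
      pair_mean \<B> (\<lambda>y z. a (y \<otimes> z) y) y z * pair_mean \<B> (\<lambda>x z. a x (x \<otimes> z)) x z) \<ge>
    (\<Sum>x\<in>carrier G. \<Sum>y\<in>carrier G. \<Sum>z\<in>coset \<K> (x \<otimes> y). ((\<Sum>z'\<in>coset \<K> (x \<otimes> y). F x y z') / h) *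
      ((\<Sum>x'\<in>coset \<K> (y \<otimes> z). F x' y z) / h) * ((\<Sum>y'\<in>coset \<K> (x \<otimes> z). F x y' z) / h)) -
    3 * \<eta> * h * real (order G) ^ 2"
proof -
  let ?G = "carrier G" and ?N = "real (order G)"
  let ?b = "\<lambda>y z. a (y \<otimes> z) y" and ?c = "\<lambda>x z. a x (x \<otimes> z)"
  define A\<^sub>1 A\<^sub>2 A\<^sub>3 where "A\<^sub>1 = pair_mean \<B> a" and "A\<^sub>2 = pair_mean \<B> ?b" and "A\<^sub>3 = pair_mean \<B> ?c"
  define F\<^sub>1 F\<^sub>2 F\<^sub>3 where "F\<^sub>1 = (\<lambda>x y. (\<Sum>z\<in>coset \<K> (x \<otimes> y). F x y z) / h)"
    and "F\<^sub>2 = (\<lambda>y z. (\<Sum>x\<in>coset \<K> (y \<otimes> z). F x y z) / h)" and "F\<^sub>3 = (\<lambda>x z. (\<Sum>y\<in>coset \<K> (x \<otimes> z). F x y z) / h)"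
  have b: "?b \<in> ?G \<rightarrow> ?G \<rightarrow> {0..1}" and c: "?c \<in> ?G \<rightarrow> ?G \<rightarrow> {0..1}"
    using a by (auto intro!: Pi_I elim: Pi_mem)
  have h: "h \<ge> 0" unfolding h_def by simp
  have F: "F x y z \<in> {0..1}" for x y z unfolding F_def by (rule line_mean_in_unit[OF a])
  have A_unit: "A\<^sub>1 x y \<in> {0..1}" "A\<^sub>2 x y \<in> {0..1}" "A\<^sub>3 x y \<in> {0..1}" for x y
    unfolding A\<^sub>1_def A\<^sub>2_def A\<^sub>3_def by (rule pair_mean_in_unit[OF a], rule pair_mean_in_unit[OF b], rule pair_mean_in_unit[OF c])
  have F_unit: "F\<^sub>1 x y \<in> {0..1}" "F\<^sub>2 x y \<in> {0..1}" "F\<^sub>3 x y \<in> {0..1}" if "x \<in> ?G" "y \<in> ?G" for x y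
    unfolding F\<^sub>1_def F\<^sub>2_def F\<^sub>3_def h_def
    by (intro average_in_unit card_coset[OF K(1)] m_closed that F)+
  have near1: "(\<Sum>x\<in>?G. \<Sum>y\<in>?G. \<bar>A\<^sub>1 x y - F\<^sub>1 x y\<bar>) \<le> \<eta> * ?N\<^sup>2"
    using pair_mean_near_line_mean[OF K unif a] unfolding A\<^sub>1_def F\<^sub>1_def F_def h_def .
  have near2: "(\<Sum>y\<in>?G. \<Sum>z\<in>?G. \<bar>A\<^sub>2 y z - F\<^sub>2 y z\<bar>) \<le> \<eta> * ?N\<^sup>2"
    using pair_mean_near_line_mean[OF K unif b] unfolding A\<^sub>2_def F\<^sub>2_def F_def h_def line_mean_rotate .
  have near3: "(\<Sum>x\<in>?G. \<Sum>z\<in>?G. \<bar>A\<^sub>3 x z - F\<^sub>3 x z\<bar>) \<le> \<eta> * ?N\<^sup>2"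
    using pair_mean_near_line_mean[OF K unif c] unfolding A\<^sub>3_def F\<^sub>3_def F_def h_def line_mean_swap .
  have e1: "(\<Sum>x\<in>?G. \<Sum>y\<in>?G. \<Sum>z\<in>coset \<K> (x \<otimes> y). \<bar>A\<^sub>1 x y - F\<^sub>1 x y\<bar>) \<le> h * (\<eta> * ?N\<^sup>2)"
    unfolding sum_triples_const[OF K(1)] h_def[symmetric] using near1 h by (rule mult_left_mono)
  have "(\<Sum>y\<in>?G. \<Sum>z\<in>?G. \<Sum>x\<in>coset \<K> (y \<otimes> z). \<bar>A\<^sub>2 y z - F\<^sub>2 y z\<bar>) \<le> h * (\<eta> * ?N\<^sup>2)"
    unfolding sum_triples_const[OF K(1)] h_def[symmetric] using near2 h by (rule mult_left_mono)
  note e2 = order_trans[OF eq_refl[OF coset_triple_rotate[OF K(1)]] this]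
  have "(\<Sum>x\<in>?G. \<Sum>z\<in>?G. \<Sum>y\<in>coset \<K> (x \<otimes> z). \<bar>A\<^sub>3 x z - F\<^sub>3 x z\<bar>) \<le> h * (\<eta> * ?N\<^sup>2)"
    unfolding sum_triples_const[OF K(1)] h_def[symmetric] using near3 h by (rule mult_left_mono)
  note e3 = order_trans[OF eq_refl[OF coset_triple_swap[OF K(1)]] this]
  have "(\<Sum>x\<in>?G. \<Sum>y\<in>?G. \<Sum>z\<in>coset \<K> (x \<otimes> y). F\<^sub>1 x y * F\<^sub>2 y z * F\<^sub>3 x z) \<le>
    (\<Sum>x\<in>?G. \<Sum>y\<in>?G. \<Sum>z\<in>coset \<K> (x \<otimes> y). A\<^sub>1 x y * A\<^sub>2 y z * A\<^sub>3 x z +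
      (\<bar>A\<^sub>1 x y - F\<^sub>1 x y\<bar> + \<bar>A\<^sub>2 y z - F\<^sub>2 y z\<bar> + \<bar>A\<^sub>3 x z - F\<^sub>3 x z\<bar>))"
    using coset_subset by (intro sum_mono product_lower_bound A_unit F_unit) auto
  also have "\<dots> \<le> (\<Sum>x\<in>?G. \<Sum>y\<in>?G. \<Sum>z\<in>coset \<K> (x \<otimes> y). A\<^sub>1 x y * A\<^sub>2 y z * A\<^sub>3 x z) +
      (h * (\<eta> * ?N\<^sup>2) + h * (\<eta> * ?N\<^sup>2) + h * (\<eta> * ?N\<^sup>2))"
    unfolding sum.distrib by (intro add_mono order_refl e1 e2 e3)
  finally show ?thesis
    unfolding A\<^sub>1_def A\<^sub>2_def A\<^sub>3_def F\<^sub>1_def F\<^sub>2_def F\<^sub>3_def by (simp add: algebra_simps)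
qed

text \<open>On each pair of cosets \<open>m_function_le_average\<close> bounds the functional of \<open>F\<close> from below by \<open>m\<close> of a local
mean. All pairs of cosets have the same weight, hence Jensen's inequality gives the value of \<open>m\<close> at the
global mean \<open>\<beta>\<close>. Summing over pairs of points instead of pairs of cosets avoids a choice of
representatives.\<close>

lemma convex_bound_on_cosets:
  fixes F :: "'a \<Rightarrow> 'a \<Rightarrow> 'a \<Rightarrow> real" and m :: "real \<Rightarrow> real"
  assumes K: "\<K> \<subseteq> kernels" and F: "\<And>x y z. F x y z \<in> {0..1}"
    and m: "convex_on {0..1} m" "\<And>\<alpha>. \<alpha> \<in> {0..1} \<Longrightarrow> m \<alpha> \<le> m_function \<alpha>"
  defines "h \<equiv> real (card (coset \<K> \<one>))"
  defines "\<beta> \<equiv> (\<Sum>x\<in>carrier G. \<Sum>y\<in>carrier G. \<Sum>z\<in>coset \<K> (x \<otimes> y). F x y z) / (h * real (order G) ^ 2)"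
  shows "\<beta> \<in> {0..1}"
    and "h * real (order G) ^ 2 * m \<beta> \<le>
      (\<Sum>x\<in>carrier G. \<Sum>y\<in>carrier G. \<Sum>z\<in>coset \<K> (x \<otimes> y). ((\<Sum>z'\<in>coset \<K> (x \<otimes> y). F x y z') / h) *
        ((\<Sum>x'\<in>coset \<K> (y \<otimes> z). F x' y z) / h) * ((\<Sum>y'\<in>coset \<K> (x \<otimes> z). F x y' z) / h))"
proof -
  let ?G = "carrier G" and ?N = "real (order G)"
  define \<phi> where "\<phi> = (\<lambda>x y z. ((\<Sum>z'\<in>coset \<K> (x \<otimes> y). F x y z') / h) *
        ((\<Sum>x'\<in>coset \<K> (y \<otimes> z). F x' y z) / h) * ((\<Sum>y'\<in>coset \<K> (x \<otimes> z). F x y' z) / h))"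
  define B where "B = (\<lambda>x\<^sub>0 y\<^sub>0. (\<Sum>x\<in>coset \<K> x\<^sub>0. \<Sum>y\<in>coset \<K> y\<^sub>0. \<Sum>z\<in>coset \<K> (x\<^sub>0 \<otimes> y\<^sub>0). F x y z) / h ^ 3)"
  have h: "h > 0" unfolding h_def using card_coset_pos by simp
  have N: "?N > 0" using order_pos by simp
  have B_unit: "B x y \<in> {0..1}" if "x \<in> ?G" "y \<in> ?G" for x y
  proof -
    have "B x y = (\<Sum>x'\<in>coset \<K> x. (\<Sum>y'\<in>coset \<K> y. (\<Sum>z\<in>coset \<K> (x \<otimes> y). F x' y' z) / h) / h) / h"
      unfolding B_def by (simp add: sum_divide_distrib power3_eq_cube)
    also have "\<dots> \<in> {0..1}"
      unfolding h_def using that by (intro average_in_unit card_coset[OF K] F m_closed)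
    finally show ?thesis .
  qed
  have local: "m (B x\<^sub>0 y\<^sub>0) \<le> (\<Sum>x\<in>coset \<K> x\<^sub>0. \<Sum>y\<in>coset \<K> y\<^sub>0. \<Sum>z\<in>coset \<K> (x\<^sub>0 \<otimes> y\<^sub>0). \<phi> x y z) / h ^ 3"
    if x0: "x\<^sub>0 \<in> ?G" "y\<^sub>0 \<in> ?G" for x\<^sub>0 y\<^sub>0
  proof -
    have "m (B x\<^sub>0 y\<^sub>0) \<le> m_function (B x\<^sub>0 y\<^sub>0)" by (rule m(2)[OF B_unit[OF x0]])
    also have "\<dots> \<le> (\<Sum>x\<in>coset \<K> x\<^sub>0. \<Sum>y\<in>coset \<K> y\<^sub>0. \<Sum>z\<in>coset \<K> (x\<^sub>0 \<otimes> y\<^sub>0).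
        ((\<Sum>z'\<in>coset \<K> (x\<^sub>0 \<otimes> y\<^sub>0). F x y z') / h) * ((\<Sum>y'\<in>coset \<K> y\<^sub>0. F x y' z) / h) *
        ((\<Sum>x'\<in>coset \<K> x\<^sub>0. F x' y z) / h)) / h ^ 3"
      unfolding B_def h_def using x0
      by (intro m_function_le_average finite_coset card_coset[OF K] card_coset_pos F m_closed)
    also have "\<dots> = (\<Sum>x\<in>coset \<K> x\<^sub>0. \<Sum>y\<in>coset \<K> y\<^sub>0. \<Sum>z\<in>coset \<K> (x\<^sub>0 \<otimes> y\<^sub>0). \<phi> x y z) / h ^ 3"
    proof (intro arg_cong2[where f = "(/)"] sum.cong refl)
      fix x y z assume mem: "x \<in> coset \<K> x\<^sub>0" "y \<in> coset \<K> y\<^sub>0" "z \<in> coset \<K> (x\<^sub>0 \<otimes> y\<^sub>0)"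
      have "coset \<K> (x \<otimes> y) = coset \<K> (x\<^sub>0 \<otimes> y\<^sub>0)" by (rule coset_mult_eq[OF K x0 mem(1,2)])
      moreover have "coset \<K> (x \<otimes> z) = coset \<K> y\<^sub>0"
        using coset_mult_eq[OF K x0(1) m_closed[OF x0] mem(1,3)] x0 by (simp add: mult_self_left)
      moreover have "coset \<K> (y \<otimes> z) = coset \<K> x\<^sub>0"
        using coset_mult_eq[OF K x0(2) m_closed[OF x0] mem(2,3)] x0
        by (simp add: m_assoc[symmetric] mult_self_middle m_comm[of y\<^sub>0 x\<^sub>0] mult_self_right)
      ultimately show "((\<Sum>z'\<in>coset \<K> (x\<^sub>0 \<otimes> y\<^sub>0). F x y z') / h) * ((\<Sum>y'\<in>coset \<K> y\<^sub>0. F x y' z) / h) *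
        ((\<Sum>x'\<in>coset \<K> x\<^sub>0. F x' y z) / h) = \<phi> x y z"
        unfolding \<phi>_def by (simp add: mult_ac)
    qed
    finally show ?thesis .
  qed
  have \<beta>_eq: "\<beta> = (\<Sum>p\<in>?G \<times> ?G. (1 / ?N\<^sup>2) * B (fst p) (snd p))"
  proof -
    have "(\<Sum>p\<in>?G \<times> ?G. (1 / ?N\<^sup>2) * B (fst p) (snd p)) = (1 / ?N\<^sup>2) * (\<Sum>x\<in>?G. \<Sum>y\<in>?G. B x y)"
      by (simp add: sum.cartesian_product' sum_distrib_left)
    also have "(\<Sum>x\<in>?G. \<Sum>y\<in>?G. B x y) = (h\<^sup>2 * (\<Sum>x\<in>?G. \<Sum>y\<in>?G. \<Sum>z\<in>coset \<K> (x \<otimes> y). F x y z)) / h ^ 3"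
      unfolding B_def sum_triples_localise[OF K, folded h_def, symmetric] by (simp add: sum_divide_distrib)
    also have "(1 / ?N\<^sup>2) * \<dots> = \<beta>" unfolding \<beta>_def using h by (simp add: power2_eq_square power3_eq_cube)
    finally show ?thesis ..
  qed
  have weights: "(\<Sum>p\<in>?G \<times> ?G. 1 / ?N\<^sup>2) = 1"
    using N by (simp add: card_cartesian_product order_def power2_eq_square)
  have fin: "finite (?G \<times> ?G)" "?G \<times> ?G \<noteq> {}" using finite_carrier by auto
  have B_mem: "B (fst p) (snd p) \<in> {0..1}" if "p \<in> ?G \<times> ?G" for p using B_unit that by auto
  have "(\<Sum>p\<in>?G \<times> ?G. (1 / ?N\<^sup>2) *\<^sub>R B (fst p) (snd p)) \<in> {0..1}"
    by (rule convex_sum[OF fin(1) _ weights _ B_mem]) auto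
  then show \<beta>_unit: "\<beta> \<in> {0..1}" unfolding \<beta>_eq by simp
  have "m \<beta> = m (\<Sum>p\<in>?G \<times> ?G. (1 / ?N\<^sup>2) *\<^sub>R B (fst p) (snd p))" unfolding \<beta>_eq by simp
  also have "\<dots> \<le> (\<Sum>p\<in>?G \<times> ?G. (1 / ?N\<^sup>2) * m (B (fst p) (snd p)))"
    by (rule convex_on_sum[OF fin m(1) weights _ B_mem]) auto
  also have "\<dots> \<le> (\<Sum>p\<in>?G \<times> ?G. (1 / ?N\<^sup>2) *
      ((\<Sum>x\<in>coset \<K> (fst p). \<Sum>y\<in>coset \<K> (snd p). \<Sum>z\<in>coset \<K> (fst p \<otimes> snd p). \<phi> x y z) / h ^ 3))"
    by (intro sum_mono mult_left_mono local) auto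
  also have "\<dots> = (1 / ?N\<^sup>2) * ((\<Sum>x\<^sub>0\<in>?G. \<Sum>y\<^sub>0\<in>?G.
      \<Sum>x\<in>coset \<K> x\<^sub>0. \<Sum>y\<in>coset \<K> y\<^sub>0. \<Sum>z\<in>coset \<K> (x\<^sub>0 \<otimes> y\<^sub>0). \<phi> x y z) / h ^ 3)"
    by (simp add: sum.cartesian_product' sum_distrib_left sum_divide_distrib)
  also have "\<dots> = (1 / ?N\<^sup>2) * ((h\<^sup>2 * (\<Sum>x\<in>?G. \<Sum>y\<in>?G. \<Sum>z\<in>coset \<K> (x \<otimes> y). \<phi> x y z)) / h ^ 3)"
    unfolding sum_triples_localise[OF K] h_def ..
  also have "\<dots> = (\<Sum>x\<in>?G. \<Sum>y\<in>?G. \<Sum>z\<in>coset \<K> (x \<otimes> y). \<phi> x y z) / (h * ?N\<^sup>2)"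
    using h by (simp add: power2_eq_square power3_eq_cube)
  finally have "m \<beta> * (h * ?N\<^sup>2) \<le> (\<Sum>x\<in>?G. \<Sum>y\<in>?G. \<Sum>z\<in>coset \<K> (x \<otimes> y). \<phi> x y z)"
    using h N by (simp add: pos_le_divide_eq)
  then show "h * ?N ^ 2 * m \<beta> \<le> (\<Sum>x\<in>?G. \<Sum>y\<in>?G. \<Sum>z\<in>coset \<K> (x \<otimes> y).
        ((\<Sum>z'\<in>coset \<K> (x \<otimes> y). F x y z') / h) *
        ((\<Sum>x'\<in>coset \<K> (y \<otimes> z). F x' y z) / h) * ((\<Sum>y'\<in>coset \<K> (x \<otimes> z). F x y' z) / h))"
    unfolding \<phi>_def by (simp only: mult_ac)
qed

section \<open>Popular differences\<close>

lemma card_corner_set: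
  assumes "d \<in> carrier G"
  shows "real (card (corner_set G A d)) = (\<Sum>x\<in>carrier G. \<Sum>y\<in>carrier G.
    of_bool ((x, y) \<in> A) * of_bool ((x \<otimes> d, y) \<in> A) * of_bool ((x, y \<otimes> d) \<in> A))"
proof -
  let ?P = "carrier G \<times> carrier G"
  have "corner_set G A d = {p \<in> ?P. (\<lambda>(x, y). (x, y) \<in> A \<and> (x \<otimes> d, y) \<in> A \<and> (x, y \<otimes> d) \<in> A) p}"
    unfolding corner_set_def by auto
  then have "real (card (corner_set G A d)) =
      (\<Sum>p\<in>?P. if (\<lambda>(x, y). (x, y) \<in> A \<and> (x \<otimes> d, y) \<in> A \<and> (x, y \<otimes> d) \<in> A) p then 1 else 0)"
    using finite_carrier by (simp add: sum.inter_filter[symmetric])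
  also have "\<dots> = (\<Sum>x\<in>carrier G. \<Sum>y\<in>carrier G.
    of_bool ((x, y) \<in> A) * of_bool ((x \<otimes> d, y) \<in> A) * of_bool ((x, y \<otimes> d) \<in> A))"
    unfolding sum.cartesian_product' split by (intro sum.cong refl) auto
  finally show ?thesis .
qed

text \<open>The substitution \<open>z = x \<otimes> y \<otimes> d\<close> turns corners into triangles.\<close>

lemma sum_card_corner_set:
  fixes a :: "'a \<Rightarrow> 'a \<Rightarrow> real"
  assumes K: "\<K> \<subseteq> kernels" and a_def: "a = (\<lambda>x y. of_bool ((x, y) \<in> A))"
  shows "(\<Sum>d\<in>coset \<K> \<one>. real (card (corner_set G A d))) =
    (\<Sum>x\<in>carrier G. \<Sum>y\<in>carrier G. \<Sum>z\<in>coset \<K> (x \<otimes> y). a x y * a (y \<otimes> z) y * a x (x \<otimes> z))"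
proof -
  let ?H = "coset \<K> \<one>" and ?G = "carrier G"
  have "(\<Sum>d\<in>?H. real (card (corner_set G A d))) =
      (\<Sum>d\<in>?H. \<Sum>x\<in>?G. \<Sum>y\<in>?G. a x y * a (x \<otimes> d) y * a x (y \<otimes> d))"
    using coset_subset[of \<K> \<one>] unfolding a_def by (intro sum.cong refl card_corner_set) auto
  also have "\<dots> = (\<Sum>x\<in>?G. \<Sum>d\<in>?H. \<Sum>y\<in>?G. a x y * a (x \<otimes> d) y * a x (y \<otimes> d))"
    by (rule sum.swap)
  also have "\<dots> = (\<Sum>x\<in>?G. \<Sum>y\<in>?G. \<Sum>d\<in>?H. a x y * a (x \<otimes> d) y * a x (y \<otimes> d))"
    by (intro sum.cong refl sum.swap)
  also have "\<dots> = (\<Sum>x\<in>?G. \<Sum>y\<in>?G. \<Sum>z\<in>coset \<K> (x \<otimes> y). a x y * a (y \<otimes> z) y * a x (x \<otimes> z))"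
  proof (rule sum.cong[OF refl], rule sum.cong[OF refl])
    fix x y assume xy: "x \<in> ?G" "y \<in> ?G"
    have "(\<Sum>z\<in>coset \<K> (x \<otimes> y). a x y * a (y \<otimes> z) y * a x (x \<otimes> z)) =
        (\<Sum>d\<in>?H. a x y * a (y \<otimes> (x \<otimes> y \<otimes> d)) y * a x (x \<otimes> (x \<otimes> y \<otimes> d)))"
      by (rule sum.reindex_bij_betw[OF coset_translate[OF K m_closed[OF xy]], symmetric])
    also have "\<dots> = (\<Sum>d\<in>?H. a x y * a (x \<otimes> d) y * a x (y \<otimes> d))"
    proof (intro sum.cong refl)
      fix d assume "d \<in> ?H"
      then have d: "d \<in> ?G" using coset_subset by blast
      have "y \<otimes> (x \<otimes> y \<otimes> d) = x \<otimes> d" "x \<otimes> (x \<otimes> y \<otimes> d) = y \<otimes> d"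
        using xy d by (simp_all add: m_assoc m_lcomm[of y x] mult_self_left)
      then show "a x y * a (y \<otimes> (x \<otimes> y \<otimes> d)) y * a x (x \<otimes> (x \<otimes> y \<otimes> d)) =
          a x y * a (x \<otimes> d) y * a x (y \<otimes> d)" by simp
    qed
    finally show "(\<Sum>d\<in>?H. a x y * a (x \<otimes> d) y * a x (y \<otimes> d)) =
        (\<Sum>z\<in>coset \<K> (x \<otimes> y). a x y * a (y \<otimes> z) y * a x (x \<otimes> z))" ..
  qed
  finally show ?thesis .
qed

text \<open>The loss \<open>5 * \<eta>\<close> consists of \<open>2 * \<eta>\<close> from the passage to cell densities and of \<open>3 * \<eta>\<close> from
equidistribution, \<open>\<eta>\<close> for each factor.\<close>

lemma average_corner_count:
  fixes m :: "real \<Rightarrow> real"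
  assumes A: "A \<subseteq> carrier G \<times> carrier G" and \<eta>: "\<eta> > 0"
    and m: "convex_on {0..1} m" "\<And>\<alpha>. \<alpha> \<in> {0..1} \<Longrightarrow> m \<alpha> \<le> m_function \<alpha>"
  obtains H \<beta> where "\<one> \<in> H" "H \<subseteq> carrier G" "order G \<le> 2 ^ complexity_bound \<eta> * card H"
    and "\<beta> \<in> {0..1}" "\<beta> \<ge> pair_density G A - \<eta>"
    and "(\<Sum>d\<in>H. real (card (corner_set G A d))) \<ge> real (card H) * real (order G) ^ 2 * (m \<beta> - 5 * \<eta>)"
proof -
  let ?G = "carrier G" and ?N = "real (order G)"
  define a :: "'a \<Rightarrow> 'a \<Rightarrow> real" where "a = (\<lambda>x y. of_bool ((x, y) \<in> A))"
  let ?b = "\<lambda>y z. a (y \<otimes> z) y" and ?c = "\<lambda>x z. a x (x \<otimes> z)"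
  have bin: "a \<in> ?G \<rightarrow> ?G \<rightarrow> {0, 1}" "?b \<in> ?G \<rightarrow> ?G \<rightarrow> {0, 1}" "?c \<in> ?G \<rightarrow> ?G \<rightarrow> {0, 1}"
    unfolding a_def by (auto simp: Pi_iff)
  note unit = funcset_binary_unit[OF bin(1)]
  obtain \<B> \<K> where K: "\<K> \<subseteq> kernels" "\<K> \<subseteq> \<B>" "finite \<B>" and card: "card \<K> \<le> complexity_bound \<eta>"
    and unif: "uniform \<B> \<K> \<eta>"
    and count: "(\<Sum>x\<in>?G. \<Sum>y\<in>?G. \<Sum>z\<in>coset \<K> (x \<otimes> y). a x y * ?b y z * ?c x z) \<ge>
      (\<Sum>x\<in>?G. \<Sum>y\<in>?G. \<Sum>z\<in>coset \<K> (x \<otimes> y). pair_mean \<B> a x y * pair_mean \<B> ?b y z * pair_mean \<B> ?c x z) -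
      2 * \<eta> * real (card (coset \<K> \<one>)) * ?N ^ 2"
    by (rule regular_uniform_partition[OF bin \<eta>]) (rule that)
  define h where "h = real (card (coset \<K> \<one>))"
  define F where "F = line_mean \<B> a"
  define \<beta> where "\<beta> = (\<Sum>x\<in>?G. \<Sum>y\<in>?G. \<Sum>z\<in>coset \<K> (x \<otimes> y). F x y z) / (h * ?N ^ 2)"
  have N: "?N > 0" and h: "h > 0" unfolding h_def using order_pos card_coset_pos by simp_all
  have F: "F x y z \<in> {0..1}" for x y z unfolding F_def by (rule line_mean_in_unit[OF unit])
  note convex = convex_bound_on_cosets[where F = F and m = m, OF K(1) F m, folded h_def, folded \<beta>_def]
  note product = product_of_pair_means_lower_bound[OF K(1,2) unif unit, folded F_def, folded h_def]
  show thesis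
  proof (rule that)
    show "\<one> \<in> coset \<K> \<one>" by (rule coset_self) simp
    show "coset \<K> \<one> \<subseteq> ?G" by (rule coset_subset)
    have "order G \<le> 2 ^ card \<K> * card (coset \<K> \<one>)"
      using order_le_card_coset[OF K(1)] K(2,3) finite_subset by blast
    also have "\<dots> \<le> 2 ^ complexity_bound \<eta> * card (coset \<K> \<one>)"
      using card by (intro mult_le_mono power_increasing) auto
    finally show "order G \<le> 2 ^ complexity_bound \<eta> * card (coset \<K> \<one>)" .
    show "\<beta> \<in> {0..1}" by (rule convex(1))
    show "\<beta> \<ge> pair_density G A - \<eta>"
    proof -
      have "real (card A) = (\<Sum>p\<in>?G \<times> ?G. if p \<in> A then 1 else 0)"
        using A finite_carrier by (simp add: sum.inter_restrict[symmetric] Int_absorb1)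
      also have "\<dots> = (\<Sum>x\<in>?G. \<Sum>y\<in>?G. 1 * a x y)"
        unfolding sum.cartesian_product' a_def by (simp add: of_bool_def)
      finally have "\<bar>real (card A) - (\<Sum>x\<in>?G. \<Sum>y\<in>?G. 1 * ((\<Sum>z\<in>coset \<K> (x \<otimes> y). F x y z) / h))\<bar> \<le> \<eta> * ?N ^ 2"
        using sum_uniform_weight[OF unif unit, of "\<lambda>_ _. 1"] unfolding F_def h_def
        by (simp add: determined_by_def)
      moreover have "(\<Sum>x\<in>?G. \<Sum>y\<in>?G. 1 * ((\<Sum>z\<in>coset \<K> (x \<otimes> y). F x y z) / h)) = \<beta> * ?N ^ 2"
        unfolding \<beta>_def using h N by (simp add: sum_divide_distrib[symmetric])
      ultimately have "real (card A) \<le> (\<beta> + \<eta>) * ?N ^ 2" unfolding distrib_right by linarith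
      then show ?thesis unfolding pair_density_def using N by (simp add: divide_le_eq algebra_simps)
    qed
    show "(\<Sum>d\<in>coset \<K> \<one>. real (card (corner_set G A d))) \<ge>
        real (card (coset \<K> \<one>)) * ?N ^ 2 * (m \<beta> - 5 * \<eta>)"
      unfolding sum_card_corner_set[OF K(1) a_def] h_def[symmetric]
      using count[folded h_def] product convex(2) unfolding right_diff_distrib
      by (simp add: algebra_simps)
  qed
qed

text \<open>If every nonzero difference were unpopular, the average over \<open>H\<close> would exceed \<open>(m \<alpha> - \<epsilon>) N\<^sup>2\<close> by at most
the share \<open>N\<^sup>2 / |H|\<close> of the zero difference. The two conditions on \<open>\<eta>\<close> and on the order of \<open>G\<close> make
this contradict \<open>average_corner_count\<close>.\<close>

lemma popular_difference:
  fixes m :: "real \<Rightarrow> real"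
  assumes m: "m \<in> {0..1} \<rightarrow> {0..1}" "convex_on {0..1} m" "\<And>\<alpha>. \<alpha> \<in> {0..1} \<Longrightarrow> m \<alpha> \<le> m_function \<alpha>"
    and \<alpha>: "0 \<le> \<alpha>" "\<alpha> < 1" and \<epsilon>: "\<epsilon> > 0" and \<eta>: "\<eta> > 0" "5 * \<eta> + \<eta> / (1 - \<alpha>) \<le> \<epsilon> / 2"
    and large: "order G \<ge> 2" "real (order G) > 2 ^ complexity_bound \<eta> * (2 / \<epsilon>)"
    and A: "A \<subseteq> carrier G \<times> carrier G" "pair_density G A \<ge> \<alpha>"
  shows "\<exists>d \<in> carrier G - {\<one>}. real (card (corner_set G A d)) > (m \<alpha> - \<epsilon>) * real (order G) ^ 2"
proof (rule ccontr)
  assume contra: "\<not> ?thesis"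
  let ?N = "real (order G)" and ?M = "(m \<alpha> - \<epsilon>) * real (order G) ^ 2"
  obtain H \<beta> where H: "\<one> \<in> H" "H \<subseteq> carrier G" "order G \<le> 2 ^ complexity_bound \<eta> * card H"
    and \<beta>: "\<beta> \<in> {0..1}" "\<beta> \<ge> pair_density G A - \<eta>"
    and sum: "(\<Sum>d\<in>H. real (card (corner_set G A d))) \<ge> real (card H) * ?N ^ 2 * (m \<beta> - 5 * \<eta>)"
    by (rule average_corner_count[OF A(1) \<eta>(1) m(2,3)]) (assumption | rule that)+
  have N: "?N > 0" using order_pos by simp
  have finH: "finite H" using H(2) finite_carrier by (rule finite_subset)
  have unit: "0 \<le> m t" "m t \<le> 1" if "0 \<le> t" "t \<le> 1" for t using m(1) that by (auto simp: Pi_iff)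
  have m0: "m 0 \<le> 0" using m(3)[of 0] m_function_zero by simp
  have "m \<alpha> \<le> m \<beta> + \<eta> / (1 - \<alpha>)"
  proof (cases "\<alpha> \<le> \<beta>")
    case True
    then have "m \<alpha> \<le> m \<beta>" using \<alpha> \<beta>(1) unit by (intro convex_zero_mono[OF m(2) m0]) auto
    then show ?thesis using \<eta>(1) \<alpha> by (simp add: add_increasing2)
  next
    case False
    then have "m \<alpha> \<le> m \<beta> + (\<alpha> - \<beta>) / (1 - \<alpha>)"
      using \<alpha> \<beta>(1) unit by (intro convex_drop_bound[OF m(2)]) auto
    moreover have "(\<alpha> - \<beta>) / (1 - \<alpha>) \<le> \<eta> / (1 - \<alpha>)"
      using \<alpha> A(2) \<beta>(2) by (intro divide_right_mono) auto
    ultimately show ?thesis by simp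
  qed
  then have "m \<alpha> - \<epsilon> / 2 \<le> m \<beta> - 5 * \<eta>" using \<eta>(2) by linarith
  then have "real (card H) * ?N ^ 2 * (m \<alpha> - \<epsilon> / 2) \<le> real (card H) * ?N ^ 2 * (m \<beta> - 5 * \<eta>)"
    by (intro mult_left_mono) auto
  also note sum
  also have "(\<Sum>d\<in>H. real (card (corner_set G A d))) =
      real (card (corner_set G A \<one>)) + (\<Sum>d\<in>H - {\<one>}. real (card (corner_set G A d)))"
    using sum.remove[OF finH H(1)] .
  also have "\<dots> \<le> ?N ^ 2 + (\<Sum>d\<in>H - {\<one>}. ?M)"
  proof (intro add_mono sum_mono)
    have "card (corner_set G A \<one>) \<le> card (carrier G \<times> carrier G)"
      using finite_carrier by (intro card_mono) (auto simp: corner_set_def)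
    then show "real (card (corner_set G A \<one>)) \<le> ?N ^ 2"
      by (simp add: card_cartesian_product order_def power2_eq_square flip: of_nat_mult)
  qed (use contra H(2) in \<open>auto simp: not_less\<close>)
  \<comment> \<open>Here \<open>?M\<close> is not negative, because some nonidentity difference exists and its count is at most \<open>?M\<close>.\<close>
  also have "(\<Sum>d\<in>H - {\<one>}. ?M) \<le> real (card H) * ?M"
  proof -
    have "card {\<one>} < card (carrier G)" using large(1) by (simp add: order_def)
    then have "carrier G - {\<one>} \<noteq> {}" using card_mono[of "{\<one>}" "carrier G"] by auto
    then obtain d where "d \<in> carrier G - {\<one>}" by blast
    then have "real (card (corner_set G A d)) \<le> ?M" using contra by (simp add: not_less)
    then have "0 \<le> ?M" by (rule order_trans[rotated]) simp
    then have "real (card (H - {\<one>})) * ?M \<le> real (card H) * ?M"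
      using finH by (intro mult_right_mono) (auto intro: card_mono)
    then show ?thesis by simp
  qed
  finally have "?N ^ 2 * (real (card H) * \<epsilon> / 2) \<le> ?N ^ 2 * 1"
    by (simp add: algebra_simps)
  then have "real (card H) * \<epsilon> \<le> 2" using N by simp
  then have small: "real (card H) \<le> 2 / \<epsilon>" using \<epsilon> by (simp add: le_divide_eq)
  have "?N \<le> real (2 ^ complexity_bound \<eta> * card H)" using H(3) by (simp only: of_nat_le_iff)
  also have "\<dots> = 2 ^ complexity_bound \<eta> * real (card H)" by simp
  also have "\<dots> \<le> 2 ^ complexity_bound \<eta> * (2 / \<epsilon>)" using small by (intro mult_left_mono) auto
  finally show False using large(2) by simp
qed

lemma corner_set_full:
  assumes A: "A \<subseteq> carrier G \<times> carrier G" "pair_density G A \<ge> 1" and d: "d \<in> carrier G"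
  shows "card (corner_set G A d) = order G ^ 2"
proof -
  have card: "card (carrier G \<times> carrier G) = order G ^ 2"
    by (simp add: card_cartesian_product order_def power2_eq_square)
  have "real (order G ^ 2) \<le> real (card A)"
    using A(2) order_pos unfolding pair_density_def by (simp add: le_divide_eq)
  then have "A = carrier G \<times> carrier G"
    using A(1) finite_carrier card by (intro card_seteq) (auto simp only: of_nat_le_iff finite_cartesian_product)
  then have "corner_set G A d = carrier G \<times> carrier G" using d unfolding corner_set_def by auto
  then show ?thesis using card by simp
qed

end

section \<open>Powers of the field with two elements\<close>

text \<open>The character \<open>x \<mapsto> (-1) ^ (\<Sum>i\<in>S. x i)\<close>, written as a product so that summing over all \<open>S\<close> factorises.\<close>

definition F2_character :: "nat set \<Rightarrow> (nat \<Rightarrow> int) \<Rightarrow> real" where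
  "F2_character S x = (\<Prod>i\<in>S. if x i = 0 then 1 else -1)"

lemma carrier_F2_power: "carrier (F2_power n) = {..<n} \<rightarrow>\<^sub>E {0, 1}"
proof -
  have "{0..<2} = {0, 1 :: int}" by auto
  then show ?thesis by (simp add: F2_power_def carrier_integer_mod_group)
qed

lemma inj_on_F2_character: "inj_on F2_character (Pow {..<n})"
proof (rule inj_onI)
  fix S T assume ST: "S \<in> Pow {..<n}" "T \<in> Pow {..<n}" and eq: "F2_character S = F2_character T"
  have "F2_character U (\<lambda>j. if j = i then 1 else 0) = (if i \<in> U then -1 else 1)" if "U \<in> Pow {..<n}" for U i
  proof -
    have "finite U" using that finite_subset by blast
    have "F2_character U (\<lambda>j. if j = i then 1 else 0) = (\<Prod>j\<in>U. if j = i then -1 else 1)"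
      unfolding F2_character_def by (intro prod.cong) auto
    then show ?thesis using \<open>finite U\<close> by simp
  qed
  note eval = this
  have "i \<in> S \<longleftrightarrow> i \<in> T" for i
  proof -
    have "(if i \<in> S then -1 else 1 :: real) = (if i \<in> T then -1 else 1)"
      using eval[OF ST(1), of i] eval[OF ST(2), of i] unfolding eq by (rule trans[OF sym])
    then show ?thesis by (simp split: if_splits)
  qed
  then show "S = T" by blast
qed

lemma sum_F2_character:
  assumes "x \<in> carrier (F2_power n)"
  shows "(\<Sum>S\<in>Pow {..<n}. F2_character S x) = (if x = \<one>\<^bsub>F2_power n\<^esub> then 2 ^ n else 0)"
proof -
  let ?s = "\<lambda>i. if x i = 0 then 1 else (-1 :: real)"
  have "(\<Sum>S\<in>Pow {..<n}. F2_character S x) = (\<Prod>i<n. ?s i + 1)"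
    using prod_add[of "{..<n}" ?s "\<lambda>_. 1"] by (simp add: F2_character_def)
  also have "\<dots> = (if x = \<one>\<^bsub>F2_power n\<^esub> then 2 ^ n else 0)"
  proof (cases "x = \<one>\<^bsub>F2_power n\<^esub>")
    case True
    then have "x i = 0" if "i < n" for i using that by (simp add: F2_power_def)
    then show ?thesis using True by simp
  next
    case False
    have ext: "x \<in> extensional {..<n}" "\<one>\<^bsub>F2_power n\<^esub> \<in> extensional {..<n}"
      using assms unfolding carrier_F2_power by (auto simp: PiE_def F2_power_def)
    obtain i where "i < n" "x i \<noteq> 0"
    proof (rule ccontr)
      assume "\<not> thesis"
      with that have "\<And>i. i < n \<Longrightarrow> x i = 0" by blast
      then have "x = \<one>\<^bsub>F2_power n\<^esub>" by (intro extensionalityI[OF ext]) (simp add: F2_power_def)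
      then show False using False by simp
    qed
    then show ?thesis using False by (auto intro!: prod_zero)
  qed
  finally show ?thesis .
qed

lemma boolean_group_F2_power: "boolean_group (F2_power n) (F2_character ` Pow {..<n})"
proof -
  interpret comm_group "F2_power n" by (rule comm_group_F2_power)
  have val: "x i = 0 \<or> x i = 1" if "x \<in> carrier (F2_power n)" "i < n" for x i
    using that unfolding carrier_F2_power by (auto dest: PiE_mem)
  have mult: "(x \<otimes>\<^bsub>F2_power n\<^esub> y) i = (x i + y i) mod 2" if "i < n" for x y i
    using that by (simp add: F2_power_def)
  show ?thesis
  proof
    show "finite (carrier (F2_power n))" by (rule finite_F2_power)
    show "x \<otimes>\<^bsub>F2_power n\<^esub> x = \<one>\<^bsub>F2_power n\<^esub>" if "x \<in> carrier (F2_power n)" for x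
      using val[OF that] by (auto simp: F2_power_def intro!: restrict_ext)
    show "finite (F2_character ` Pow {..<n})" by simp
    show "\<xi> x = 1 \<or> \<xi> x = -1" if \<xi>: "\<xi> \<in> F2_character ` Pow {..<n}" for \<xi> x
    proof -
      obtain S where "\<xi> = F2_character S" using \<xi> by blast
      moreover
      have "\<bar>F2_character S x\<bar> = 1" unfolding F2_character_def abs_prod by (intro prod.neutral) auto
      then have "F2_character S x = 1 \<or> F2_character S x = -1" by linarith
      ultimately show ?thesis by simp
    qed
    show "\<xi> (x \<otimes>\<^bsub>F2_power n\<^esub> y) = \<xi> x * \<xi> y"
      if \<xi>: "\<xi> \<in> F2_character ` Pow {..<n}" and xy: "x \<in> carrier (F2_power n)" "y \<in> carrier (F2_power n)" for \<xi> x y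
    proof -
      obtain S where S: "\<xi> = F2_character S" "S \<subseteq> {..<n}" using \<xi> by blast
      show ?thesis
        unfolding S(1) F2_character_def prod.distrib[symmetric]
      proof (rule prod.cong[OF refl])
        fix i assume "i \<in> S"
        then have "i < n" using S(2) by blast
        then show "(if (x \<otimes>\<^bsub>F2_power n\<^esub> y) i = 0 then 1 else -1) =
            (if x i = 0 then 1 else -1) * (if y i = 0 then 1 else (-1 :: real))"
          using val[OF xy(1), of i] val[OF xy(2), of i] by (auto simp: mult)
      qed
    qed
    show "(\<Sum>\<xi>\<in>F2_character ` Pow {..<n}. \<xi> x) = (if x = \<one>\<^bsub>F2_power n\<^esub> then real (order (F2_power n)) else 0)"
      if "x \<in> carrier (F2_power n)" for x
      using sum_F2_character[OF that] by (simp add: sum.reindex[OF inj_on_F2_character] order_F2_power)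
  qed
qed

theorem theorem4:
  fixes m' :: "real \<Rightarrow> real"
  assumes "m' \<in> {0..1} \<rightarrow> {0..1}"
    and "convex_on {0..1} m'"
    and "\<And>\<alpha>. \<alpha> \<in> {0..1} \<Longrightarrow> m' \<alpha> \<le> m_function \<alpha>"
  shows "\<forall>\<alpha>\<in>{0..1}. threshold_density {F2_power n | n. n \<ge> 1} \<alpha> \<ge> m' \<alpha>"
proof
  fix \<alpha> :: real assume \<alpha>: "\<alpha> \<in> {0..1}"
  let ?\<G> = "{F2_power n | n. n \<ge> 1}"
  have "popular_corner_bound ?\<G> \<alpha> (m' \<alpha>)"
    unfolding popular_corner_bound_def
  proof (intro allI impI)
    fix \<epsilon> :: real assume \<epsilon>: "\<epsilon> > 0"
    show "\<exists>N\<^sub>0. \<forall>G\<in>?\<G>. order G \<ge> N\<^sub>0 \<longrightarrow> (\<forall>A \<subseteq> carrier G \<times> carrier G. pair_density G A \<ge> \<alpha> \<longrightarrow>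
       (\<exists>d \<in> carrier G - {\<one>\<^bsub>G\<^esub>}. real (card (corner_set G A d)) > (m' \<alpha> - \<epsilon>) * real (order G) ^ 2))"
    proof (cases "\<alpha> = 1")
      case True
      show ?thesis
      proof (intro exI[of _ 2] ballI allI impI)
        fix G A assume G: "G \<in> ?\<G>" and order: "2 \<le> order G"
          and A: "A \<subseteq> carrier G \<times> carrier G" "\<alpha> \<le> pair_density G A"
        obtain n where n: "G = F2_power n" using G by blast
        interpret boolean_group G "F2_character ` Pow {..<n}" unfolding n by (rule boolean_group_F2_power)
        have "\<not> carrier G \<subseteq> {\<one>\<^bsub>G\<^esub>}"
          using order card_mono[of "{\<one>\<^bsub>G\<^esub>}" "carrier G"] by (auto simp: order_def)
        then obtain d where d: "d \<in> carrier G - {\<one>\<^bsub>G\<^esub>}" by blast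
        have "real (card (corner_set G A d)) = real (order G) ^ 2"
          using corner_set_full[of A d] A True d by simp
        moreover have "m' \<alpha> - \<epsilon> < 1" using assms(1) \<alpha> \<epsilon> by (auto simp: Pi_iff dest!: bspec[of _ _ \<alpha>])
        then have "(m' \<alpha> - \<epsilon>) * real (order G) ^ 2 < 1 * real (order G) ^ 2"
          using order by (intro mult_strict_right_mono) auto
        ultimately show "\<exists>d \<in> carrier G - {\<one>\<^bsub>G\<^esub>}.
            real (card (corner_set G A d)) > (m' \<alpha> - \<epsilon>) * real (order G) ^ 2"
          using d by (intro bexI[of _ d]) auto
      qed
    next
      case False
      then have \<alpha>1: "0 \<le> \<alpha>" "\<alpha> < 1" using \<alpha> by auto
      \<comment> \<open>With this choice \<open>5 * \<eta> + \<eta> / (1 - \<alpha>)\<close> equals \<open>\<epsilon> / 2\<close>.\<close>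
      define D where "D = 5 + 1 / (1 - \<alpha>)"
      define \<eta> where "\<eta> = (\<epsilon> / 2) / D"
      have pos: "D > 0" unfolding D_def using \<alpha>1 by (simp add: add_pos_pos)
      then have \<eta>: "\<eta> > 0" unfolding \<eta>_def using \<epsilon> by simp
      have "5 * \<eta> + \<eta> / (1 - \<alpha>) = \<eta> * D" by (simp add: D_def algebra_simps)
      also have "\<dots> = \<epsilon> / 2" unfolding \<eta>_def using pos by simp
      finally have \<eta>_le: "5 * \<eta> + \<eta> / (1 - \<alpha>) \<le> \<epsilon> / 2" by simp
      obtain N\<^sub>0 :: nat where N0: "real N\<^sub>0 > 2 ^ complexity_bound \<eta> * (2 / \<epsilon>)"
        using reals_Archimedean2 by blast
      show ?thesis
      proof (intro exI[of _ "max 2 N\<^sub>0"] ballI allI impI)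
        fix G A assume G: "G \<in> ?\<G>" and order: "max 2 N\<^sub>0 \<le> order G"
          and A: "A \<subseteq> carrier G \<times> carrier G" "\<alpha> \<le> pair_density G A"
        obtain n where n: "G = F2_power n" using G by blast
        interpret boolean_group G "F2_character ` Pow {..<n}" unfolding n by (rule boolean_group_F2_power)
        show "\<exists>d \<in> carrier G - {\<one>\<^bsub>G\<^esub>}.
            real (card (corner_set G A d)) > (m' \<alpha> - \<epsilon>) * real (order G) ^ 2"
          using order N0 by (intro popular_difference[OF assms \<alpha>1 \<epsilon> \<eta> \<eta>_le _ _ A]) auto
      qed
    qed
  qed
  moreover have "m' \<alpha> \<in> {0..1}" using assms(1) \<alpha> by blast
  ultimately show "threshold_density ?\<G> \<alpha> \<ge> m' \<alpha>"
    by (intro threshold_density_greatest(3)) (use comm_group_F2_power finite_F2_power in auto)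
qed

end
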